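(* Let $X$ be a compact metrizable space and $T:X\to X$ a continuous map. If $h_{top}(T)>0$, then the induced system $(\mathcal{M}(X),T_* )$ has infinite topological mean dimension, i.e. $\mathrm{mdim}(\mathcal{M}(X),T_* )=\infty$. Therefore, for any such $(X,T)$, $$h_{top}(T)>0\iff \mathrm{mdim}(\mathcal{M}(X),T_* )>0\iff \mathrm{mdim}(\mathcal{M}(X),T_* )=\infty.$$
   Context: $\mathcal{M}(X)$ is the compact metrizable space of Borel probability measures on $X$ with the weak-$*$ topology, and $T_*:\mathcal{M}(X)\to\mathcal{M}(X)$, $T_*\mu=\mu\circ T^{-1}$, is the (continuous) push-forward map. $h_{top}$ denotes topological entropy. For a compact metrizable space $Y$ and a finite open cover $\mathcal{A}$ of $Y$, put $\mathrm{ord}(\mathcal{A})=\sup_{y\in Y}\sum_{A\in\mathcal{A}}1_A(y)-1$ and $D(\mathcal{A})=\min_{\mathcal{B}\succ\mathcal{A}}\mathrm{ord}(\mathcal{B})$, where $\mathcal{B}$ runs over finite open covers of $Y$ finer than $\mathcal{A}$ (every element of $\mathcal{B}$ is contained in some element of $\mathcal{A}$). The join is $\mathcal{A}\vee\mathcal{B}=\{U\cap V: U\in\mathcal{A},V\in\mathcal{B}\}$. For a continuous map $S:Y\to Y$, the (topological) mean dimension is $$\mathrm{mdim}(Y,S)=\sup_{\mathcal{A}}\lim_{n\to\infty}\frac{1}{n}D\Big(\bigvee_{i=0}^{n-1}S^{-i}\mathcal{A}\Big),$$ where $\mathcal{A}$ runs over all finite open covers of $Y$ (the limit exists by subadditivity).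 *)

theory Defs
  imports "HOL-Probability.Probability"
begin

section \<open>Finite open covers\<close>

definition finite_open_cover :: "'a topology \<Rightarrow> 'a set set \<Rightarrow> bool" where
  "finite_open_cover Y \<A> \<longleftrightarrow>
     finite \<A> \<and> (\<forall>A\<in>\<A>. openin Y A) \<and> \<Union>\<A> = topspace Y"

definition finer_cover :: "'a set set \<Rightarrow> 'a set set \<Rightarrow> bool" where
  "finer_cover \<B> \<A> \<longleftrightarrow> (\<forall>B\<in>\<B>. \<exists>A\<in>\<A>. B \<subseteq> A)"

definition cover_join :: "'a set set \<Rightarrow> 'a set set \<Rightarrow> 'a set set" where
  "cover_join \<A> \<B> = {U \<inter> V | U V. U \<in> \<A> \<and> V \<in> \<B>}"

definition cover_preimage :: "'a topology \<Rightarrow> ('a \<Rightarrow> 'a) \<Rightarrow> 'a set set \<Rightarrow> 'a set set" where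
  "cover_preimage Y f \<A> = {f -` A \<inter> topspace Y | A. A \<in> \<A>}"

text \<open>The join of the preimages of \<open>\<A>\<close> under \<open>S ^^ i\<close> for \<open>0 \<le> i < n\<close>; the
  empty join is the trivial cover, which is neutral for \<^const>\<open>cover_join\<close>.\<close>

primrec iterated_cover :: "'a topology \<Rightarrow> ('a \<Rightarrow> 'a) \<Rightarrow> 'a set set \<Rightarrow> nat \<Rightarrow> 'a set set" where
  "iterated_cover Y S \<A> 0 = {topspace Y}"
| "iterated_cover Y S \<A> (Suc n) =
     cover_join (iterated_cover Y S \<A> n) (cover_preimage Y (S ^^ n) \<A>)"

section \<open>Topological entropy\<close>

text \<open>Entropy by open covers, after Adler, Konheim and McAndrew.\<close>

definition min_subcover_card :: "'a topology \<Rightarrow> 'a set set \<Rightarrow> nat" where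
  "min_subcover_card Y \<A> = Inf {card \<B> | \<B>. \<B> \<subseteq> \<A> \<and> \<Union>\<B> = topspace Y}"

definition cover_entropy :: "'a topology \<Rightarrow> ('a \<Rightarrow> 'a) \<Rightarrow> 'a set set \<Rightarrow> real" where
  "cover_entropy Y S \<A> =
     lim (\<lambda>n. ln (real (min_subcover_card Y (iterated_cover Y S \<A> n))) / real n)"

definition top_entropy :: "'a topology \<Rightarrow> ('a \<Rightarrow> 'a) \<Rightarrow> ereal" where
  "top_entropy Y S = (SUP \<A>\<in>{\<A>. finite_open_cover Y \<A>}. ereal (cover_entropy Y S \<A>))"

section \<open>Topological mean dimension\<close>

text \<open>The values are integers because the order of the empty cover is \<open>-1\<close>.\<close>

definition cover_ord :: "'a topology \<Rightarrow> 'a set set \<Rightarrow> int" where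
  "cover_ord Y \<A> = int (SUP y\<in>topspace Y. \<Sum>A\<in>\<A>. indicator A y) - 1"

definition cover_dim :: "'a topology \<Rightarrow> 'a set set \<Rightarrow> int" where
  "cover_dim Y \<A> = Inf {cover_ord Y \<B> | \<B>. finite_open_cover Y \<B> \<and> finer_cover \<B> \<A>}"

definition mean_dim :: "'a topology \<Rightarrow> ('a \<Rightarrow> 'a) \<Rightarrow> ereal" where
  "mean_dim Y S = (SUP \<A>\<in>{\<A>. finite_open_cover Y \<A>}.
     ereal (lim (\<lambda>n. real_of_int (cover_dim Y (iterated_cover Y S \<A> n)) / real n)))"

section \<open>The induced system on probability measures\<close>

definition borel_of_top :: "'a topology \<Rightarrow> 'a measure" where
  "borel_of_top X = sigma (topspace X) {U. openin X U}"

definition borel_probs :: "'a topology \<Rightarrow> 'a measure set" where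
  "borel_probs X = {\<mu>. prob_space \<mu> \<and> sets \<mu> = sets (borel_of_top X)}"

text \<open>The coarsest topology making \<open>\<mu> \<mapsto> \<integral>f d\<mu>\<close> continuous for every continuous real \<open>f\<close>
  on the (compact) space \<open>X\<close>.\<close>

definition prob_weak_star :: "'a topology \<Rightarrow> 'a measure topology" where
  "prob_weak_star X = topology_generated_by
     {{\<mu> \<in> borel_probs X. (\<integral>x. f x \<partial>\<mu>) \<in> U} | f U.
        continuous_map X euclideanreal f \<and> open U}"

definition push_forward :: "'a topology \<Rightarrow> ('a \<Rightarrow> 'a) \<Rightarrow> 'a measure \<Rightarrow> 'a measure" where
  "push_forward X T \<mu> = distr \<mu> (borel_of_top X) T"

end

(*
  Positive entropy: the disambiguation bound for set systems (a form of the Sauer-Shelah lemma)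
  yields a continuous f and, for infinitely many n, a set J of at least c n times in [0, n) at
  which the values 0 and 1 of f can be prescribed freely along an orbit. In windows of fixed
  length containing k of these times, the distribution of the 2^k patterns of values can be
  prescribed independently for the different windows, which embeds cubes of dimension
  const n (2^k - 1) / k into the space of measures compatibly with one fixed cover; by the
  Lebesgue covering theorem the mean dimension is at least const (2^k - 1) / k for every k.

  Zero entropy: a measure is determined at scale epsilon up to time n by the means of the
  functions f (T^j x), and Maurey's empirical method approximates this vector in normalised l2 by
  one of exp(o(n)) many averages of orbits. Counting shows that cut points in the coordinate
  axes can be chosen such that every vector of means is close to a cut point in at most delta n
  coordinates, and the corresponding cells give a cover of order at most delta n.
*)
theory Submission
  imports Defs
begin

section \<open>Subadditive sequences and disambiguation of set systems\<close>

text \<open>Free values at the times of J alone would give cubes of dimension comparable to n, hence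
  only a finite positive bound. Windows are the remedy: the parameters of a window grow
  exponentially in k, its length R only linearly. The cover must not depend on n, so it refers to
  all patterns inside a window of length R, wherever the k free times of a particular window lie; k
  is chosen from the bound to be exceeded.

  Both invariants are defined by \<open>lim\<close>, which is informative only if the limit exists.
  Independence is known for infinitely many n only, so the lower bound needs convergence, hence
  subadditivity of the dimension under joins, hence partitions of unity on the space of measures.
  This is the reason for proving that space compact and completely regular. For zero entropy the
  estimate itself yields the limit. No metric on the space of measures is used: neighborhoods,
  Lebesgue numbers and separation are all expressed by finitely many integrals.\<close>

text \<open>Supplies the existence of the limits by which \<open>cover_entropy\<close> and, for a
  nonempty space, the mean dimension of a cover are defined. The limit is the infimum of the
  quotients: an m with small quotient controls all n by division with remainder.\<close>

lemma fekete_convergent: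
  fixes a :: "nat \<Rightarrow> real"
  assumes sub: "\<And>m n. a (m + n) \<le> a m + a n" and nonneg: "\<And>n. 0 \<le> a n"
  shows "convergent (\<lambda>n. a n / real n)"
proof -
  define L where "L = (INF n\<in>{1..}. a n / real n)"
  have bdd: "bdd_below ((\<lambda>n. a n / real n) ` {1..})"
    by (rule bdd_belowI2[of _ 0]) (simp add: nonneg)
  have "(\<lambda>n. a n / real n) \<longlonglongrightarrow> L"
  proof (rule order_tendstoI)
    fix y assume "y < L"
    have "L \<le> a n / real n" if "n \<ge> 1" for n
      unfolding L_def by (rule cINF_lower[OF bdd]) (use that in auto)
    then show "\<forall>\<^sub>F n in sequentially. y < a n / real n"
      using \<open>y < L\<close> by (auto simp: eventually_sequentially intro!: exI[of _ 1] intro: less_le_trans)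
  next
    fix y assume "L < y"
    then obtain m where m: "m \<ge> 1" "a m / real m < y"
      unfolding L_def using cINF_less_iff[OF _ bdd] by auto
    define C where "C = (\<Sum>r<m. a r)"
    have mult: "a (q * m + r) \<le> real q * a m + a r" for q r
    proof (induction q)
      case (Suc q)
      have "a (Suc q * m + r) \<le> a m + a (q * m + r)"
        using sub[of m "q * m + r"] by (simp add: ac_simps)
      with Suc show ?case by (simp add: algebra_simps)
    qed simp
    have bound: "a n / real n \<le> a m / real m + C / real n" if "n \<ge> 1" for n
    proof -
      have "a n \<le> real (n div m) * a m + a (n mod m)"
        using mult[of "n div m" "n mod m"] by simp
      also have "a (n mod m) \<le> C"
        unfolding C_def using m(1) by (intro member_le_sum) (auto simp: nonneg)
      also have "real (n div m) * a m \<le> (real n / real m) * a m"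
        by (intro mult_right_mono nonneg of_nat_div_le_of_nat)
      finally show ?thesis using that m(1) by (simp add: field_simps)
    qed
    have "(\<lambda>n. a m / real m + C / real n) \<longlonglongrightarrow> a m / real m + 0"
      by (intro tendsto_intros lim_const_over_n)
    then have "\<forall>\<^sub>F n in sequentially. a m / real m + C / real n < y"
      using m(2) by (intro order_tendstoD(2)) auto
    then show "\<forall>\<^sub>F n in sequentially. a n / real n < y"
      using eventually_ge_at_top[of 1] by eventually_elim (use bound in fastforce)
  qed
  then show ?thesis by (auto simp: convergent_def)
qed

text \<open>Chernoff's bound: for 0 < t \<le> 1 the sum is at most (1 + t)^n / t^m. With t at most
  \<eta>/2 the numerator costs exp(\<eta> n / 2), and \<open>c\<close> is the ratio m / n up to
  which t^(-m) costs no more than that.\<close>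

lemma binomial_sum_le_exp:
  assumes "0 < (\<eta>::real)"
  shows "\<exists>c>0. \<forall>n m. real m \<le> c * real n \<longrightarrow> real (\<Sum>i\<le>m. n choose i) \<le> exp (\<eta> * real n)"
proof -
  define t where "t = min (\<eta>/2) (1/2)"
  have t: "0 < t" "t \<le> 1/2" "t \<le> \<eta>/2" using assms by (auto simp: t_def)
  define c where "c = \<eta> / (2 * ln (1/t))"
  have lt: "0 < ln (1/t)" using t by (intro ln_gt_zero) auto
  have c: "c > 0" using lt assms by (simp add: c_def)
  have "real (\<Sum>i\<le>m. n choose i) \<le> exp (\<eta> * real n)" if m: "real m \<le> c * real n" for n m
  proof -
    have "real (\<Sum>i\<le>m. n choose i) * t^m = (\<Sum>i\<le>m. real (n choose i) * t^m)"
      by (simp add: sum_distrib_right)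
    also have "\<dots> \<le> (\<Sum>i\<le>m. real (n choose i) * t^i)"
      using t by (intro sum_mono mult_left_mono power_decreasing) auto
    also have "\<dots> \<le> (\<Sum>i\<le>m+n. real (n choose i) * t^i)"
      using t by (intro sum_mono2) auto
    also have "\<dots> = (\<Sum>i\<le>n. real (n choose i) * t^i)"
      using t by (intro sum.mono_neutral_right) (auto simp: binomial_eq_0)
    also have "\<dots> = (t + 1)^n"
      by (simp add: binomial_ring)
    also have "\<dots> \<le> exp t ^ n"
      using t by (intro power_mono) (auto simp: add.commute)
    finally have "real (\<Sum>i\<le>m. n choose i) \<le> exp (real n * t) / t^m"
      using t by (simp add: exp_of_nat_mult pos_le_divide_eq)
    also have "\<dots> = exp (real n * t + real m * ln (1/t))"
      using t by (simp add: exp_add exp_of_nat_mult exp_diff ln_div power_one_over exp_minus field_simps)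
    also have "\<dots> \<le> exp (\<eta> * real n)"
    proof -
      have "real m * ln (1/t) \<le> c * real n * ln (1/t)"
        using m lt by (intro mult_right_mono) auto
      also have "\<dots> = \<eta>/2 * real n" using lt by (simp add: c_def)
      finally have "real m * ln (1/t) \<le> \<eta>/2 * real n" .
      moreover have "real n * t \<le> real n * (\<eta>/2)" using t by (intro mult_left_mono) auto
      ultimately show ?thesis by (simp add: algebra_simps)
    qed
    finally show ?thesis .
  qed
  then show ?thesis using c by blast
qed

lemma card_subsets_le: 
  assumes "finite I"
  shows "card {J. J \<subseteq> I \<and> card J \<le> k} = (\<Sum>i\<le>k. card I choose i)"
proof -
  have "{J. J \<subseteq> I \<and> card J \<le> k} = (\<Union>i\<le>k. {J. J \<subseteq> I \<and> card J = i})" by auto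
  also have "card \<dots> = (\<Sum>i\<le>k. card {J. J \<subseteq> I \<and> card J = i})"
    using assms by (intro card_UN_disjoint) (auto intro: finite_subset[of _ "Pow I"])
  finally show ?thesis using assms by (simp add: n_subsets)
qed

lemma sum_binomial_Suc:
  "(\<Sum>i\<le>Suc m. Suc n choose i) = (\<Sum>i\<le>Suc m. n choose i) + (\<Sum>i\<le>m. n choose i)"
  by (induction m) auto

section \<open>Shattering and disambiguation for partial binary functions\<close>

text \<open>A point x is regarded as a partial binary function of j: its value is a where x lies in
  \<open>A a j\<close>, and it has no value where x lies in neither set. This is shattering in the
  sense of Vapnik and Chervonenkis for such functions; the empty set is shattered exactly when Y is
  nonempty.\<close>

definition shattered :: "(bool \<Rightarrow> 'j \<Rightarrow> 'a set) \<Rightarrow> 'a set \<Rightarrow> 'j set \<Rightarrow> bool" where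
  "shattered A Y J \<longleftrightarrow> (\<forall>\<omega>. \<exists>x\<in>Y. \<forall>j\<in>J. x \<in> A (\<omega> j) j)"

lemma shattered_mono: "shattered A Y J \<Longrightarrow> Y \<subseteq> Y' \<Longrightarrow> shattered A Y' J"
  unfolding shattered_def by blast

text \<open>The negation of f extends the partial function given by x. The induction removes one
  coordinate j. A set shattered by both halves \<open>Y \<inter> A True j\<close> and
  \<open>Y \<inter> A False j\<close> counts twice, with and without j, so one half, say with value
  a at j, shatters fewer than 2^m subsets of I. On it m drops by one and f j is \<not> a, which is
  safe by disjointness. The points outside \<open>A a j\<close> keep m and get f j = a. Pascal's
  rule adds the two bounds. Bounding the number of shattered sets, rather than their size, is what
  makes the halving work.\<close>

lemma disambiguation:
  assumes "finite I" and disj: "\<And>j. j \<in> I \<Longrightarrow> A True j \<inter> A False j = {}"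
    and "card {J. J \<subseteq> I \<and> shattered A Y J} < 2 ^ (m + 1)"
  shows "\<exists>F. finite F \<and> card F \<le> (\<Sum>i\<le>m. card I choose i)
    \<and> (\<forall>x\<in>Y. \<exists>f\<in>F. \<forall>j\<in>I. x \<notin> A (f j) j)"
  using assms
proof (induction I arbitrary: Y m rule: finite_induct)
  case empty
  have "card {\<lambda>_::'a. True} \<le> (\<Sum>i\<le>m. card ({}::'a set) choose i)"
    by (simp add: sum.atMost_shift)
  then show ?case by (intro exI[of _ "{\<lambda>_. True}"]) auto
next
  case (insert j I)
  define sh where "sh K Z = {J. J \<subseteq> K \<and> shattered A Z J}" for K Z
  have fin_sh: "finite (sh K Z)" if "finite K" for K Z
    using that by (auto simp: sh_def intro: finite_subset[of _ "Pow K"])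
  define S where "S a = sh I (Y \<inter> A a j)" for a
  have fS: "finite (S a)" for a using fin_sh insert.hyps(1) by (simp add: S_def)
  have "card (S True) + card (S False) = card (S True \<union> S False) + card (S True \<inter> S False)"
    by (rule card_Un_Int) (use fS in auto)
  also have "card (S True \<inter> S False) = card (Set.insert j ` (S True \<inter> S False))"
    by (rule card_image[symmetric]) (use insert.hyps(2) in \<open>auto simp: inj_on_def S_def sh_def\<close>)
  also have "card (S True \<union> S False) + \<dots> = card ((S True \<union> S False) \<union> Set.insert j ` (S True \<inter> S False))"
    by (rule card_Un_disjoint[symmetric]) (use fS insert.hyps(2) in \<open>auto simp: S_def sh_def\<close>)
  also have "\<dots> \<le> card (sh (Set.insert j I) Y)"
  proof (rule card_mono[OF fin_sh])
    have 1: "S a \<subseteq> sh (Set.insert j I) Y" for a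
      unfolding S_def sh_def using shattered_mono[of A "Y \<inter> A a j" _ Y] by blast
    have "Set.insert j J \<in> sh (Set.insert j I) Y" if J: "J \<in> S True" "J \<in> S False" for J
    proof -
      have "\<exists>x\<in>Y. \<forall>i\<in>Set.insert j J. x \<in> A (\<omega> i) i" for \<omega>
      proof -
        have "J \<in> S (\<omega> j)" using J by (cases "\<omega> j") auto
        then obtain x where "x \<in> Y \<inter> A (\<omega> j) j" "\<forall>i\<in>J. x \<in> A (\<omega> i) i"
          unfolding S_def sh_def shattered_def by blast
        then show ?thesis by auto
      qed
      then show ?thesis using J by (auto simp: S_def sh_def shattered_def)
    qed
    then show "S True \<union> S False \<union> Set.insert j ` (S True \<inter> S False) \<subseteq> sh (Set.insert j I) Y"
      using 1 by blast
  qed (use insert.hyps in simp)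
  also have "\<dots> < 2 ^ (m + 1)" using insert.prems(2) by (simp add: sh_def)
  finally have "\<exists>a. card (S a) < 2 ^ m"
    by (metis add_mono_thms_linordered_semiring(1) linorder_not_less mult_2 power_Suc Suc_eq_plus1)
  then obtain a where a: "card (S a) < 2 ^ m" by blast
  have disj': "\<And>i. i \<in> I \<Longrightarrow> A True i \<inter> A False i = {}" using insert.prems(1) by auto
  have "card (sh I (Y - A a j)) \<le> card (sh (Set.insert j I) Y)"
    by (rule card_mono[OF fin_sh]) (use insert.hyps shattered_mono[of A "Y - A a j" _ Y] in \<open>auto simp: sh_def\<close>)
  then have "card {J. J \<subseteq> I \<and> shattered A (Y - A a j) J} < 2 ^ (m + 1)"
    using insert.prems(2) by (simp add: sh_def)
  from insert.IH[OF disj' this] obtain F1 where F1: "finite F1" "card F1 \<le> (\<Sum>i\<le>m. card I choose i)"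
    "\<And>x. x \<in> Y - A a j \<Longrightarrow> \<exists>f\<in>F1. \<forall>i\<in>I. x \<notin> A (f i) i" by blast
  define G1 where "G1 = (\<lambda>f. f(j := a)) ` F1"
  have G1: "\<exists>f\<in>G1. \<forall>i\<in>Set.insert j I. x \<notin> A (f i) i" if x: "x \<in> Y - A a j" for x
  proof -
    obtain f where f: "f \<in> F1" "\<forall>i\<in>I. x \<notin> A (f i) i" using F1(3)[OF x] by blast
    show ?thesis
      by (rule bexI[of _ "f(j := a)"]) (use f x insert.hyps(2) in \<open>auto simp: G1_def\<close>)
  qed
  have cG1: "finite G1" "card G1 \<le> (\<Sum>i\<le>m. card I choose i)"
    using F1 card_image_le[OF F1(1), of "\<lambda>f. f(j := a)"] by (auto simp: G1_def)
  have "\<exists>G2. finite G2 \<and> card G1 + card G2 \<le> (\<Sum>i\<le>m. card (Set.insert j I) choose i)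
    \<and> (\<forall>x\<in>Y \<inter> A a j. \<exists>f\<in>G2. \<forall>i\<in>Set.insert j I. x \<notin> A (f i) i)"
  proof (cases m)
    \<comment> \<open>Fewer than 2^0 shattered sets: not even the empty set is shattered by this
      half, so it is empty and needs no functions.\<close>
    case 0
    then have "S a = {}" using a fS by simp
    then have "{} \<notin> S a" by blast
    then have "Y \<inter> A a j = {}" by (auto simp: S_def sh_def shattered_def)
    then show ?thesis using cG1 0 by (intro exI[of _ "{}"]) auto
  next
    case (Suc m')
    have "card {J. J \<subseteq> I \<and> shattered A (Y \<inter> A a j) J} < 2 ^ (m' + 1)"
      using a Suc by (simp add: S_def sh_def)
    from insert.IH[OF disj' this] obtain F2 where F2: "finite F2" "card F2 \<le> (\<Sum>i\<le>m'. card I choose i)"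
      "\<And>x. x \<in> Y \<inter> A a j \<Longrightarrow> \<exists>f\<in>F2. \<forall>i\<in>I. x \<notin> A (f i) i" by blast
    define G2 where "G2 = (\<lambda>f. f(j := \<not> a)) ` F2"
    have "\<exists>f\<in>G2. \<forall>i\<in>Set.insert j I. x \<notin> A (f i) i" if x: "x \<in> Y \<inter> A a j" for x
    proof -
      obtain f where f: "f \<in> F2" "\<forall>i\<in>I. x \<notin> A (f i) i" using F2(3)[OF x] by blast
      have "x \<notin> A (\<not> a) j" using x insert.prems(1)[of j] by (cases a) auto
      then show ?thesis
        by (intro bexI[of _ "f(j := \<not> a)"]) (use f insert.hyps(2) in \<open>auto simp: G2_def\<close>)
    qed
    moreover have "finite G2" "card G2 \<le> (\<Sum>i\<le>m'. card I choose i)"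
      using F2 card_image_le[OF F2(1), of "\<lambda>f. f(j := \<not> a)"] by (auto simp: G2_def)
    moreover have "(\<Sum>i\<le>m. card (Set.insert j I) choose i)
      = (\<Sum>i\<le>m. card I choose i) + (\<Sum>i\<le>m'. card I choose i)"
      using insert.hyps by (simp add: sum_binomial_Suc Suc del: sum.atMost_Suc)
    ultimately show ?thesis using cG1 by (intro exI[of _ G2]) auto
  qed
  then obtain G2 where G2: "finite G2" "card G1 + card G2 \<le> (\<Sum>i\<le>m. card (Set.insert j I) choose i)"
    "\<forall>x\<in>Y \<inter> A a j. \<exists>f\<in>G2. \<forall>i\<in>Set.insert j I. x \<notin> A (f i) i" by blast
  show ?case
  proof (intro exI[of _ "G1 \<union> G2"] conjI ballI)
    show "finite (G1 \<union> G2)" using cG1 G2 by simp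
    show "card (G1 \<union> G2) \<le> (\<Sum>i\<le>m. card (Set.insert j I) choose i)"
      using card_Un_le[of G1 G2] G2(2) by linarith
    fix x assume "x \<in> Y"
    then show "\<exists>f\<in>G1 \<union> G2. \<forall>i\<in>Set.insert j I. x \<notin> A (f i) i"
      using G1[of x] G2(3) by (cases "x \<in> A a j") blast+
  qed
qed

text \<open>The binomial bound is used twice. \<open>c1\<close> makes sums up to c1 n at most
  exp(\<eta> n). If all shattered sets have fewer than c n elements, their number is at most a
  second binomial sum, which \<open>c\<close> makes at most 2^(c1 n). For m the floor of c1 n this
  is below 2^(m + 1), the threshold of \<open>disambiguation\<close>.\<close>

theorem shattered_or_disambiguation:
  assumes "0 < (\<eta>::real)"
  shows "\<exists>c>0. \<forall>(I::'j set) A (Y::'a set). finite I \<longrightarrow> (\<forall>j\<in>I. A True j \<inter> A False j = {}) \<longrightarrow>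
    (\<exists>J\<subseteq>I. c * real (card I) \<le> real (card J) \<and> shattered A Y J) \<or>
    (\<exists>F. finite F \<and> real (card F) \<le> exp (\<eta> * real (card I))
      \<and> (\<forall>x\<in>Y. \<exists>f\<in>F. \<forall>j\<in>I. x \<notin> A (f j) j))"
proof -
  obtain c1 where c1: "0 < c1"
    "\<And>n m. real m \<le> c1 * real n \<Longrightarrow> real (\<Sum>i\<le>m. n choose i) \<le> exp (\<eta> * real n)"
    using binomial_sum_le_exp[OF assms] by blast
  have "0 < c1 * ln 2" using c1(1) by simp
  then obtain c where c: "0 < c"
    "\<And>n m. real m \<le> c * real n \<Longrightarrow> real (\<Sum>i\<le>m. n choose i) \<le> exp (c1 * ln 2 * real n)"
    using binomial_sum_le_exp by blast
  show ?thesis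
  proof (intro exI[of _ c] conjI c(1) allI impI)
    fix I :: "'j set" and A :: "bool \<Rightarrow> 'j \<Rightarrow> 'a set" and Y :: "'a set"
    assume I: "finite I" "\<forall>j\<in>I. A True j \<inter> A False j = {}"
    show "(\<exists>J\<subseteq>I. c * real (card I) \<le> real (card J) \<and> shattered A Y J) \<or>
      (\<exists>F. finite F \<and> real (card F) \<le> exp (\<eta> * real (card I))
        \<and> (\<forall>x\<in>Y. \<exists>f\<in>F. \<forall>j\<in>I. x \<notin> A (f j) j))"
    proof (cases "\<exists>J\<subseteq>I. c * real (card I) \<le> real (card J) \<and> shattered A Y J")
      case False
      define n where "n = card I"
      define m where "m = nat \<lfloor>c1 * real n\<rfloor>"
      have m: "real m \<le> c1 * real n" "c1 * real n < real (m + 1)"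
        unfolding m_def using c1(1) by (auto simp: of_nat_nat) linarith
      define k where "k = nat \<lfloor>c * real n\<rfloor>"
      have k: "real k \<le> c * real n" unfolding k_def using c(1) by (auto simp: of_nat_nat)
      have "card {J. J \<subseteq> I \<and> shattered A Y J} \<le> card {J. J \<subseteq> I \<and> card J \<le> k}"
      proof (rule card_mono)
        show "finite {J. J \<subseteq> I \<and> card J \<le> k}" using I by simp
        have "card J \<le> k" if "J \<subseteq> I" "shattered A Y J" for J
        proof -
          have "real (card J) < c * real n" using False that by (auto simp: n_def not_le)
          then show ?thesis unfolding k_def by linarith
        qed
        then show "{J. J \<subseteq> I \<and> shattered A Y J} \<subseteq> {J. J \<subseteq> I \<and> card J \<le> k}" by blast
      qed
      then have "real (card {J. J \<subseteq> I \<and> shattered A Y J}) \<le> real (\<Sum>i\<le>k. n choose i)"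
        by (simp only: card_subsets_le[OF I(1)] n_def of_nat_le_iff)
      also have "\<dots> \<le> exp (c1 * ln 2 * real n)" by (rule c(2)[OF k])
      also have "\<dots> = 2 powr (c1 * real n)" by (simp add: powr_def ac_simps)
      also have "\<dots> < 2 powr (real (m + 1))" using m(2) by (intro powr_less_mono) auto
      also have "\<dots> = real (2 ^ (m + 1))" by (subst powr_realpow) auto
      finally have "card {J. J \<subseteq> I \<and> shattered A Y J} < 2 ^ (m + 1)" by linarith
      from disambiguation[OF I(1) _ this] I(2) obtain F where F: "finite F"
        "card F \<le> (\<Sum>i\<le>m. n choose i)" "\<forall>x\<in>Y. \<exists>f\<in>F. \<forall>j\<in>I. x \<notin> A (f j) j"
        by (auto simp: n_def)
      have "real (card F) \<le> exp (\<eta> * real n)"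
        using F(2) c1(2)[OF m(1)] by linarith
      then show ?thesis using F by (auto simp: n_def)
    qed blast
  qed
qed

section \<open>Finite open covers\<close>

text \<open>Members as itineraries: \<open>a i\<close> is the member of \<A> visited at time i.
  Later arguments that pick or inspect a member of the iterated cover go through this form.\<close>

lemma in_iterated_cover_iff:
  "U \<in> iterated_cover Y S \<A> n \<longleftrightarrow>
    (\<exists>a. (\<forall>i<n. a i \<in> \<A>) \<and> U = {y \<in> topspace Y. \<forall>i<n. (S ^^ i) y \<in> a i})"
proof (induction n arbitrary: U)
  case (Suc n)
  show ?case
  proof
    assume "U \<in> iterated_cover Y S \<A> (Suc n)"
    then obtain V A where V: "V \<in> iterated_cover Y S \<A> n" "A \<in> \<A>"
      "U = V \<inter> ((S ^^ n) -` A \<inter> topspace Y)"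
      by (auto simp: cover_join_def cover_preimage_def)
    then obtain a where a: "\<forall>i<n. a i \<in> \<A>" "V = {y \<in> topspace Y. \<forall>i<n. (S ^^ i) y \<in> a i}"
      using Suc by blast
    show "\<exists>a. (\<forall>i<Suc n. a i \<in> \<A>) \<and> U = {y \<in> topspace Y. \<forall>i<Suc n. (S ^^ i) y \<in> a i}"
      by (rule exI[of _ "a(n := A)"]) (use a V in \<open>auto simp: less_Suc_eq\<close>)
  next
    assume "\<exists>a. (\<forall>i<Suc n. a i \<in> \<A>) \<and> U = {y \<in> topspace Y. \<forall>i<Suc n. (S ^^ i) y \<in> a i}"
    then obtain a where a: "\<forall>i<Suc n. a i \<in> \<A>"
      "U = {y \<in> topspace Y. \<forall>i<Suc n. (S ^^ i) y \<in> a i}" by blast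
    have "{y \<in> topspace Y. \<forall>i<n. (S ^^ i) y \<in> a i} \<in> iterated_cover Y S \<A> n"
      using a(1) by (subst Suc) (intro exI[of _ a], auto)
    moreover have "(S ^^ n) -` a n \<inter> topspace Y \<in> cover_preimage Y (S ^^ n) \<A>"
      using a(1) by (auto simp: cover_preimage_def)
    moreover have "U = {y \<in> topspace Y. \<forall>i<n. (S ^^ i) y \<in> a i} \<inter> ((S ^^ n) -` a n \<inter> topspace Y)"
      using a(2) by (auto simp: less_Suc_eq)
    ultimately show "U \<in> iterated_cover Y S \<A> (Suc n)"
      unfolding iterated_cover.simps cover_join_def by blast
  qed
qed auto

lemma continuous_map_funpow:
  "continuous_map Y Y S \<Longrightarrow> continuous_map Y Y (S ^^ n)"
proof (induction n)
  case (Suc n)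
  then show ?case unfolding funpow.simps by (intro continuous_map_compose) auto
qed (simp add: id_def[symmetric] del: id_apply)

lemma funpow_in_topspace:
  "continuous_map Y Y S \<Longrightarrow> y \<in> topspace Y \<Longrightarrow> (S ^^ n) y \<in> topspace Y"
  using continuous_map_funpow[of Y S n] by (auto simp: continuous_map_def Pi_iff)

lemma finite_open_cover_join:
  assumes "finite_open_cover Y \<A>" "finite_open_cover Y \<B>"
  shows "finite_open_cover Y (cover_join \<A> \<B>)"
proof -
  have "cover_join \<A> \<B> = (\<lambda>(U, V). U \<inter> V) ` (\<A> \<times> \<B>)" by (auto simp: cover_join_def)
  moreover have "\<Union>(cover_join \<A> \<B>) = \<Union>\<A> \<inter> \<Union>\<B>" by (auto simp: cover_join_def)
  ultimately show ?thesis using assms by (auto simp: finite_open_cover_def)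
qed

lemma cover_preimage_image: "cover_preimage Y f \<A> = (\<lambda>A. f -` A \<inter> topspace Y) ` \<A>"
  by (auto simp: cover_preimage_def)

lemma finite_open_cover_preimage:
  assumes "finite_open_cover Y \<A>" "continuous_map Y Y f"
  shows "finite_open_cover Y (cover_preimage Y f \<A>)"
proof -
  have "openin Y (f -` A \<inter> topspace Y)" if "A \<in> \<A>" for A
  proof -
    have "f -` A \<inter> topspace Y = {y \<in> topspace Y. f y \<in> A}" by auto
    then show ?thesis using assms that openin_continuous_map_preimage[of Y Y f A]
      by (auto simp: finite_open_cover_def)
  qed
  moreover have "\<Union>(cover_preimage Y f \<A>) = topspace Y"
  proof -
    have "f y \<in> \<Union>\<A>" if "y \<in> topspace Y" for y
      using assms that by (auto simp: finite_open_cover_def continuous_map_def Pi_iff)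
    then show ?thesis by (auto simp: cover_preimage_image)
  qed
  ultimately show ?thesis
    using assms by (auto simp: finite_open_cover_def cover_preimage_image)
qed

lemma finite_open_cover_iterated:
  assumes "finite_open_cover Y \<A>" "continuous_map Y Y S"
  shows "finite_open_cover Y (iterated_cover Y S \<A> n)"
proof (induction n)
  case 0
  then show ?case by (simp add: finite_open_cover_def)
next
  case (Suc n)
  then show ?case
    using assms by (auto intro!: finite_open_cover_join finite_open_cover_preimage continuous_map_funpow)
qed

section \<open>Entropy of covers\<close>

lemma min_subcover_card_le:
  assumes "\<B> \<subseteq> \<A>" "\<Union>\<B> = topspace Y"
  shows "min_subcover_card Y \<A> \<le> card \<B>"
  unfolding min_subcover_card_def by (rule cInf_lower) (use assms in auto)

lemma min_subcover_card_obtain: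
  assumes "finite_open_cover Y \<A>"
  obtains \<B> where "\<B> \<subseteq> \<A>" "\<Union>\<B> = topspace Y" "card \<B> = min_subcover_card Y \<A>" "finite \<B>"
proof -
  have "min_subcover_card Y \<A> \<in> {card \<B> | \<B>. \<B> \<subseteq> \<A> \<and> \<Union>\<B> = topspace Y}"
    unfolding min_subcover_card_def
    by (rule Inf_nat_def1) (use assms in \<open>auto simp: finite_open_cover_def\<close>)
  then obtain \<B> where B: "\<B> \<subseteq> \<A>" "\<Union>\<B> = topspace Y" "card \<B> = min_subcover_card Y \<A>"
    by auto
  have "finite \<B>"
    by (rule finite_subset[OF B(1)]) (use assms in \<open>simp add: finite_open_cover_def\<close>)
  with B show ?thesis by (rule that)
qed

lemma min_subcover_card_pos:
  assumes "finite_open_cover Y \<A>" "topspace Y \<noteq> {}"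
  shows "1 \<le> min_subcover_card Y \<A>"
proof -
  obtain \<B> where B: "\<B> \<subseteq> \<A>" "\<Union>\<B> = topspace Y" "card \<B> = min_subcover_card Y \<A>" "finite \<B>"
    by (rule min_subcover_card_obtain[OF assms(1)])
  have "\<B> \<noteq> {}" using B(2) assms(2) by (metis Union_empty)
  then show ?thesis using B(3,4) by (metis Suc_leI card_gt_0_iff One_nat_def)
qed

lemma in_iterated_cover_add:
  assumes "continuous_map Y Y S" "U \<in> iterated_cover Y S \<A> m" "V \<in> iterated_cover Y S \<A> n"
  shows "U \<inter> ((S ^^ m) -` V \<inter> topspace Y) \<in> iterated_cover Y S \<A> (m + n)" (is "?L \<in> _")
proof -
  obtain a b where a: "\<forall>i<m. a i \<in> \<A>" "U = {y \<in> topspace Y. \<forall>i<m. (S ^^ i) y \<in> a i}"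
    and b: "\<forall>i<n. b i \<in> \<A>" "V = {y \<in> topspace Y. \<forall>i<n. (S ^^ i) y \<in> b i}"
    using assms(2,3) unfolding in_iterated_cover_iff by blast
  define c where "c i = (if i < m then a i else b (i - m))" for i
  have "?L = {y \<in> topspace Y. \<forall>i<m+n. (S ^^ i) y \<in> c i}" (is "_ = ?R")
  proof
    show "?L \<subseteq> ?R"
    proof
      fix y assume y: "y \<in> ?L"
      have "(S ^^ i) y \<in> c i" if "i < m + n" for i
      proof (cases "i < m")
        case True
        then show ?thesis using y a by (auto simp: c_def)
      next
        case False
        then have "(S ^^ (i - m)) ((S ^^ m) y) \<in> b (i - m)" using y b that by auto
        then have "(S ^^ (i - m + m)) y \<in> b (i - m)" by (simp add: funpow_add)
        then show ?thesis using False by (simp add: c_def)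
      qed
      then show "y \<in> ?R" using y by auto
    qed
    show "?R \<subseteq> ?L"
    proof
      fix y assume y: "y \<in> ?R"
      have "(S ^^ i) ((S ^^ m) y) \<in> b i" if "i < n" for i
      proof -
        have "(S ^^ (i + m)) y \<in> c (i + m)" using y that by auto
        then show ?thesis by (simp add: funpow_add c_def)
      qed
      moreover have "(S ^^ i) y \<in> a i" if "i < m" for i
      proof -
        have "(S ^^ i) y \<in> c i" using y that by auto
        then show ?thesis using that by (simp add: c_def)
      qed
      ultimately show "y \<in> ?L"
        using y funpow_in_topspace[OF assms(1)] by (auto simp: a b)
    qed
  qed
  moreover have "\<forall>i<m+n. c i \<in> \<A>" using a b by (auto simp: c_def)
  ultimately show ?thesis
    unfolding in_iterated_cover_iff by blast
qed

lemma min_subcover_card_add: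
  assumes "finite_open_cover Y \<A>" "continuous_map Y Y S"
  shows "min_subcover_card Y (iterated_cover Y S \<A> (m + n)) \<le>
    min_subcover_card Y (iterated_cover Y S \<A> m) * min_subcover_card Y (iterated_cover Y S \<A> n)"
proof -
  obtain \<B> where B: "\<B> \<subseteq> iterated_cover Y S \<A> m" "\<Union>\<B> = topspace Y"
    "card \<B> = min_subcover_card Y (iterated_cover Y S \<A> m)" "finite \<B>"
    by (rule min_subcover_card_obtain[OF finite_open_cover_iterated[OF assms]])
  obtain \<C> where C: "\<C> \<subseteq> iterated_cover Y S \<A> n" "\<Union>\<C> = topspace Y"
    "card \<C> = min_subcover_card Y (iterated_cover Y S \<A> n)" "finite \<C>"
    by (rule min_subcover_card_obtain[OF finite_open_cover_iterated[OF assms]])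
  define h where "h = (\<lambda>(U, V). U \<inter> ((S ^^ m) -` V \<inter> topspace Y))"
  have "h ` (\<B> \<times> \<C>) \<subseteq> iterated_cover Y S \<A> (m + n)"
    using B(1) C(1) by (auto simp: h_def intro!: in_iterated_cover_add[OF assms(2)])
  moreover have "\<Union>(h ` (\<B> \<times> \<C>)) = topspace Y"
  proof
    show "topspace Y \<subseteq> \<Union>(h ` (\<B> \<times> \<C>))"
    proof
      fix y assume y: "y \<in> topspace Y"
      then obtain U V where "U \<in> \<B>" "y \<in> U" "V \<in> \<C>" "(S ^^ m) y \<in> V"
        using B(2) C(2) funpow_in_topspace[OF assms(2), of y m] by blast
      then show "y \<in> \<Union>(h ` (\<B> \<times> \<C>))"
        using y by (intro UnionI[of "h (U, V)"]) (auto simp: h_def)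
    qed
  qed (auto simp: h_def)
  ultimately have "min_subcover_card Y (iterated_cover Y S \<A> (m + n)) \<le> card (h ` (\<B> \<times> \<C>))"
    by (rule min_subcover_card_le)
  also have "\<dots> \<le> card (\<B> \<times> \<C>)" by (rule card_image_le) (use B C in auto)
  finally show ?thesis using B(3) C(3) by (simp add: card_cartesian_product)
qed

lemma cover_entropy_tendsto:
  assumes "finite_open_cover Y \<A>" "continuous_map Y Y S"
  shows "(\<lambda>n. ln (real (min_subcover_card Y (iterated_cover Y S \<A> n))) / real n)
    \<longlonglongrightarrow> cover_entropy Y S \<A>"
proof -
  let ?N = "\<lambda>n. min_subcover_card Y (iterated_cover Y S \<A> n)"
  note foc = finite_open_cover_iterated[OF assms]
  have "convergent (\<lambda>n. ln (real (?N n)) / real n)"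
  proof (rule fekete_convergent)
    fix m n
    show "ln (real (?N (m + n))) \<le> ln (real (?N m)) + ln (real (?N n))"
    proof (cases "topspace Y = {}")
      \<comment> \<open>In the empty space the empty family is a subcover, so \<open>?N\<close> is
        constantly 0; since \<open>ln 0 = 0\<close>, subadditivity persists.\<close>
      case True
      have "?N k = 0" for k
      proof -
        have "?N k \<le> card ({} :: 'a set set)"
          by (rule min_subcover_card_le) (simp_all only: True empty_subsetI Union_empty)
        then show ?thesis by (simp only: card.empty le_zero_eq)
      qed
      then show ?thesis by simp
    next
      case False
      then have pos: "1 \<le> ?N k" for k by (rule min_subcover_card_pos[OF foc])
      have "ln (real (?N (m + n))) \<le> ln (real (?N m) * real (?N n))"
      proof (rule ln_mono)
        show "0 < real (?N (m + n))" using pos[of "m + n"] by linarith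
        show "real (?N (m + n)) \<le> real (?N m) * real (?N n)"
          using min_subcover_card_add[OF assms, of m n] by (metis of_nat_le_iff of_nat_mult)
      qed
      also have "\<dots> = ln (real (?N m)) + ln (real (?N n))"
        using pos[of m] pos[of n] by (subst ln_mult) auto
      finally show ?thesis .
    qed
  next
    fix n
    show "0 \<le> ln (real (?N n))"
    proof (cases "?N n = 0")
      case False
      then show ?thesis by (intro ln_ge_zero) linarith
    qed simp
  qed
  then show ?thesis unfolding cover_entropy_def by (rule convergent_LIMSEQ_iff[THEN iffD1])
qed

section \<open>Order and dimension of covers\<close>

text \<open>Order plus one, at a single point and as a natural number; estimates of covers are made
  in this form, without the supremum and the integer shift of \<open>cover_ord\<close>.\<close>

definition multiplicity_at :: "'a set set \<Rightarrow> 'a \<Rightarrow> nat" where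
  "multiplicity_at \<A> y = card {A\<in>\<A>. y \<in> A}"

lemma sum_indicator_eq_multiplicity:
  "finite \<A> \<Longrightarrow> (\<Sum>A\<in>\<A>. indicator A y) = multiplicity_at \<A> y"
  by (simp add: multiplicity_at_def indicator_def of_bool_def sum.If_cases Int_def)

lemma cover_ord_le_iff:
  assumes "finite \<A>" "-1 \<le> k"
  shows "cover_ord Y \<A> \<le> k \<longleftrightarrow> (\<forall>y\<in>topspace Y. int (multiplicity_at \<A> y) \<le> k + 1)"
proof (cases "topspace Y = {}")
  case True
  then show ?thesis using assms by (simp add: cover_ord_def)
next
  case False
  have bdd: "bdd_above ((\<lambda>y. multiplicity_at \<A> y) ` topspace Y)"
    by (rule bdd_aboveI2[of _ _ "card \<A>"]) (auto simp: multiplicity_at_def intro!: card_mono assms)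
  have "cover_ord Y \<A> \<le> k \<longleftrightarrow> (SUP y\<in>topspace Y. multiplicity_at \<A> y) \<le> nat (k + 1)"
    using assms by (simp add: cover_ord_def sum_indicator_eq_multiplicity) linarith
  also have "\<dots> \<longleftrightarrow> (\<forall>y\<in>topspace Y. multiplicity_at \<A> y \<le> nat (k + 1))"
    by (rule cSUP_le_iff[OF False bdd])
  also have "\<dots> \<longleftrightarrow> (\<forall>y\<in>topspace Y. int (multiplicity_at \<A> y) \<le> k + 1)"
    using assms by (auto simp: le_nat_iff)
  finally show ?thesis .
qed

lemma cover_ord_ge: "-1 \<le> cover_ord Y \<A>"
  by (simp add: cover_ord_def)

lemma cover_dim_le_ord:
  assumes "finite_open_cover Y \<B>" "finer_cover \<B> \<A>"
  shows "cover_dim Y \<A> \<le> cover_ord Y \<B>"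
  unfolding cover_dim_def
  by (rule cInf_lower) (use assms in \<open>auto intro!: bdd_belowI[of _ "-1"] cover_ord_ge\<close>)

lemma cover_dim_le:
  assumes "finite_open_cover Y \<B>" "finer_cover \<B> \<A>" "-1 \<le> k"
    "\<And>y. y \<in> topspace Y \<Longrightarrow> int (multiplicity_at \<B> y) \<le> k + 1"
  shows "cover_dim Y \<A> \<le> k"
  using cover_dim_le_ord[OF assms(1,2)] cover_ord_le_iff[of \<B> k Y] assms
  by (force simp: finite_open_cover_def)

lemma finer_cover_refl: "finer_cover \<A> \<A>"
  by (auto simp: finer_cover_def)

lemma finer_cover_trans: "finer_cover \<A> \<B> \<Longrightarrow> finer_cover \<B> \<C> \<Longrightarrow> finer_cover \<A> \<C>"
  unfolding finer_cover_def by (meson subset_trans)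

lemma cover_dim_ge:
  assumes "finite_open_cover Y \<A>"
  shows "-1 \<le> cover_dim Y \<A>"
  unfolding cover_dim_def
  by (rule cInf_greatest) (use assms finer_cover_refl cover_ord_ge in auto)

text \<open>The orders are integers bounded below, so the infimum in \<open>cover_dim\<close> is
  attained: a value below \<open>cover_dim Y \<A> + 1\<close> is already at most
  \<open>cover_dim Y \<A>\<close>.\<close>

lemma cover_dim_obtain:
  assumes "finite_open_cover Y \<A>"
  obtains \<B> where "finite_open_cover Y \<B>" "finer_cover \<B> \<A>"
    "\<forall>y\<in>topspace Y. int (multiplicity_at \<B> y) \<le> cover_dim Y \<A> + 1"
proof -
  let ?S = "{cover_ord Y \<B> | \<B>. finite_open_cover Y \<B> \<and> finer_cover \<B> \<A>}"
  have "\<exists>x\<in>?S. x < cover_dim Y \<A> + 1"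
    by (rule cInf_lessD) (use assms finer_cover_refl in \<open>auto simp: cover_dim_def\<close>)
  then obtain \<B> where B: "finite_open_cover Y \<B>" "finer_cover \<B> \<A>" "cover_ord Y \<B> \<le> cover_dim Y \<A>"
    by auto
  then show ?thesis
    using that cover_ord_le_iff[of \<B> "cover_dim Y \<A>" Y] cover_dim_ge[OF assms]
    by (auto simp: finite_open_cover_def)
qed

lemma cover_dim_lower_bound:
  assumes "finite_open_cover Y \<A>"
    and "\<And>\<B>. finite_open_cover Y \<B> \<Longrightarrow> finer_cover \<B> \<A> \<Longrightarrow>
      \<exists>y\<in>topspace Y. k + 1 \<le> multiplicity_at \<B> y"
  shows "int k \<le> cover_dim Y \<A>"
proof -
  obtain \<B> where B: "finite_open_cover Y \<B>" "finer_cover \<B> \<A>"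
    "\<forall>y\<in>topspace Y. int (multiplicity_at \<B> y) \<le> cover_dim Y \<A> + 1"
    by (rule cover_dim_obtain[OF assms(1)])
  obtain y where y: "y \<in> topspace Y" "k + 1 \<le> multiplicity_at \<B> y"
    using assms(2)[OF B(1,2)] by blast
  show ?thesis using B(3)[THEN bspec, OF y(1)] y(2) by linarith
qed

lemma cover_dim_nonneg:
  assumes "finite_open_cover Y \<A>" "topspace Y \<noteq> {}"
  shows "0 \<le> cover_dim Y \<A>"
proof -
  have "\<exists>y\<in>topspace Y. 0 + 1 \<le> multiplicity_at \<B> y" if B: "finite_open_cover Y \<B>" for \<B>
  proof -
    obtain y where y: "y \<in> topspace Y" using assms(2) by blast
    then have "{B\<in>\<B>. y \<in> B} \<noteq> {}" "finite {B\<in>\<B>. y \<in> B}"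
      using B by (auto simp: finite_open_cover_def)
    then show ?thesis using y by (auto simp: multiplicity_at_def Suc_le_eq card_gt_0_iff)
  qed
  then show ?thesis using cover_dim_lower_bound[OF assms(1), of 0] by simp
qed

lemma cover_dim_mono:
  assumes "finite_open_cover Y \<A>" "finer_cover \<A> \<A>'"
  shows "cover_dim Y \<A>' \<le> cover_dim Y \<A>"
proof -
  obtain \<B> where B: "finite_open_cover Y \<B>" "finer_cover \<B> \<A>"
    "\<forall>y\<in>topspace Y. int (multiplicity_at \<B> y) \<le> cover_dim Y \<A> + 1"
    by (rule cover_dim_obtain[OF assms(1)])
  show ?thesis
    by (rule cover_dim_le[OF B(1) finer_cover_trans[OF B(2) assms(2)] cover_dim_ge[OF assms(1)] B(3)[THEN bspec]])
qed

lemma cover_dim_preimage: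
  assumes "finite_open_cover Y \<A>" "continuous_map Y Y f"
  shows "cover_dim Y (cover_preimage Y f \<A>) \<le> cover_dim Y \<A>"
proof -
  obtain \<B> where B: "finite_open_cover Y \<B>" "finer_cover \<B> \<A>"
    "\<forall>y\<in>topspace Y. int (multiplicity_at \<B> y) \<le> cover_dim Y \<A> + 1"
    by (rule cover_dim_obtain[OF assms(1)])
  show ?thesis
  proof (rule cover_dim_le[OF finite_open_cover_preimage[OF B(1) assms(2)] _ cover_dim_ge[OF assms(1)]])
    show "finer_cover (cover_preimage Y f \<B>) (cover_preimage Y f \<A>)"
      unfolding finer_cover_def
    proof
      fix V assume "V \<in> cover_preimage Y f \<B>"
      then obtain C where C: "C \<in> \<B>" "V = f -` C \<inter> topspace Y" by (auto simp: cover_preimage_image)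
      then obtain A where "A \<in> \<A>" "C \<subseteq> A" using B(2) by (auto simp: finer_cover_def)
      then show "\<exists>A\<in>cover_preimage Y f \<A>. V \<subseteq> A"
        using C(2) by (auto simp: cover_preimage_image)
    qed
    fix y assume y: "y \<in> topspace Y"
    have "{C \<in> cover_preimage Y f \<B>. y \<in> C} \<subseteq> (\<lambda>A. f -` A \<inter> topspace Y) ` {B\<in>\<B>. f y \<in> B}"
      by (auto simp: cover_preimage_image)
    then have "multiplicity_at (cover_preimage Y f \<B>) y \<le> multiplicity_at \<B> (f y)"
      unfolding multiplicity_at_def
      by (rule surj_card_le[rotated]) (use B(1) in \<open>simp add: finite_open_cover_def\<close>)
    moreover have "f y \<in> topspace Y" using assms(2) y by (auto simp: continuous_map_def Pi_iff)
    ultimately show "int (multiplicity_at (cover_preimage Y f \<B>) y) \<le> cover_dim Y \<A> + 1"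
      using B(3)[THEN bspec, of "f y"] by linarith
  qed
qed

section \<open>Partitions of unity and subadditivity of the dimension\<close>

lemma openin_less:
  assumes "continuous_map Y euclideanreal h" "continuous_map Y euclideanreal h'"
  shows "openin Y {y \<in> topspace Y. h y < h' y}"
proof -
  have "continuous_map Y euclideanreal (\<lambda>y. h' y - h y)" using assms by (intro continuous_intros)
  from openin_continuous_map_preimage[OF this, of "{0<..}"] show ?thesis by simp
qed

text \<open>Complete regularity gives around each point a function that is 1 there and vanishes
  outside a member of the cover. By compactness finitely many of them have a positive sum; they are
  collected according to the member chosen and divided by that sum. The result is applied both to X
  and to the space of measures.\<close>

lemma partition_of_unity_finite_cover:
  assumes Y: "compact_space Y" "completely_regular_space Y" and \<A>: "finite_open_cover Y \<A>"
  shows "\<exists>w. (\<forall>A\<in>\<A>. continuous_map Y euclideanreal (w A)) \<and>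
    (\<forall>A\<in>\<A>. \<forall>y\<in>topspace Y. 0 \<le> w A y \<and> (y \<notin> A \<longrightarrow> w A y = 0)) \<and>
    (\<forall>y\<in>topspace Y. (\<Sum>A\<in>\<A>. w A y) = (1::real))"
proof -
  have fin: "finite \<A>" using \<A> by (simp add: finite_open_cover_def)
  have "\<forall>y\<in>topspace Y. \<exists>A u. A \<in> \<A> \<and> continuous_map Y euclideanreal u \<and> u y = 1 \<and>
    (\<forall>z\<in>topspace Y. 0 \<le> u z \<and> (z \<notin> A \<longrightarrow> u z = 0))"
  proof
    fix y assume y: "y \<in> topspace Y"
    then obtain A where A: "A \<in> \<A>" "y \<in> A" "openin Y A" using \<A> by (auto simp: finite_open_cover_def)
    then have "closedin Y (topspace Y - A)" "y \<in> topspace Y - (topspace Y - A)" using y by auto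
    then obtain f where f: "continuous_map Y (top_of_set {0..1::real}) f" "f y = 0"
      "f ` (topspace Y - A) \<subseteq> {1}"
      using Y(2) unfolding completely_regular_space_def by blast
    then have "continuous_map Y euclideanreal f" "f ` topspace Y \<subseteq> {0..1}"
      by (auto simp: continuous_map_in_subtopology)
    then show "\<exists>A u. A \<in> \<A> \<and> continuous_map Y euclideanreal u \<and> u y = 1 \<and>
      (\<forall>z\<in>topspace Y. 0 \<le> u z \<and> (z \<notin> A \<longrightarrow> u z = 0))"
      using A f(2,3) by (intro exI[of _ A] exI[of _ "\<lambda>z. 1 - f z"])
        (auto intro!: continuous_intros simp: image_subset_iff)
  qed
  then obtain a u where au: "\<And>y. y \<in> topspace Y \<Longrightarrow> a y \<in> \<A>"
    "\<And>y. y \<in> topspace Y \<Longrightarrow> continuous_map Y euclideanreal (u y)"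
    "\<And>y. y \<in> topspace Y \<Longrightarrow> u y y = 1"
    "\<And>y z. y \<in> topspace Y \<Longrightarrow> z \<in> topspace Y \<Longrightarrow> 0 \<le> u y z"
    "\<And>y z. y \<in> topspace Y \<Longrightarrow> z \<in> topspace Y \<Longrightarrow> z \<notin> a y \<Longrightarrow> u y z = 0"
    unfolding bchoice_iff by blast
  define V where "V y = {z \<in> topspace Y. u y z \<in> {0<..}}" for y
  have "openin Y (V y)" if "y \<in> topspace Y" for y
    unfolding V_def by (rule openin_continuous_map_preimage[OF au(2)[OF that]]) auto
  moreover have "topspace Y \<subseteq> \<Union>(V ` topspace Y)" using au(3) by (auto simp: V_def)
  ultimately obtain \<F> where F: "finite \<F>" "\<F> \<subseteq> V ` topspace Y" "topspace Y \<subseteq> \<Union>\<F>"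
    using Y(1) unfolding compact_space_alt by (metis (no_types, lifting) imageE)
  then obtain P where P: "finite P" "P \<subseteq> topspace Y" "topspace Y \<subseteq> \<Union>(V ` P)"
    by (metis finite_subset_image)
  define v where "v A z = (\<Sum>y\<in>{y\<in>P. a y = A}. u y z)" for A z
  have contv: "continuous_map Y euclideanreal (v A)" for A
    unfolding v_def using P au(2) by (intro continuous_map_sum) auto
  have v0: "0 \<le> v A z" if "z \<in> topspace Y" for A z
    unfolding v_def using P(2) au(4) that by (intro sum_nonneg) auto
  have v1: "v A z = 0" if "z \<in> topspace Y" "z \<notin> A" for A z
    unfolding v_def using P(2) au(5) that by (intro sum.neutral) auto
  define s where "s z = (\<Sum>A\<in>\<A>. v A z)" for z
  have conts: "continuous_map Y euclideanreal s"
    unfolding s_def by (intro continuous_map_sum fin contv)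
  have spos: "0 < s z" if z: "z \<in> topspace Y" for z
  proof -
    obtain y where y: "y \<in> P" "0 < u y z" using P(3) z by (auto simp: V_def)
    have "u y z \<le> v (a y) z"
      unfolding v_def using P y au(4) z by (intro member_le_sum) auto
    also have "\<dots> \<le> s z"
      unfolding s_def using fin au(1) P(2) y(1) v0 z by (intro member_le_sum) auto
    finally show ?thesis using y by simp
  qed
  show ?thesis
  proof (intro exI[of _ "\<lambda>A z. v A z / s z"] conjI ballI impI)
    show "continuous_map Y euclideanreal (\<lambda>z. v A z / s z)" for A
      using spos by (intro continuous_map_real_divide contv conts) force
    show "0 \<le> v A y / s y" if "y \<in> topspace Y" for A y
      using v0[OF that] spos[OF that] by simp
    show "v A y / s y = 0" if "y \<in> topspace Y" "y \<notin> A" for A y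
      using v1[OF that] by simp
    show "(\<Sum>A\<in>\<A>. v A y / s y) = 1" if "y \<in> topspace Y" for y
      using spos[OF that] by (simp add: s_def flip: sum_divide_distrib)
  qed
qed

text \<open>The rank of i in I plus the rank of j in J increases strictly along the lexicographic
  order on R. Ranks start at 0, so the sum takes at most \<open>card I + card J - 1\<close>
  values.\<close>

lemma card_chain_in_product:
  fixes I J :: "nat set"
  assumes fin: "finite I" "finite J" and R: "R \<subseteq> I \<times> J"
    and chain: "\<And>i j i' j'. (i, j) \<in> R \<Longrightarrow> (i', j') \<in> R \<Longrightarrow> i < i' \<Longrightarrow> j \<le> j'"
  shows "card R \<le> card I + card J - 1"
proof -
  define r where "r = (\<lambda>(i, j). card {k\<in>I. k < i} + card {k\<in>J. k < j})"
  have less: "card {k\<in>K. k < i} < card {k\<in>K. k < i'}" if "finite K" "i \<in> K" "i < i'" for K and i i' :: nat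
    by (rule psubset_card_mono) (use that in auto)
  have le: "card {k\<in>K. k < i} \<le> card {k\<in>K. k < i'}" if "finite K" "i \<le> i'" for K and i i' :: nat
    by (rule card_mono) (use that in auto)
  have "r (i, j) < r (i', j')" if "(i, j) \<in> R" "(i', j') \<in> R" "i < i' \<or> i = i' \<and> j < j'" for i j i' j'
    using that(3)
  proof
    assume "i < i'"
    then show ?thesis
      using less[OF fin(1), of i i'] le[OF fin(2) chain[OF that(1,2)]] that R by (auto simp: r_def)
  next
    assume "i = i' \<and> j < j'"
    then show ?thesis using less[OF fin(2), of j j'] that R by (auto simp: r_def)
  qed
  note mono = this
  have "inj_on r R"
  proof (rule inj_onI, clarify)
    fix i j i' j' assume *: "(i, j) \<in> R" "(i', j') \<in> R" "r (i, j) = r (i', j')"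
    then have "\<not> (i < i' \<or> i = i' \<and> j < j')" "\<not> (i' < i \<or> i' = i \<and> j' < j)"
      using mono[of i j i' j'] mono[of i' j' i j] by auto
    then show "i = i' \<and> j = j'" by auto
  qed
  moreover have "r ` R \<subseteq> {..<card I + card J - 1}"
  proof clarsimp
    fix i j assume "(i, j) \<in> R"
    then have "i \<in> I" "j \<in> J" using R by auto
    then have "card {k\<in>I. k < i} < card I" "card {k\<in>J. k < j} < card J"
      using fin by (auto intro!: psubset_card_mono)
    then show "r (i, j) < card I + card J - Suc 0" by (simp add: r_def)
  qed
  ultimately show ?thesis by (metis card_inj_on_le card_lessThan finite_lessThan)
qed

text \<open>Two partitions of unity cut \<open>[0, 1)\<close> at their partial sums into intervals of lengths
  \<open>f i y\<close> and \<open>g j y\<close>. The pairs of overlapping intervals form a chain, so at most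
  \<open>a + b - 1\<close> pairs overlap if \<open>a\<close> and \<open>b\<close> of the intervals are nonempty.\<close>

lemma cover_dim_join:
  assumes Y: "compact_space Y" "completely_regular_space Y" "topspace Y \<noteq> {}"
    and \<A>: "finite_open_cover Y \<A>" and \<B>: "finite_open_cover Y \<B>"
  shows "cover_dim Y (cover_join \<A> \<B>) \<le> cover_dim Y \<A> + cover_dim Y \<B>"
proof -
  obtain \<A>' where A': "finite_open_cover Y \<A>'" "finer_cover \<A>' \<A>"
    "\<forall>y\<in>topspace Y. int (multiplicity_at \<A>' y) \<le> cover_dim Y \<A> + 1"
    by (rule cover_dim_obtain[OF \<A>])
  obtain \<B>' where B': "finite_open_cover Y \<B>'" "finer_cover \<B>' \<B>"
    "\<forall>y\<in>topspace Y. int (multiplicity_at \<B>' y) \<le> cover_dim Y \<B> + 1"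
    by (rule cover_dim_obtain[OF \<B>])
  have enum: "\<exists>(p::nat) a f. bij_betw a {..<p} \<C> \<and> (\<forall>i<p. continuous_map Y euclideanreal (f i)) \<and>
    (\<forall>i<p. \<forall>y\<in>topspace Y. 0 \<le> f i y \<and> (y \<notin> a i \<longrightarrow> f i y = 0)) \<and>
    (\<forall>y\<in>topspace Y. (\<Sum>i<p. f i y) = (1::real))" if \<C>: "finite_open_cover Y \<C>" for \<C>
  proof -
    obtain w where w: "\<forall>A\<in>\<C>. continuous_map Y euclideanreal (w A)"
      "\<forall>A\<in>\<C>. \<forall>y\<in>topspace Y. 0 \<le> w A y \<and> (y \<notin> A \<longrightarrow> w A y = 0)"
      "\<forall>y\<in>topspace Y. (\<Sum>A\<in>\<C>. w A y) = (1::real)"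
      using partition_of_unity_finite_cover[OF Y(1,2) \<C>] by blast
    have "finite \<C>" using \<C> by (simp add: finite_open_cover_def)
    then obtain a where a: "bij_betw a {..<card \<C>} \<C>"
      using ex_bij_betw_nat_finite by (auto simp: atLeast0LessThan)
    have "a i \<in> \<C>" if "i < card \<C>" for i using a that by (auto dest: bij_betwE)
    moreover have "(\<Sum>i<card \<C>. w (a i) y) = (\<Sum>A\<in>\<C>. w A y)" for y
      by (rule sum.reindex_bij_betw[OF a])
    ultimately show ?thesis using a w
      by (intro exI[of _ "card \<C>"] exI[of _ a] exI[of _ "\<lambda>i. w (a i)"]) auto
  qed
  obtain p a f where f: "bij_betw a {..<p::nat} \<A>'" "\<And>i. i < p \<Longrightarrow> continuous_map Y euclideanreal (f i)"
    "\<And>i y. i < p \<Longrightarrow> y \<in> topspace Y \<Longrightarrow> 0 \<le> f i y"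
    "\<And>i y. i < p \<Longrightarrow> y \<in> topspace Y \<Longrightarrow> y \<notin> a i \<Longrightarrow> f i y = 0"
    "\<And>y. y \<in> topspace Y \<Longrightarrow> (\<Sum>i<p. f i y) = (1::real)"
    using enum[OF A'(1)] by metis
  obtain q b g where g: "bij_betw b {..<q::nat} \<B>'" "\<And>i. i < q \<Longrightarrow> continuous_map Y euclideanreal (g i)"
    "\<And>i y. i < q \<Longrightarrow> y \<in> topspace Y \<Longrightarrow> 0 \<le> g i y"
    "\<And>i y. i < q \<Longrightarrow> y \<in> topspace Y \<Longrightarrow> y \<notin> b i \<Longrightarrow> g i y = 0"
    "\<And>y. y \<in> topspace Y \<Longrightarrow> (\<Sum>i<q. g i y) = (1::real)"
    using enum[OF B'(1)] by metis
  define F where "F i y = (\<Sum>k<i. f k y)" for i y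
  define G where "G i y = (\<Sum>k<i. g k y)" for i y
  \<comment> \<open>The four inequalities say that the larger left end is smaller than the smaller
    right end, so the two intervals are nonempty and overlap. In this strict form the condition is
    open in y.\<close>
  define P where "P i j = {y \<in> topspace Y. F i y < F (Suc i) y \<and> F i y < G (Suc j) y
    \<and> G j y < F (Suc i) y \<and> G j y < G (Suc j) y}" for i j
  define \<P> where "\<P> = (\<lambda>(i, j). P i j) ` ({..<p} \<times> {..<q})"
  have contF: "continuous_map Y euclideanreal (F i)" if "i \<le> p" for i
    unfolding F_def using that f(2) by (intro continuous_map_sum) auto
  have contG: "continuous_map Y euclideanreal (G i)" if "i \<le> q" for i
    unfolding G_def using that g(2) by (intro continuous_map_sum) auto
  have openP: "openin Y (P i j)" if "i < p" "j < q" for i j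
  proof -
    have "P i j = {y \<in> topspace Y. F i y < F (Suc i) y} \<inter> {y \<in> topspace Y. F i y < G (Suc j) y}
      \<inter> {y \<in> topspace Y. G j y < F (Suc i) y} \<inter> {y \<in> topspace Y. G j y < G (Suc j) y}"
      by (auto simp: P_def)
    also have "openin Y \<dots>" using that by (intro openin_Int openin_less contF contG) auto
    finally show ?thesis .
  qed
  have Pa: "y \<in> a i" "0 < f i y" if "y \<in> P i j" "i < p" for y i j
    using that f(4)[of i y] by (auto simp: P_def F_def)
  have Pb: "y \<in> b j" "0 < g j y" if "y \<in> P i j" "j < q" for y i j
    using that g(4)[of j y] by (auto simp: P_def G_def)
  \<comment> \<open>The first nonempty interval of either partition starts at 0, so these two
    overlap and every y lies in some \<open>P i j\<close>.\<close>
  have first: "\<exists>i<n. (\<Sum>k<i. h k) = 0 \<and> 0 < h i"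
    if "\<And>i. i < n \<Longrightarrow> 0 \<le> h i" "(\<Sum>i<n. h i) = 1" for n and h :: "nat \<Rightarrow> real"
  proof -
    have "\<exists>i. i < n \<and> 0 < h i"
    proof (rule ccontr)
      assume "\<not> (\<exists>i. i < n \<and> 0 < h i)"
      then have "(\<Sum>i<n. h i) = 0" using that(1) by (intro sum.neutral) (meson lessThan_iff not_less antisym)
      then show False using that(2) by simp
    qed
    then obtain i where i: "i < n" "0 < h i" "\<forall>k<i. \<not> (k < n \<and> 0 < h k)"
      using exists_least_iff[of "\<lambda>i. i < n \<and> 0 < h i"] by blast
    then have "(\<Sum>k<i. h k) = 0"
      using that(1) by (intro sum.neutral) (meson lessThan_iff less_trans not_less antisym)
    then show ?thesis using i by blast
  qed
  have "\<Union>\<P> = topspace Y"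
  proof
    show "\<Union>\<P> \<subseteq> topspace Y" by (auto simp: \<P>_def P_def)
    show "topspace Y \<subseteq> \<Union>\<P>"
    proof
      fix y assume y: "y \<in> topspace Y"
      obtain i where i: "i < p" "F i y = 0" "0 < f i y"
        using first[of p "\<lambda>i. f i y"] f(3,5) y by (auto simp: F_def)
      obtain j where j: "j < q" "G j y = 0" "0 < g j y"
        using first[of q "\<lambda>i. g i y"] g(3,5) y by (auto simp: G_def)
      have "y \<in> P i j" using y i j by (auto simp: P_def F_def G_def)
      then show "y \<in> \<Union>\<P>" using i j by (auto simp: \<P>_def)
    qed
  qed
  then have foc: "finite_open_cover Y \<P>"
    using openP by (auto simp: finite_open_cover_def \<P>_def)
  have "finer_cover \<P> (cover_join \<A> \<B>)"
    unfolding finer_cover_def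
  proof
    fix B assume "B \<in> \<P>"
    then obtain i j where ij: "i < p" "j < q" "B = P i j" by (auto simp: \<P>_def)
    have "a i \<in> \<A>'" "b j \<in> \<B>'" using ij f(1) g(1) by (auto dest: bij_betwE)
    then obtain U V where "U \<in> \<A>" "a i \<subseteq> U" "V \<in> \<B>" "b j \<subseteq> V"
      using A'(2) B'(2) unfolding finer_cover_def by meson
    moreover have "B \<subseteq> a i \<inter> b j" using ij Pa Pb by auto
    ultimately show "\<exists>A\<in>cover_join \<A> \<B>. B \<subseteq> A"
      unfolding cover_join_def by (intro bexI[of _ "U \<inter> V"]) auto
  qed
  moreover have "int (multiplicity_at \<P> y) \<le> cover_dim Y \<A> + cover_dim Y \<B> + 1" if y: "y \<in> topspace Y" for y
  proof -
    define I where "I = {i. i < p \<and> 0 < f i y}"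
    define J where "J = {j. j < q \<and> 0 < g j y}"
    define R where "R = {(i, j). i < p \<and> j < q \<and> y \<in> P i j}"
    have monoF: "F i y \<le> F i' y" if "i \<le> i'" "i' \<le> p" for i i'
      unfolding F_def using that f(3) y by (intro sum_mono2) auto
    have monoG: "G i y \<le> G i' y" if "i \<le> i'" "i' \<le> q" for i i'
      unfolding G_def using that g(3) y by (intro sum_mono2) auto
    have RIJ: "R \<subseteq> I \<times> J" using Pa Pb by (auto simp: R_def I_def J_def)
    have finIJ: "finite I" "finite J" by (auto simp: I_def J_def)
    have "card R \<le> card I + card J - 1"
    proof (rule card_chain_in_product[OF finIJ RIJ])
      fix i j i' j' assume *: "(i, j) \<in> R" "(i', j') \<in> R" "i < i'"
      show "j \<le> j'"
      proof (rule ccontr)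
        assume "\<not> j \<le> j'"
        have "G j y < F (Suc i) y" using * by (auto simp: R_def P_def)
        also have "\<dots> \<le> F i' y" using * by (intro monoF) (auto simp: R_def)
        also have "\<dots> < G (Suc j') y" using * by (auto simp: R_def P_def)
        also have "\<dots> \<le> G j y" using * \<open>\<not> j \<le> j'\<close> by (intro monoG) (auto simp: R_def)
        finally show False by simp
      qed
    qed
    moreover have "card I \<le> multiplicity_at \<A>' y"
      unfolding multiplicity_at_def
    proof (rule card_inj_on_le[of a])
      show "inj_on a I" using f(1) by (auto simp: bij_betw_def I_def intro: inj_on_subset)
      show "a ` I \<subseteq> {A \<in> \<A>'. y \<in> A}"
        using f(1,4) y by (force simp: I_def dest: bij_betwE)
    qed (use A'(1) in \<open>auto simp: finite_open_cover_def\<close>)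
    moreover have "card J \<le> multiplicity_at \<B>' y"
      unfolding multiplicity_at_def
    proof (rule card_inj_on_le[of b])
      show "inj_on b J" using g(1) by (auto simp: bij_betw_def J_def intro: inj_on_subset)
      show "b ` J \<subseteq> {A \<in> \<B>'. y \<in> A}"
        using g(1,4) y by (force simp: J_def dest: bij_betwE)
    qed (use B'(1) in \<open>auto simp: finite_open_cover_def\<close>)
    moreover have "multiplicity_at \<P> y \<le> card R"
      unfolding multiplicity_at_def
    proof (rule surj_card_le[of _ _ "\<lambda>(i, j). P i j"])
      show "finite R" using RIJ finIJ by (meson finite_SigmaI finite_subset)
    qed (auto simp: \<P>_def R_def)
    moreover note A'(3)[THEN bspec, OF y] B'(3)[THEN bspec, OF y] cover_dim_nonneg[OF \<A> Y(3)] cover_dim_nonneg[OF \<B> Y(3)]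
    ultimately show ?thesis by linarith
  qed
  ultimately show ?thesis
    using cover_dim_nonneg[OF \<A> Y(3)] cover_dim_nonneg[OF \<B> Y(3)]
    by (intro cover_dim_le[OF foc]) auto
qed

lemma iterated_cover_add_coarser:
  assumes "continuous_map Y Y S"
  shows "finer_cover (cover_join (iterated_cover Y S \<A> m) (cover_preimage Y (S ^^ m) (iterated_cover Y S \<A> n)))
    (iterated_cover Y S \<A> (m + n))"
  unfolding finer_cover_def
proof
  fix B assume "B \<in> cover_join (iterated_cover Y S \<A> m) (cover_preimage Y (S ^^ m) (iterated_cover Y S \<A> n))"
  then obtain U V where B: "B = U \<inter> ((S ^^ m) -` V \<inter> topspace Y)"
    "U \<in> iterated_cover Y S \<A> m" "V \<in> iterated_cover Y S \<A> n"
    by (auto simp: cover_join_def cover_preimage_def)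
  then have "B \<in> iterated_cover Y S \<A> (m + n)" using in_iterated_cover_add[OF assms] by simp
  then show "\<exists>A\<in>iterated_cover Y S \<A> (m + n). B \<subseteq> A" by blast
qed

text \<open>Subadditivity in n: the iterated cover for m + n times is refined by the join of the
  block of m times with the m-th preimage of the block of n times; joins at most add dimensions and
  preimages do not raise them.\<close>

lemma cover_dim_iterated_convergent:
  assumes Y: "compact_space Y" "completely_regular_space Y" "topspace Y \<noteq> {}"
    and \<A>: "finite_open_cover Y \<A>" and S: "continuous_map Y Y S"
  shows "convergent (\<lambda>n. real_of_int (cover_dim Y (iterated_cover Y S \<A> n)) / real n)"
proof (rule fekete_convergent)
  note foc = finite_open_cover_iterated[OF \<A> S]
  fix m n
  have "cover_dim Y (iterated_cover Y S \<A> (m + n)) \<le>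
    cover_dim Y (cover_join (iterated_cover Y S \<A> m) (cover_preimage Y (S ^^ m) (iterated_cover Y S \<A> n)))"
    by (intro cover_dim_mono iterated_cover_add_coarser S finite_open_cover_join foc
        finite_open_cover_preimage continuous_map_funpow)
  also have "\<dots> \<le> cover_dim Y (iterated_cover Y S \<A> m)
      + cover_dim Y (cover_preimage Y (S ^^ m) (iterated_cover Y S \<A> n))"
    by (intro cover_dim_join Y foc finite_open_cover_preimage continuous_map_funpow S)
  also have "cover_dim Y (cover_preimage Y (S ^^ m) (iterated_cover Y S \<A> n))
    \<le> cover_dim Y (iterated_cover Y S \<A> n)"
    by (intro cover_dim_preimage foc continuous_map_funpow S)
  finally show "real_of_int (cover_dim Y (iterated_cover Y S \<A> (m + n))) \<le>
    real_of_int (cover_dim Y (iterated_cover Y S \<A> m)) + real_of_int (cover_dim Y (iterated_cover Y S \<A> n))"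
    by linarith
  show "0 \<le> real_of_int (cover_dim Y (iterated_cover Y S \<A> n))"
    using cover_dim_nonneg[OF foc Y(3), of n] by simp
qed

section \<open>The Lebesgue covering theorem for cubes\<close>

text \<open>The index type is left general: \<open>nat\<close> serves for the cubes of the covering
  theorem, \<open>nat list\<close> for weights on the paths of a tree.\<close>

lemma compact_unit_cube: "compact {x :: 'i \<Rightarrow> real. \<forall>i. 0 \<le> x i \<and> x i \<le> 1}"
proof -
  have "compactin (product_topology (\<lambda>_::'i. euclidean) UNIV) (PiE UNIV (\<lambda>_. {0..1::real}))"
    by (subst compactin_PiE) (simp add: compactin_euclidean_iff)
  then have "compact (PiE UNIV (\<lambda>_::'i. {0..1::real}))"
    by (simp add: euclidean_product_topology compactin_euclidean_iff)
  also have "PiE UNIV (\<lambda>_::'i. {0..1::real}) = {x. \<forall>i. 0 \<le> x i \<and> x i \<le> 1}"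
    by (auto simp: PiE_iff)
  finally show ?thesis .
qed

text \<open>The cube sits in \<open>nat \<Rightarrow> real\<close>, so n can vary without changing
  the type; only the first n coordinates carry a condition on faces. Each point of a fine grid is
  assigned a member that contains its neighborhood in the cube, and is labelled 1 in coordinate i if
  this member meets the face where coordinate i is 1. The hypothesis on faces is the boundary
  condition of Kuhn's combinatorial lemma, which provides a small simplex with n + 1 different
  reduced labels. Its base vertex lies in the members of all vertices.\<close>

theorem cube_cover_multiplicity:
  fixes n :: nat and G :: "'b \<Rightarrow> (nat \<Rightarrow> real) set"
  defines "C \<equiv> {x :: nat \<Rightarrow> real. \<forall>i. 0 \<le> x i \<and> x i \<le> 1}"
  assumes fin: "finite I"
    and op: "\<And>b. b \<in> I \<Longrightarrow> openin (top_of_set C) (G b)"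
    and cov: "C \<subseteq> (\<Union>b\<in>I. G b)"
    and faces: "\<And>b i x y. \<lbrakk>b \<in> I; i < n; x \<in> G b; y \<in> G b; x i = 0\<rbrakk> \<Longrightarrow> y i \<noteq> 1"
  shows "\<exists>x\<in>C. n + 1 \<le> card {b\<in>I. x \<in> G b}"
proof -
  have "\<forall>b\<in>I. \<exists>U. open U \<and> G b = C \<inter> U"
    using op by (auto simp: openin_open)
  then obtain U where U: "\<And>b. b \<in> I \<Longrightarrow> open (U b)" "\<And>b. b \<in> I \<Longrightarrow> G b = C \<inter> U b"
    by metis
  have "compact C" unfolding C_def by (rule compact_unit_cube)
  moreover have "C \<subseteq> \<Union>(U ` I)" using cov U(2) by blast
  ultimately obtain e where e: "0 < e" "\<And>x. x \<in> C \<Longrightarrow> \<exists>V\<in>U ` I. ball x e \<subseteq> V"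
    using U(1) by (elim Heine_Borel_lemma) auto
  \<comment> \<open>The distance in \<open>nat \<Rightarrow> real\<close> is at most twice the
    largest distance in coordinates up to N, plus (1/2)^N. \<open>N\<close> and \<open>p\<close>
    bring each of the two parts below e/2.\<close>
  obtain N where N: "(1/2::real)^N < e/2"
    using real_arch_pow_inv[of "e/2" "1/2"] e(1) by auto
  define p where "p = nat \<lceil>8/e\<rceil> + 1"
  have p: "0 < p" "2 / real p < e/2"
  proof -
    show "0 < p" by (simp add: p_def)
    have "8/e < real p" unfolding p_def by linarith
    then have "8 < e * real p" using e(1) by (simp add: field_simps)
    then show "2 / real p < e/2" using \<open>0 < p\<close> by (simp add: field_simps)
  qed
  define g where "g x = (\<lambda>i. real (x i) / real p)" for x :: "nat \<Rightarrow> nat"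
  have gC: "g x \<in> C" if "\<forall>j. x j \<le> p" for x
    using that p(1) by (auto simp: g_def C_def divide_le_eq_1)
  define b where "b x = (SOME b. b \<in> I \<and> ball (g x) e \<subseteq> U b)" for x
  have b: "b x \<in> I \<and> ball (g x) e \<subseteq> U (b x)" if "\<forall>j. x j \<le> p" for x
    unfolding b_def by (rule someI_ex) (use e(2)[OF gC[OF that]] in blast)
  have bG: "g x \<in> G (b x)" if "\<forall>j. x j \<le> p" for x
    using b[OF that] gC[OF that] U(2)[of "b x"] e(1) by auto
  define lab where "lab x = (\<lambda>i. if \<exists>y\<in>G (b x). y i = 1 then 1 else (0::nat))" for x
  have "odd (card {s. ksimplex p n s \<and> (reduced n \<circ> lab) ` s = {..n}})"
  proof (rule kuhn_combinatorial[OF p(1)])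
    show "\<forall>x j. (\<forall>j. x j \<le> p) \<and> j < n \<and> x j = 0 \<longrightarrow> lab x j = 0"
    proof (intro allI impI, elim conjE)
      fix x j assume x: "\<forall>j. x j \<le> p" "j < n" "x j = 0"
      have "g x j = 0" using x by (simp add: g_def)
      then show "lab x j = 0"
        using faces[of "b x" j "g x"] b[OF x(1)] bG[OF x(1)] x(2) by (auto simp: lab_def)
    qed
    show "\<forall>x j. (\<forall>j. x j \<le> p) \<and> j < n \<and> x j = p \<longrightarrow> lab x j = 1"
    proof (intro allI impI, elim conjE)
      fix x j assume x: "\<forall>j. x j \<le> p" "j < n" "x j = p"
      have "g x j = 1" using x p(1) by (simp add: g_def)
      then show "lab x j = 1" using bG[OF x(1)] by (auto simp: lab_def)
    qed
  qed
  then obtain s where s: "ksimplex p n s" "(reduced n \<circ> lab) ` s = {..n}"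
    by (metis (mono_tags, lifting) card.empty empty_Collect_eq even_zero)
  from s(1) obtain base upd where "kuhn_simplex p n base upd s"
    by (auto elim: ksimplex.cases)
  then interpret kuhn_simplex p n base upd s .
  define x0 where "x0 = g base"
  have base_p: "\<forall>j. base j \<le> p" using base_in_s s_le_p by blast
  have x0C: "x0 \<in> C" unfolding x0_def by (rule gC[OF base_p])
  have near: "x0 \<in> G (b x)" and bI: "b x \<in> I" if "x \<in> s" for x
  proof -
    have xp: "\<forall>j. x j \<le> p" using that s_le_p by blast
    have d1: "dist (x0 i) (g x i) \<le> 1 / real p" for i
    proof -
      have "base i \<le> x i" "x i \<le> Suc (base i)" using that base_le le_Suc_base by auto
      then have "x i = base i \<or> x i = Suc (base i)" by auto
      then show ?thesis by (auto simp: x0_def g_def dist_real_def diff_divide_distrib[symmetric])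
    qed
    have "dist x0 (g x) \<le> 2 * Max {dist (x0 (from_nat n)) (g x (from_nat n))|n. n \<le> N} + (1/2)^N"
      by (rule dist_fun_le_dist_first_terms)
    also have "Max {dist (x0 (from_nat n)) (g x (from_nat n))|n. n \<le> N} \<le> 1 / real p"
      by (subst Max_le_iff) (use d1 in auto)
    finally have "dist x0 (g x) < e" using N p(2) by simp
    then have "x0 \<in> U (b x)" using b[OF xp] by (auto simp: dist_commute)
    then show "x0 \<in> G (b x)" "b x \<in> I" using U(2) b[OF xp] x0C by auto
  qed
  \<comment> \<open>A label is determined by the member assigned to the vertex, so n + 1 different
    labels require n + 1 different members.\<close>
  have "{..n} = (\<lambda>c. reduced n (\<lambda>i. if \<exists>y\<in>G c. y i = 1 then 1 else (0::nat))) ` b ` s"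
    using s(2) by (auto simp: lab_def image_comp o_def)
  also have "card \<dots> \<le> card (b ` s)"
    by (rule card_image_le) (use finite_subset[OF _ fin] bI in blast)
  also have "\<dots> \<le> card {c\<in>I. x0 \<in> G c}"
    by (rule card_mono) (use fin near bI in auto)
  finally have "n + 1 \<le> card {c\<in>I. x0 \<in> G c}" by simp
  then show ?thesis using x0C by blast
qed

section \<open>The weak-star topology\<close>

lemma opens_subset_Pow: "{U. openin X U} \<subseteq> Pow (topspace X)"
  by (auto dest: openin_subset)

lemma space_borel_of_top [simp]: "space (borel_of_top X) = topspace X"
  unfolding borel_of_top_def by (rule space_measure_of[OF opens_subset_Pow])

lemma sets_borel_of_top: "sets (borel_of_top X) = sigma_sets (topspace X) {U. openin X U}"
  unfolding borel_of_top_def by (rule sets_measure_of[OF opens_subset_Pow])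

lemma openin_sets_borel [intro]: "openin X U \<Longrightarrow> U \<in> sets (borel_of_top X)"
  unfolding sets_borel_of_top by (rule sigma_sets.Basic) simp

lemma continuous_map_measurable_real:
  assumes "continuous_map X euclideanreal f"
  shows "f \<in> borel_measurable (borel_of_top X)"
proof (rule borel_measurableI)
  fix S :: "real set" assume "open S"
  then have "openin X {x \<in> topspace X. f x \<in> S}"
    using assms by (intro openin_continuous_map_preimage[of X euclideanreal]) auto
  then show "f -` S \<inter> space (borel_of_top X) \<in> sets (borel_of_top X)"
    by (auto simp: vimage_def Int_def conj_commute)
qed

lemma measurable_into_borel_of_top:
  assumes "\<And>y. y \<in> space N \<Longrightarrow> f y \<in> topspace X"
    "\<And>U. openin X U \<Longrightarrow> {y \<in> space N. f y \<in> U} \<in> sets N"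
  shows "f \<in> measurable N (borel_of_top X)"
proof (rule measurable_sigma_sets[OF sets_borel_of_top opens_subset_Pow])
  show "f \<in> space N \<rightarrow> topspace X" using assms(1) by auto
  show "f -` U \<inter> space N \<in> sets N" if "U \<in> {U. openin X U}" for U
    using assms(2)[of U] that by (auto simp: vimage_def Int_def conj_commute)
qed

lemma continuous_map_measurable:
  assumes "continuous_map X X T"
  shows "T \<in> measurable (borel_of_top X) (borel_of_top X)"
  by (rule measurable_into_borel_of_top)
    (use assms in \<open>auto simp: continuous_map_def Pi_iff\<close>)

lemma borel_probsD:
  assumes "\<mu> \<in> borel_probs X"
  shows "prob_space \<mu>" "sets \<mu> = sets (borel_of_top X)" "space \<mu> = topspace X"
  using assms sets_eq_imp_space_eq[of \<mu> "borel_of_top X"] by (auto simp: borel_probs_def)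

lemma borel_probs_nonempty_space: "\<mu> \<in> borel_probs X \<Longrightarrow> topspace X \<noteq> {}"
  using borel_probsD[of \<mu> X] prob_space.not_empty by metis

lemma borel_probs_measurable_eq:
  "\<mu> \<in> borel_probs X \<Longrightarrow> measurable \<mu> N = measurable (borel_of_top X) N"
  by (rule measurable_cong_sets) (simp_all add: borel_probsD)

lemma distr_in_borel_probs:
  assumes "prob_space R" "f \<in> measurable R (borel_of_top X)"
  shows "distr R (borel_of_top X) f \<in> borel_probs X"
  using assms by (simp add: borel_probs_def prob_space.prob_space_distr)

lemma dirac_in_borel_probs:
  assumes "x \<in> topspace X"
  shows "return (borel_of_top X) x \<in> borel_probs X"
  using assms by (simp add: borel_probs_def prob_space_return)

lemma compact_space_continuous_bounded:
  assumes "compact_space X" "continuous_map X euclideanreal f"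
  shows "\<exists>B>0. \<forall>x\<in>topspace X. \<bar>f x\<bar> \<le> B"
proof -
  have "compactin euclideanreal (f ` topspace X)"
    using assms by (intro image_compactin[of X]) (auto simp: compact_space_def)
  then have "bounded (f ` topspace X)" by (simp add: compact_imp_bounded)
  then obtain B where "B > 0" "\<forall>y\<in>f ` topspace X. norm y \<le> B" unfolding bounded_pos by blast
  then show ?thesis by auto
qed

lemma continuous_map_integrable:
  assumes "compact_space X" "continuous_map X euclideanreal f" "\<mu> \<in> borel_probs X"
  shows "integrable \<mu> f"
proof -
  interpret prob_space \<mu> using assms(3) by (rule borel_probsD)
  obtain B where B: "\<forall>x\<in>topspace X. \<bar>f x\<bar> \<le> B"
    using compact_space_continuous_bounded[OF assms(1,2)] by blast
  show ?thesis
  proof (rule integrable_const_bound[of _ B])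
    show "AE x in \<mu>. norm (f x) \<le> B" using B borel_probsD(3)[OF assms(3)] by (intro AE_I2) auto
    show "f \<in> borel_measurable \<mu>"
      using continuous_map_measurable_real[OF assms(2)] borel_probs_measurable_eq[OF assms(3)] by blast
  qed
qed

lemma topspace_prob_weak_star [simp]: "topspace (prob_weak_star X) = borel_probs X"
proof -
  have "borel_probs X = {\<mu> \<in> borel_probs X. (\<integral>x. (\<lambda>_. 0) x \<partial>\<mu>) \<in> (UNIV :: real set)}" by auto
  moreover have "continuous_map X euclideanreal (\<lambda>_. 0)" by simp
  ultimately show ?thesis unfolding prob_weak_star_def topology_generated_by_topspace by blast
qed

lemma continuous_map_weak_star_integral:
  assumes "continuous_map X euclideanreal f"
  shows "continuous_map (prob_weak_star X) euclideanreal (\<lambda>\<mu>. \<integral>x. f x \<partial>\<mu>)"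
  unfolding continuous_map_def
proof (intro conjI allI impI)
  fix U :: "real set" assume "openin euclidean U"
  then have "{\<mu> \<in> borel_probs X. (\<integral>x. f x \<partial>\<mu>) \<in> U} \<in>
    {{\<mu> \<in> borel_probs X. (\<integral>x. f x \<partial>\<mu>) \<in> U} | f U. continuous_map X euclideanreal f \<and> open U}"
    using assms by auto
  then show "openin (prob_weak_star X) {\<mu> \<in> topspace (prob_weak_star X). (\<integral>x. f x \<partial>\<mu>) \<in> U}"
    unfolding topspace_prob_weak_star unfolding prob_weak_star_def by (rule topology_generated_by_Basis)
qed simp

lemma continuous_map_into_weak_star:
  assumes "\<And>z. z \<in> topspace Z \<Longrightarrow> g z \<in> borel_probs X"
    and "\<And>f. continuous_map X euclideanreal f \<Longrightarrow> continuous_map Z euclideanreal (\<lambda>z. \<integral>x. f x \<partial>(g z))"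
  shows "continuous_map Z (prob_weak_star X) g"
  unfolding prob_weak_star_def
proof (rule continuous_on_generated_topo)
  fix V assume "V \<in> {{\<mu> \<in> borel_probs X. (\<integral>x. f x \<partial>\<mu>) \<in> U} | f U. continuous_map X euclideanreal f \<and> open U}"
  then obtain f U where V: "V = {\<mu> \<in> borel_probs X. (\<integral>x. f x \<partial>\<mu>) \<in> U}"
    "continuous_map X euclideanreal f" "open U" by blast
  have "g -` V \<inter> topspace Z = {z \<in> topspace Z. (\<integral>x. f x \<partial>(g z)) \<in> U}"
    using assms(1) V(1) by auto
  also have "openin Z \<dots>"
    by (rule openin_continuous_map_preimage[OF assms(2)[OF V(2)]]) (use V(3) in auto)
  finally show "openin Z (g -` V \<inter> topspace Z)" .
next
  show "g ` topspace Z \<subseteq> \<Union> {{\<mu> \<in> borel_probs X. (\<integral>x. f x \<partial>\<mu>) \<in> U} | f U. continuous_map X euclideanreal f \<and> open U}"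
    using assms(1) topspace_prob_weak_star[of X]
    unfolding prob_weak_star_def topology_generated_by_topspace by auto
qed

text \<open>The topology is given by a subbase only; induction over its generation turns subbasic
  sets into neighborhoods by finitely many functions with a common tolerance.\<close>

lemma weak_star_nbhd:
  assumes "openin (prob_weak_star X) U" "\<mu> \<in> U"
  shows "\<exists>F \<epsilon>. finite F \<and> (\<forall>f\<in>F. continuous_map X euclideanreal f) \<and> 0 < \<epsilon> \<and>
    {\<nu> \<in> borel_probs X. \<forall>f\<in>F. \<bar>(\<integral>x. f x \<partial>\<nu>) - (\<integral>x. f x \<partial>\<mu>)\<bar> < \<epsilon>} \<subseteq> U"
proof -
  have "generate_topology_on {{\<mu> \<in> borel_probs X. (\<integral>x. f x \<partial>\<mu>) \<in> U} | f U.
      continuous_map X euclideanreal f \<and> open U} U"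
    using assms(1) unfolding prob_weak_star_def openin_topology_generated_by_iff .
  then show ?thesis using assms(2)
  proof induction
    case Empty
    then show ?case by simp
  next
    case (Int a b)
    obtain F \<epsilon> where F: "finite F" "\<forall>f\<in>F. continuous_map X euclideanreal f" "0 < \<epsilon>"
      "{\<nu> \<in> borel_probs X. \<forall>f\<in>F. \<bar>(\<integral>x. f x \<partial>\<nu>) - (\<integral>x. f x \<partial>\<mu>)\<bar> < \<epsilon>} \<subseteq> a"
      using Int by blast
    obtain G \<delta> where G: "finite G" "\<forall>f\<in>G. continuous_map X euclideanreal f" "0 < \<delta>"
      "{\<nu> \<in> borel_probs X. \<forall>f\<in>G. \<bar>(\<integral>x. f x \<partial>\<nu>) - (\<integral>x. f x \<partial>\<mu>)\<bar> < \<delta>} \<subseteq> b"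
      using Int by blast
    have "{\<nu> \<in> borel_probs X. \<forall>f\<in>F \<union> G. \<bar>(\<integral>x. f x \<partial>\<nu>) - (\<integral>x. f x \<partial>\<mu>)\<bar> < min \<epsilon> \<delta>} \<subseteq> a \<inter> b"
      using F(4) G(4) by fastforce
    then show ?case
      using F G by (intro exI[of _ "F \<union> G"] exI[of _ "min \<epsilon> \<delta>"]) auto
  next
    case (UN K)
    then obtain k where "k \<in> K" "\<mu> \<in> k" by blast
    then show ?case using UN.IH[of k] by (meson Union_upper subset_trans)
  next
    case (Basis s)
    then obtain f V where s: "s = {\<mu> \<in> borel_probs X. (\<integral>x. f x \<partial>\<mu>) \<in> V}"
      "continuous_map X euclideanreal f" "open V" by blast
    then have "(\<integral>x. f x \<partial>\<mu>) \<in> V" using Basis by auto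
    then obtain e where "0 < e" "ball (\<integral>x. f x \<partial>\<mu>) e \<subseteq> V" using s(3) openE by blast
    then show ?case using s
      by (intro exI[of _ "{f}"] exI[of _ e]) (auto simp: subset_iff dist_real_def abs_minus_commute)
  qed
qed

text \<open>Sum the deviations of the finitely many integrals that define a neighborhood of \<mu>
  off the closed set: this is continuous, 0 at \<mu> and at least \<epsilon> on the closed set.
  Dividing by \<epsilon> and truncating at 1 gives the separating function.\<close>

lemma completely_regular_weak_star: "completely_regular_space (prob_weak_star X)"
  unfolding completely_regular_space_def
proof (intro allI impI, elim conjE)
  fix S \<mu> assume S: "closedin (prob_weak_star X) S" and \<mu>: "\<mu> \<in> topspace (prob_weak_star X) - S"
  have "openin (prob_weak_star X) (topspace (prob_weak_star X) - S)"
    by (rule openin_diff[OF openin_topspace S])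
  from weak_star_nbhd[OF this \<mu>] obtain F \<epsilon> where F: "finite F"
    "\<And>f. f \<in> F \<Longrightarrow> continuous_map X euclideanreal f" "0 < \<epsilon>"
    "{\<nu> \<in> borel_probs X. \<forall>f\<in>F. \<bar>(\<integral>x. f x \<partial>\<nu>) - (\<integral>x. f x \<partial>\<mu>)\<bar> < \<epsilon>} \<subseteq> topspace (prob_weak_star X) - S"
    by blast
  define h where "h \<nu> = (\<Sum>f\<in>F. \<bar>(\<integral>x. f x \<partial>\<nu>) - (\<integral>x. f x \<partial>\<mu>)\<bar>)" for \<nu>
  define g where "g \<nu> = min 1 (h \<nu> / \<epsilon>)" for \<nu>
  have h0: "0 \<le> h \<nu>" for \<nu> unfolding h_def by (intro sum_nonneg) auto
  have conth: "continuous_map (prob_weak_star X) euclideanreal h"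
    unfolding h_def
    by (intro continuous_map_sum F(1) continuous_map_real_abs continuous_map_diff
        continuous_map_weak_star_integral F(2)) auto
  have "continuous_map (prob_weak_star X) euclideanreal g"
    unfolding g_def using F(3)
    by (intro continuous_map_real_min continuous_map_real_divide conth) auto
  then have "continuous_map (prob_weak_star X) (top_of_set {0..1}) g"
    using h0 F(3) by (auto simp: continuous_map_in_subtopology g_def)
  moreover have "g \<mu> = 0" by (simp add: g_def h_def)
  moreover have "g ` S \<subseteq> {1}"
  proof (rule image_subsetI)
    fix \<nu> assume \<nu>: "\<nu> \<in> S"
    then have "\<nu> \<in> borel_probs X" using closedin_subset[OF S] by auto
    then obtain f where f: "f \<in> F" "\<epsilon> \<le> \<bar>(\<integral>x. f x \<partial>\<nu>) - (\<integral>x. f x \<partial>\<mu>)\<bar>"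
      using F(4) \<nu> by (force simp: not_less)
    note f(2)
    also have "\<dots> \<le> h \<nu>" unfolding h_def by (rule member_le_sum) (use f(1) F(1) in auto)
    finally show "g \<nu> \<in> {1}" using F(3) by (simp add: g_def)
  qed
  ultimately show "\<exists>f. continuous_map (prob_weak_star X) (top_of_set {0..1::real}) f \<and> f \<mu> = 0 \<and> f ` S \<subseteq> {1}"
    by blast
qed

lemma push_forward_in_borel_probs:
  assumes "continuous_map X X T" "\<mu> \<in> borel_probs X"
  shows "push_forward X T \<mu> \<in> borel_probs X"
  unfolding push_forward_def
  by (rule distr_in_borel_probs)
    (use assms borel_probsD continuous_map_measurable borel_probs_measurable_eq in blast)+

lemma integral_push_forward:
  assumes "continuous_map X X T" "\<mu> \<in> borel_probs X" "continuous_map X euclideanreal f"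
  shows "(\<integral>x. f x \<partial>(push_forward X T \<mu>)) = (\<integral>x. f (T x) \<partial>\<mu>)"
  unfolding push_forward_def
proof (rule integral_distr)
  show "T \<in> measurable \<mu> (borel_of_top X)"
    using assms continuous_map_measurable borel_probs_measurable_eq by blast
  show "f \<in> borel_measurable (borel_of_top X)" by (rule continuous_map_measurable_real[OF assms(3)])
qed

lemma continuous_map_push_forward:
  assumes "continuous_map X X T"
  shows "continuous_map (prob_weak_star X) (prob_weak_star X) (push_forward X T)"
proof (rule continuous_map_into_weak_star)
  fix f assume f: "continuous_map X euclideanreal f"
  have "continuous_map (prob_weak_star X) euclideanreal (\<lambda>\<mu>. \<integral>x. (f \<circ> T) x \<partial>\<mu>)"
    by (intro continuous_map_weak_star_integral continuous_map_compose[OF assms f])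
  then show "continuous_map (prob_weak_star X) euclideanreal (\<lambda>z. \<integral>x. f x \<partial>(push_forward X T z))"
    by (rule continuous_map_eq) (simp add: integral_push_forward[OF assms _ f])
qed (simp add: push_forward_in_borel_probs[OF assms])

lemma integral_funpow_push_forward:
  assumes "continuous_map X X T" "\<mu> \<in> borel_probs X" "continuous_map X euclideanreal f"
  shows "(\<integral>x. f x \<partial>((push_forward X T ^^ n) \<mu>)) = (\<integral>x. f ((T ^^ n) x) \<partial>\<mu>)"
  using assms(3)
proof (induction n arbitrary: f)
  case (Suc n)
  have "(push_forward X T ^^ n) \<mu> \<in> borel_probs X"
    using funpow_in_topspace[OF continuous_map_push_forward[OF assms(1)], of \<mu> n] assms(2) by simp
  then have "(\<integral>x. f x \<partial>((push_forward X T ^^ Suc n) \<mu>)) = (\<integral>x. f (T x) \<partial>((push_forward X T ^^ n) \<mu>))"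
    using integral_push_forward[OF assms(1) _ Suc.prems] by simp
  also have "\<dots> = (\<integral>x. f (T ((T ^^ n) x)) \<partial>\<mu>)"
    using Suc.IH[of "f \<circ> T"] continuous_map_compose[OF assms(1) Suc.prems] by (simp add: o_def)
  finally show ?case by simp
qed simp

section \<open>Compactness of the space of probability measures\<close>

text \<open>Paths from the root of a tree in which every node of depth k has \<open>m k\<close>
  children. The latest step is the head of the list, so extending a path is consing and depth is
  \<open>length\<close>.\<close>

fun valid_path :: "(nat \<Rightarrow> nat) \<Rightarrow> nat list \<Rightarrow> bool" where
  "valid_path m [] \<longleftrightarrow> True"
| "valid_path m (i # l) \<longleftrightarrow> i < m (length l) \<and> valid_path m l"

lemma finite_valid_paths: "finite {l. valid_path m l \<and> length l = k}"
proof (induction k)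
  case (Suc k)
  have "{l. valid_path m l \<and> length l = Suc k} = (\<lambda>(i, l). i # l) ` ({..<m k} \<times> {l. valid_path m l \<and> length l = k})"
    by (auto simp: image_iff length_Suc_conv)
  then show ?case using Suc by simp
qed simp

text \<open>A unit mass distributed down the tree. Every condition is closed and involves finitely
  many coordinates of \<open>w\<close>, which later makes the set of weights compact.\<close>

definition path_weights :: "(nat \<Rightarrow> nat) \<Rightarrow> (nat list \<Rightarrow> real) \<Rightarrow> bool" where
  "path_weights m w \<longleftrightarrow> w [] = 1 \<and> (\<forall>l. 0 \<le> w l) \<and>
     (\<forall>l. valid_path m l \<longrightarrow> w l = (\<Sum>i<m (length l). w (i # l)))"

text \<open>The path of a uniformly distributed \<open>t \<in> [0, 1)\<close> through the nested intervals whose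
  lengths are the given weights.\<close>

lemma random_path_exists:
  assumes w: "path_weights m w"
  shows "\<exists>(R :: real measure) p. prob_space R \<and>
    (\<forall>t\<in>space R. \<forall>k. valid_path m (p t k) \<and> length (p t k) = k \<and> 0 < w (p t k) \<and> (\<exists>i. p t (Suc k) = i # p t k)) \<and>
    (\<forall>l. valid_path m l \<longrightarrow> {t\<in>space R. p t (length l) = l} \<in> sets R \<and>
      measure R {t\<in>space R. p t (length l) = l} = w l)"
proof -
  have w0: "w [] = 1" "\<And>l. 0 \<le> w l" "\<And>l. valid_path m l \<Longrightarrow> w l = (\<Sum>i<m (length l). w (i # l))"
    using w by (auto simp: path_weights_def)
  \<comment> \<open>\<open>start l\<close> is the left end of the interval of l; the intervals of
    the children lie side by side, from left to right, inside that of the parent.\<close>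
  define start where "start = rec_list (0::real) (\<lambda>i l s. s + (\<Sum>j<i. w (j # l)))"
  have start: "start [] = 0" "\<And>i l. start (i # l) = start l + (\<Sum>j<i. w (j # l))"
    by (simp_all add: start_def)
  have startSuc: "start (Suc i # l) = start (i # l) + w (i # l)" for i l
    by (simp add: start)
  have startmono: "start (i # l) \<le> start (j # l)" if "i \<le> j" for i j l
    using that by (auto simp: start w0(2) intro!: sum_mono2)
  have start0: "start (0 # l) = start l" for l by (simp add: start)
  have startm: "start (m (length l) # l) = start l + w l" if "valid_path m l" for l
    using w0(3)[OF that] by (simp add: start)
  define I where "I l = {start l ..< start l + w l}" for l
  \<comment> \<open>By \<open>startSuc\<close> the right end of the interval of \<open>i # l\<close>
    is \<open>start (Suc i # l)\<close>, so the path moves to the first child whose right end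
    exceeds t.\<close>
  define p where "p t = rec_nat [] (\<lambda>k l. (LEAST i. t < start (Suc i # l)) # l)" for t
  have p: "p t 0 = []" "\<And>k. p t (Suc k) = (LEAST i. t < start (Suc i # p t k)) # p t k" for t
    by (simp_all add: p_def)
  have step: "i < m (length l) \<and> t \<in> I (i # l)" if "valid_path m l" "t \<in> I l" "i = (LEAST i. t < start (Suc i # l))" for i l t
  proof -
    have "t < start (m (length l) # l)" "start l \<le> t" using that startm by (auto simp: I_def)
    then obtain n where n: "m (length l) = Suc n" using start0[of l] by (cases "m (length l)") auto
    then have ex: "t < start (Suc n # l)" using \<open>t < start (m (length l) # l)\<close> by simp
    have 1: "t < start (Suc i # l)" unfolding that(3) by (rule LeastI[of "\<lambda>i. t < start (Suc i # l)" n, OF ex])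
    have 2: "i \<le> n" unfolding that(3) by (rule Least_le[of "\<lambda>i. t < start (Suc i # l)" n, OF ex])
    have 3: "start (i # l) \<le> t"
    proof (cases i)
      case 0
      then show ?thesis using \<open>start l \<le> t\<close> start0 by simp
    next
      case (Suc j)
      then have "\<not> t < start (Suc j # l)" using that(3) not_less_Least[of j "\<lambda>i. t < start (Suc i # l)"] by simp
      then show ?thesis using Suc by simp
    qed
    show ?thesis using 1 2 3 n startSuc[of i l] by (simp add: I_def)
  qed
  have good: "valid_path m (p t k) \<and> length (p t k) = k \<and> t \<in> I (p t k)" if "t \<in> {0..<1}" for t k
  proof (induction k)
    case 0
    then show ?case using that by (simp add: p I_def start w0)
  next
    case (Suc k)
    then show ?case using step[of "p t k" t, OF _ _ refl] by (simp add: p)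
  qed
  have subI: "I (i # l) \<subseteq> I l" if "valid_path m (i # l)" for i l
  proof -
    have "start (Suc i # l) \<le> start l + w l"
      using that startmono[of "Suc i" "m (length l)" l] startm[of l] by simp
    moreover have "start l \<le> start (i # l)" using startmono[of 0 i l] start0 by simp
    ultimately show ?thesis using startSuc by (auto simp: I_def)
  qed
  have path_eq: "p t (length l) = l" if "valid_path m l" "t \<in> I l" for l t
    using that
  proof (induction l)
    case Nil
    then show ?case by (simp add: p)
  next
    case (Cons i l)
    then have IH: "p t (length l) = l" using subI by auto
    have t: "start (i # l) \<le> t" "t < start (Suc i # l)" using Cons.prems startSuc by (auto simp: I_def)
    have "(LEAST i. t < start (Suc i # l)) = i"
    proof (rule Least_equality)
      fix j assume "t < start (Suc j # l)"
      then show "i \<le> j" using t(1) startmono[of "Suc j" i l] by (cases "i \<le> j") auto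
    qed (rule t(2))
    then show ?case using IH by (simp add: p)
  qed
  have I01: "I l \<subseteq> {0..<1}" if "valid_path m l" for l
    using that
  proof (induction l)
    case Nil
    then show ?case by (simp add: I_def start w0)
  next
    case (Cons i l)
    then show ?case using subI[OF Cons.prems] by auto
  qed
  define R where "R = restrict_space lborel {0..<1::real}"
  have spR: "space R = {0..<1}" by (simp add: R_def space_restrict_space)
  have "prob_space R"
    by (rule prob_spaceI) (simp add: R_def space_restrict_space emeasure_restrict_space)
  moreover have "\<forall>t\<in>space R. \<forall>k. valid_path m (p t k) \<and> length (p t k) = k \<and> 0 < w (p t k) \<and> (\<exists>i. p t (Suc k) = i # p t k)"
  proof (intro ballI allI)
    fix t k assume "t \<in> space R"
    then have *: "valid_path m (p t k) \<and> length (p t k) = k \<and> t \<in> I (p t k)" using good spR by auto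
    \<comment> \<open>A half-open interval that contains t has positive length. Hence a random path
      never enters a node of weight 0.\<close>
    moreover have "0 < w (p t k)"
    proof -
      have "start (p t k) \<le> t" "t < start (p t k) + w (p t k)" using * by (auto simp: I_def)
      then show ?thesis by linarith
    qed
    ultimately show "valid_path m (p t k) \<and> length (p t k) = k \<and> 0 < w (p t k) \<and> (\<exists>i. p t (Suc k) = i # p t k)"
      using p(2) by blast
  qed
  moreover have "{t\<in>space R. p t (length l) = l} \<in> sets R \<and> measure R {t\<in>space R. p t (length l) = l} = w l"
    if "valid_path m l" for l
  proof -
    have "{t\<in>space R. p t (length l) = l} = I l"
    proof (intro set_eqI iffI)
      fix t assume "t \<in> {t\<in>space R. p t (length l) = l}"
      then show "t \<in> I l" using good[of t "length l"] spR by auto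
    next
      fix t assume "t \<in> I l"
      then show "t \<in> {t\<in>space R. p t (length l) = l}"
        using path_eq[OF that] I01[OF that] spR by auto
    qed
    moreover have "I l \<in> sets R"
      unfolding R_def by (subst sets_restrict_space_iff) (use I01[OF that] in \<open>auto simp: I_def\<close>)
    moreover have "measure R (I l) = w l"
    proof -
      have "measure R (I l) = measure lborel (I l)"
        unfolding R_def by (rule measure_restrict_space) (use I01[OF that] in auto)
      then show ?thesis using w0(2)[of l] by (simp add: I_def)
    qed
    ultimately show ?thesis by simp
  qed
  ultimately show ?thesis by (intro exI[of _ R] exI[of _ p] conjI allI impI) blast+
qed

section \<open>Tree weights as a compact parameter space for measures\<close>

text \<open>Used for two partitions: by the path up to a given depth, and by the cells of a given
  depth.\<close>

lemma integral_approx_finite_partition: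
  fixes h :: "'b \<Rightarrow> real"
  assumes "prob_space R" "finite L" "h \<in> borel_measurable R"
    and E: "\<And>l. l \<in> L \<Longrightarrow> E l \<in> sets R" "disjoint_family_on E L" "space R \<subseteq> (\<Union>l\<in>L. E l)"
    and near: "\<And>l t. l \<in> L \<Longrightarrow> t \<in> E l \<Longrightarrow> \<bar>h t - c l\<bar> \<le> \<epsilon>"
  shows "\<bar>(\<integral>t. h t \<partial>R) - (\<Sum>l\<in>L. measure R (E l) * c l)\<bar> \<le> \<epsilon>"
proof -
  interpret prob_space R by fact
  define s where "s t = (\<Sum>l\<in>L. indicator (E l) t * c l)" for t
  have s_eq: "s t = c l" if "l \<in> L" "t \<in> E l" for l t
  proof -
    have "s t = (\<Sum>l'\<in>L. if l' = l then c l else 0)"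
      unfolding s_def using that E(2)
      by (intro sum.cong) (auto simp: indicator_def disjoint_family_on_def)
    then show ?thesis using assms(2) that by simp
  qed
  have diff: "\<bar>h t - s t\<bar> \<le> \<epsilon>" if t: "t \<in> space R" for t
  proof -
    obtain l where "l \<in> L" "t \<in> E l" using E(3) t by blast
    then show ?thesis using near[of l t] s_eq[of l t] by simp
  qed
  have ints: "integrable R s"
    unfolding s_def using E(1) by (intro Bochner_Integration.integrable_sum integrable_mult_left) (auto simp: emeasure_eq_measure)
  have intd: "integrable R (\<lambda>t. h t - s t)"
  proof (rule integrable_const_bound[of _ \<epsilon>])
    show "AE t in R. norm (h t - s t) \<le> \<epsilon>" using diff by (intro AE_I2) auto
    show "(\<lambda>t. h t - s t) \<in> borel_measurable R" using assms(3) ints by auto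
  qed
  have inth: "integrable R h"
    using Bochner_Integration.integrable_add[OF intd ints] by simp
  have "(\<integral>t. s t \<partial>R) = (\<Sum>l\<in>L. measure R (E l) * c l)"
    unfolding s_def using E(1)
    by (subst Bochner_Integration.integral_sum) (auto simp: emeasure_eq_measure intro!: sum.cong)
  then have "(\<integral>t. h t \<partial>R) - (\<Sum>l\<in>L. measure R (E l) * c l) = (\<integral>t. h t - s t \<partial>R)"
    using inth ints by simp
  also have "\<bar>\<dots>\<bar> \<le> (\<integral>t. \<bar>h t - s t\<bar> \<partial>R)" by (rule integral_abs_bound)
  also have "\<dots> \<le> (\<integral>t. \<epsilon> \<partial>R)"
    using intd diff by (intro integral_mono) auto
  also have "\<dots> = \<epsilon>" by (simp add: prob_space)
  finally show ?thesis .
qed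

text \<open>Nested finite Borel partitions of X, whose cells shrink with the depth in a tree, reduce
  a measure to the masses of the cells. Consistent masses form a compact subset \<open>W\<close> of
  a product of unit intervals; each is turned into a measure \<open>\<Psi> w\<close> that depends
  continuously on w, and every measure has the same integrals of continuous functions as some
  \<open>\<Psi> w\<close>. Limits of sample points may leave their cell, so \<open>\<Psi> w\<close>
  need not give the cells the masses w; integrals are compared up to oscillation instead.\<close>

theorem compact_space_weak_star:
  assumes "compact_space X" "metrizable_space X"
  shows "compact_space (prob_weak_star X)"
proof (cases "topspace X = {}")
  case True
  then have "topspace (prob_weak_star X) = {}"
    using borel_probs_nonempty_space[of _ X] by auto
  then show ?thesis by (simp add: compact_space_def)
next
  case False
  obtain M d where Md: "Metric_space M d" "X = Metric_space.mtopology M d"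
    using assms(2) unfolding metrizable_space_def by blast
  interpret Metric_space M d by (rule Md(1))
  have spX [simp]: "topspace X = M" by (simp add: Md(2))
  have compX: "compact_space mtopology" using assms(1) Md(2) by simp
  have "\<exists>(n::nat) z. (\<forall>i<n. z i \<in> M) \<and> M \<subseteq> (\<Union>i<n. mball (z i) (1/2^k))" for k
  proof -
    have "mtotally_bounded M"
      using compX compactin_imp_mtotally_bounded by (simp add: compact_space_def)
    then obtain K where K: "finite K" "K \<subseteq> M" "M \<subseteq> (\<Union>x\<in>K. mball x (1/2^k))"
      unfolding mtotally_bounded_def by (meson zero_less_divide_1_iff zero_less_numeral zero_less_power)
    then obtain n z where "K = z ` {i::nat. i < n}"
      using finite_imp_nat_seg_image_inj_on by blast
    then show ?thesis using K by (intro exI[of _ n] exI[of _ z]) auto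
  qed
  then have "\<forall>k. \<exists>(n::nat) z. (\<forall>i<n. z i \<in> M) \<and> M \<subseteq> (\<Union>i<n. mball (z i) (1/2^k))" by blast
  then obtain m :: "nat \<Rightarrow> nat" and z where
    mz: "\<forall>k. (\<forall>i<m k. z k i \<in> M) \<and> M \<subseteq> (\<Union>i<m k. mball (z k i) (1/2^k))"
    unfolding choice_iff by blast
  then have z: "\<And>k i. i < m k \<Longrightarrow> z k i \<in> M" "\<And>k. M \<subseteq> (\<Union>i<m k. mball (z k i) (1/2^k))"
    by blast+
  define Q where "Q k i = mball (z k i) (1/2^k) - (\<Union>j<i. mball (z k j) (1/2^k))" for k i
  \<comment> \<open>The step taken at depth \<open>length l\<close> intersects with a piece of a
    ball of radius 1/2^(length l).\<close>
  define cell where "cell = rec_list M (\<lambda>i l c. c \<inter> Q (length l) i)"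
  have cell: "cell [] = M" "\<And>i l. cell (i # l) = cell l \<inter> Q (length l) i"
    by (simp_all add: cell_def)
  define L where "L k = {l. valid_path m l \<and> length l = k}" for k
  have finL: "finite (L k)" for k unfolding L_def by (rule finite_valid_paths)
  have cellM: "cell l \<subseteq> M" for l by (induction l) (auto simp: cell)
  have Qcover: "\<exists>i<m k. y \<in> Q k i" if "y \<in> M" for y k
  proof -
    have "\<exists>i. i < m k \<and> y \<in> mball (z k i) (1/2^k)" using z(2)[of k] that by blast
    then obtain i where i: "i < m k" "y \<in> mball (z k i) (1/2^k)"
      "\<forall>j<i. \<not> (j < m k \<and> y \<in> mball (z k j) (1/2^k))"
      using exists_least_iff[of "\<lambda>i. i < m k \<and> y \<in> mball (z k i) (1/2^k)"] by blast
    then show ?thesis by (intro exI[of _ i]) (auto simp: Q_def)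
  qed
  have Qdisj: "Q k i \<inter> Q k j = {}" if "i \<noteq> j" for k i j
    using that by (cases i j rule: linorder_cases) (auto simp: Q_def)
  have Qborel: "Q k i \<in> sets (borel_of_top X)" for k i
    unfolding Q_def Md(2) by (intro sets.Diff sets.finite_UN) auto
  have cellborel: "cell l \<in> sets (borel_of_top X)" for l
  proof (induction l)
    case Nil
    then show ?case using sets.top[of "borel_of_top X"] by (simp add: cell)
  next
    case (Cons i l)
    then show ?case using Qborel by (simp add: cell)
  qed
  have cellUn: "cell l = (\<Union>i<m (length l). cell (i # l))" for l
  proof
    show "cell l \<subseteq> (\<Union>i<m (length l). cell (i # l))"
    proof
      fix y assume y: "y \<in> cell l"
      then obtain i where "i < m (length l)" "y \<in> Q (length l) i" using Qcover cellM by blast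
      then show "y \<in> (\<Union>i<m (length l). cell (i # l))" using y by (auto simp: cell)
    qed
  qed (auto simp: cell)
  have celldisj1: "cell (i # l) \<inter> cell (j # l) = {}" if "i \<noteq> j" for i j l
    using Qdisj[OF that] by (auto simp: cell)
  have celldisj: "disjoint_family_on cell (L k)" for k
  proof (induction k)
    case 0
    then show ?case by (auto simp: disjoint_family_on_def L_def)
  next
    case (Suc k)
    show ?case
      unfolding disjoint_family_on_def
    proof (intro ballI impI)
      fix l l' assume l: "l \<in> L (Suc k)" "l' \<in> L (Suc k)" "l \<noteq> l'"
      then obtain i l0 j l0' where eq: "l = i # l0" "l' = j # l0'" "l0 \<in> L k" "l0' \<in> L k"
        unfolding L_def mem_Collect_eq by (cases l; cases l') auto
      show "cell l \<inter> cell l' = {}"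
      proof (cases "l0 = l0'")
        case True
        then show ?thesis using celldisj1[of i j l0] l(3) eq by auto
      next
        case False
        then have "cell l0 \<inter> cell l0' = {}" using Suc eq unfolding disjoint_family_on_def by blast
        then show ?thesis using eq by (auto simp: cell)
      qed
    qed
  qed
  have cellcover: "M \<subseteq> (\<Union>l\<in>L k. cell l)" for k
  proof (induction k)
    case 0
    then show ?case by (auto simp: L_def cell)
  next
    case (Suc k)
    show ?case
    proof
      fix y assume "y \<in> M"
      then obtain l where l: "l \<in> L k" "y \<in> cell l" using Suc by blast
      then obtain i where "i < m (length l)" "y \<in> cell (i # l)" using cellUn[of l] by blast
      then show "y \<in> (\<Union>l\<in>L (Suc k). cell l)" using l by (intro UN_I[of "i # l"]) (auto simp: L_def)
    qed
  qed
  have celldiam: "d y y' < 2 / 2^length l" if "y \<in> cell (i # l)" "y' \<in> cell (i # l)" for y y' i l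
  proof -
    have "d (z (length l) i) y < 1/2^length l" "d (z (length l) i) y' < 1/2^length l"
      "y \<in> M" "y' \<in> M" "z (length l) i \<in> M"
      using that by (auto simp: cell Q_def in_mball)
    then show ?thesis using triangle[of y "z (length l) i" y'] commute[of y "z (length l) i"]
      by simp
  qed
  define osc where "osc f \<epsilon> k \<longleftrightarrow> (\<forall>l. k \<le> length l \<longrightarrow> (\<forall>y\<in>cell l. \<forall>y'\<in>cell l. \<bar>f y - f y'\<bar> \<le> \<epsilon>))"
    for f :: "'a \<Rightarrow> real" and \<epsilon> k
  have osc_ex: "\<exists>k0. \<forall>k\<ge>k0. osc f \<epsilon> k" if f: "continuous_map X euclideanreal f" and "0 < \<epsilon>" for f \<epsilon>
  proof -
    have "uniformly_continuous_map (metric (M, d)) euclidean_metric f"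
      by (rule continuous_imp_uniformly_continuous_map)
        (use f compX Md(2) in \<open>simp add: mtopology_of\<close>)
    then obtain \<delta> where \<delta>: "0 < \<delta>" "\<And>x y. x \<in> M \<Longrightarrow> y \<in> M \<Longrightarrow> d y x < \<delta> \<Longrightarrow> dist (f y) (f x) < \<epsilon>"
      unfolding uniformly_continuous_map_def using \<open>0 < \<epsilon>\<close> by auto
    obtain k1 where k1: "(1/2::real)^k1 < \<delta>/2"
      using real_arch_pow_inv[of "\<delta>/2" "1/2"] \<delta>(1) by auto
    have "osc f \<epsilon> k" if k: "Suc k1 \<le> k" for k
      unfolding osc_def
    proof (intro allI impI ballI)
      fix l y y' assume l: "k \<le> length l" "y \<in> cell l" "y' \<in> cell l"
      then obtain i l0 where l0: "l = i # l0" using k by (cases l) auto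
      have "d y y' < 2 / 2^length l0" using celldiam l l0 by auto
      also have "\<dots> \<le> 2 / 2^k1" using k l l0 by (intro divide_left_mono power_increasing) auto
      also have "\<dots> < \<delta>" using k1 by (simp add: power_one_over)
      finally show "\<bar>f y - f y'\<bar> \<le> \<epsilon>"
        using \<delta>(2)[of y' y] l cellM[of l] by (auto simp: dist_real_def intro: less_imp_le)
    qed
    then show ?thesis by blast
  qed
  define x where "x l = (SOME y. y \<in> cell l)" for l
  have xcell: "x l \<in> cell l" if "cell l \<noteq> {}" for l
    unfolding x_def using that by (simp add: some_in_eq)
  \<comment> \<open>Mass 0 on empty cells keeps the random path, which visits positive weights only,
    among cells that contain their sample point.\<close>
  define W where "W = {w. path_weights m w \<and> (\<forall>l. w l \<le> 1) \<and> (\<forall>l. cell l = {} \<longrightarrow> w l = 0)}"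
  have compW: "compact W"
  proof -
    define C where "C = {w. w [] = (1::real)} \<inter> (\<Inter>l\<in>{l. valid_path m l}. {w. w l = (\<Sum>i<m (length l). w (i # l))})
      \<inter> (\<Inter>l\<in>{l. cell l = {}}. {w. w l = 0})"
    have "closed C"
      unfolding C_def
      by (intro closed_Int closed_INT ballI closed_Collect_eq continuous_on_sum
          continuous_on_product_coordinates continuous_on_const)
    then have "compact ({x :: nat list \<Rightarrow> real. \<forall>i. 0 \<le> x i \<and> x i \<le> 1} \<inter> C)"
      by (rule compact_Int_closed[OF compact_unit_cube])
    also have "{x :: nat list \<Rightarrow> real. \<forall>i. 0 \<le> x i \<and> x i \<le> 1} \<inter> C = W"
      by (auto simp: W_def C_def path_weights_def)
    finally show ?thesis .
  qed
  \<comment> \<open>The measure is the law of the limit of the sample points along a random path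
    with weights w. The limit exists because later sample points stay in the shrinking cells of the
    path and X is complete.\<close>
  have "\<forall>w\<in>W. \<exists>\<mu>. \<mu> \<in> borel_probs X \<and> (\<forall>f \<epsilon> k. continuous_map X euclideanreal f \<longrightarrow> osc f \<epsilon> k \<longrightarrow>
    \<bar>(\<integral>y. f y \<partial>\<mu>) - (\<Sum>l\<in>L k. w l * f (x l))\<bar> \<le> \<epsilon>)"
  proof
    fix w assume w: "w \<in> W"
    then have "path_weights m w" by (simp add: W_def)
    from random_path_exists[OF this] obtain R :: "real measure" and p where R: "prob_space R"
      and p: "\<And>t k. t \<in> space R \<Longrightarrow> valid_path m (p t k)" "\<And>t k. t \<in> space R \<Longrightarrow> length (p t k) = k"
        "\<And>t k. t \<in> space R \<Longrightarrow> 0 < w (p t k)" "\<And>t k. t \<in> space R \<Longrightarrow> \<exists>i. p t (Suc k) = i # p t k"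
      and pm: "\<And>l. valid_path m l \<Longrightarrow> {t\<in>space R. p t (length l) = l} \<in> sets R"
        "\<And>l. valid_path m l \<Longrightarrow> measure R {t\<in>space R. p t (length l) = l} = w l"
      by blast
    have xp: "x (p t j) \<in> cell (p t k)" if t: "t \<in> space R" and kj: "k \<le> j" for t j k
    proof -
      have "cell (p t j) \<noteq> {}" using p(3)[OF t, of j] w by (auto simp: W_def)
      moreover have "cell (p t j) \<subseteq> cell (p t k)"
        using kj
      proof (induction j rule: dec_induct)
        case (step n)
        obtain i where "p t (Suc n) = i # p t n" using p(4)[OF t] by blast
        then show ?case using step by (auto simp: cell)
      qed simp
      ultimately show ?thesis using xcell by blast
    qed
    have "\<exists>y. limitin mtopology (\<lambda>k. x (p t k)) y sequentially" if t: "t \<in> space R" for t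
    proof -
      have "MCauchy (\<lambda>k. x (p t k))"
        unfolding MCauchy_def
      proof (intro conjI allI impI)
        show "range (\<lambda>k. x (p t k)) \<subseteq> M" using xp[OF t order_refl] cellM by blast
        fix \<epsilon> :: real assume "0 < \<epsilon>"
        then obtain k where k: "(1/2::real)^k < \<epsilon>/2"
          using real_arch_pow_inv[of "\<epsilon>/2" "1/2"] by auto
        obtain i where i: "p t (Suc k) = i # p t k" using p(4)[OF t] by blast
        have "d (x (p t n)) (x (p t n')) < \<epsilon>" if "Suc k \<le> n" "Suc k \<le> n'" for n n'
        proof -
          have "d (x (p t n)) (x (p t n')) < 2 / 2^length (p t k)"
            using xp[OF t that(1)] xp[OF t that(2)] i by (intro celldiam) auto
          also have "\<dots> < \<epsilon>" using k p(2)[OF t] by (simp add: power_one_over)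
          finally show ?thesis .
        qed
        then show "\<exists>N. \<forall>n n'. N \<le> n \<longrightarrow> N \<le> n' \<longrightarrow> d (x (p t n)) (x (p t n')) < \<epsilon>" by blast
      qed
      then show ?thesis using compact_space_imp_mcomplete[OF compX] by (auto simp: mcomplete_def)
    qed
    then obtain \<phi> where \<phi>: "\<And>t. t \<in> space R \<Longrightarrow> limitin mtopology (\<lambda>k. x (p t k)) (\<phi> t) sequentially"
      by metis
    have \<phi>M: "\<phi> t \<in> M" if "t \<in> space R" for t using limitin_mspace[OF \<phi>[OF that]] .
    have \<phi>ev: "\<forall>\<^sub>F k in sequentially. d (x (p t k)) (\<phi> t) < \<epsilon>" if "t \<in> space R" "0 < \<epsilon>" for t \<epsilon>
      using \<phi>[OF that(1)] that(2) unfolding limitin_metric by (auto elim: eventually_mono)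
    have xM: "x (p t k) \<in> M" if "t \<in> space R" for t k using xp[OF that order_refl] cellM by blast
    have pmeas: "{t \<in> space R. P (p t k)} \<in> sets R" for P k
    proof -
      have "{t \<in> space R. P (p t k)} = (\<Union>l\<in>{l\<in>L k. P l}. {t\<in>space R. p t (length l) = l})"
        using p by (auto simp: L_def)
      also have "\<dots> \<in> sets R"
      proof (rule sets.finite_UN)
        show "finite {l \<in> L k. P l}" by (rule finite_subset[OF _ finL[of k]]) auto
      qed (use pm(1) in \<open>auto simp: L_def\<close>)
      finally show ?thesis .
    qed
    have \<phi>meas: "\<phi> \<in> measurable R (borel_of_top X)"
    proof (rule measurable_into_borel_of_top)
      fix U assume "openin X U"
      then have U: "openin mtopology U" by (simp add: Md(2))
      \<comment> \<open>\<open>V n\<close> is U shrunk by 1 / (n + 1). The limit lies in U exactly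
        when the sample points eventually stay in some \<open>V n\<close>, and this is a countable
        combination of events that each depend on finitely many steps of the path.\<close>
      define V where "V n = {y \<in> M. mball y (1 / real (Suc n)) \<subseteq> U}" for n
      have iff: "\<phi> t \<in> U \<longleftrightarrow> (\<exists>n N. \<forall>k. N \<le> k \<longrightarrow> x (p t k) \<in> V n)" if t: "t \<in> space R" for t
      proof
        assume "\<phi> t \<in> U"
        then obtain r where r: "0 < r" "mball (\<phi> t) r \<subseteq> U" using U unfolding openin_mtopology by blast
        obtain n where n: "inverse (real (Suc n)) < r/2" using reals_Archimedean[of "r/2"] r(1) by auto
        have "\<forall>\<^sub>F k in sequentially. d (x (p t k)) (\<phi> t) < r/2" using \<phi>ev[OF t, of "r/2"] r(1) by auto
        then obtain N where N: "\<And>k. N \<le> k \<Longrightarrow> d (x (p t k)) (\<phi> t) < r/2" by (auto simp: eventually_sequentially)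
        have "mball (x (p t k)) (1 / real (Suc n)) \<subseteq> U" if k: "N \<le> k" for k
        proof
          fix y assume y: "y \<in> mball (x (p t k)) (1 / real (Suc n))"
          then have "d (\<phi> t) y < r"
            using triangle[of "\<phi> t" "x (p t k)" y] N[OF k] n commute[of "\<phi> t" "x (p t k)"] \<phi>M[OF t] xM[OF t]
            by (auto simp: in_mball inverse_eq_divide)
          then show "y \<in> U" using r(2) y \<phi>M[OF t] by (auto simp: in_mball)
        qed
        then show "\<exists>n N. \<forall>k. N \<le> k \<longrightarrow> x (p t k) \<in> V n" using xM[OF t] by (auto simp: V_def)
      next
        assume "\<exists>n N. \<forall>k. N \<le> k \<longrightarrow> x (p t k) \<in> V n"
        then obtain n N where nN: "\<And>k. N \<le> k \<Longrightarrow> x (p t k) \<in> V n" by auto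
        have "\<forall>\<^sub>F k in sequentially. d (x (p t k)) (\<phi> t) < 1 / real (Suc n)" by (rule \<phi>ev[OF t]) simp
        then obtain N' where N': "\<And>k. N' \<le> k \<Longrightarrow> d (x (p t k)) (\<phi> t) < 1 / real (Suc n)"
          unfolding eventually_sequentially by blast
        then show "\<phi> t \<in> U"
          using nN[of "max N N'"] N'[of "max N N'"] \<phi>M[OF t] by (auto simp: V_def in_mball)
      qed
      have "{t \<in> space R. \<phi> t \<in> U} = {t \<in> space R. \<exists>n N. \<forall>k. N \<le> k \<longrightarrow> x (p t k) \<in> V n}"
        by (rule Collect_cong, rule conj_cong[OF refl], erule iff)
      also have "\<dots> \<in> sets R"
        using pmeas[of "\<lambda>l. x l \<in> V _"]
        by (intro sets.sets_Collect_countable_Ex sets.sets_Collect_countable_All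
            sets.sets_Collect_imp sets.sets_Collect_const)
      finally show "{t \<in> space R. \<phi> t \<in> U} \<in> sets R" .
    qed (use \<phi>M in auto)
    have "\<bar>(\<integral>y. f y \<partial>(distr R (borel_of_top X) \<phi>)) - (\<Sum>l\<in>L k. w l * f (x l))\<bar> \<le> \<epsilon>"
      if f: "continuous_map X euclideanreal f" and o: "osc f \<epsilon> k" for f \<epsilon> k
    proof -
      have fm: "f \<in> borel_measurable (borel_of_top X)" by (rule continuous_map_measurable_real[OF f])
      have "\<bar>(\<integral>t. f (\<phi> t) \<partial>R) - (\<Sum>l\<in>L k. measure R {t\<in>space R. p t (length l) = l} * f (x l))\<bar> \<le> \<epsilon>"
      proof (rule integral_approx_finite_partition[OF R finL])
        show "(\<lambda>t. f (\<phi> t)) \<in> borel_measurable R" by (rule measurable_compose[OF \<phi>meas fm])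
        show "{t\<in>space R. p t (length l) = l} \<in> sets R" if "l \<in> L k" for l
          using that pm by (auto simp: L_def)
        show "disjoint_family_on (\<lambda>l. {t\<in>space R. p t (length l) = l}) (L k)"
          by (auto simp: disjoint_family_on_def L_def)
        show "space R \<subseteq> (\<Union>l\<in>L k. {t\<in>space R. p t (length l) = l})"
          using p by (auto simp: L_def)
        fix l t assume l: "l \<in> L k" "t \<in> {t\<in>space R. p t (length l) = l}"
        then have t: "t \<in> space R" "p t k = l" by (auto simp: L_def)
        have "limitin euclideanreal (f \<circ> (\<lambda>k. x (p t k))) (f (\<phi> t)) sequentially"
          by (rule continuous_map_limit[OF _ \<phi>[OF t(1)]]) (use f Md(2) in simp)
        then have lim: "(\<lambda>j. f (x (p t j))) \<longlonglongrightarrow> f (\<phi> t)" by (simp add: o_def)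
        have "\<bar>f (x (p t j)) - f (x l)\<bar> \<le> \<epsilon>" if "k \<le> j" for j
        proof -
          have "x (p t j) \<in> cell l" "x l \<in> cell l" "k \<le> length l"
            using xp[OF t(1) that] xp[OF t(1) order_refl[of k]] t p(2)[OF t(1), of k] by auto
          then show ?thesis using o unfolding osc_def by blast
        qed
        then have "\<forall>\<^sub>F j in sequentially. \<bar>f (x (p t j)) - f (x l)\<bar> \<le> \<epsilon>"
          by (auto simp: eventually_sequentially)
        moreover have "(\<lambda>j. \<bar>f (x (p t j)) - f (x l)\<bar>) \<longlonglongrightarrow> \<bar>f (\<phi> t) - f (x l)\<bar>"
          by (intro tendsto_intros lim)
        ultimately show "\<bar>f (\<phi> t) - f (x l)\<bar> \<le> \<epsilon>"
          by (intro tendsto_upperbound[of _ _ sequentially]) auto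
      qed
      also have "(\<Sum>l\<in>L k. measure R {t\<in>space R. p t (length l) = l} * f (x l)) = (\<Sum>l\<in>L k. w l * f (x l))"
        using pm(2) by (intro sum.cong) (auto simp: L_def)
      finally show ?thesis by (simp add: integral_distr[OF \<phi>meas fm])
    qed
    then show "\<exists>\<mu>. \<mu> \<in> borel_probs X \<and> (\<forall>f \<epsilon> k. continuous_map X euclideanreal f \<longrightarrow> osc f \<epsilon> k \<longrightarrow>
      \<bar>(\<integral>y. f y \<partial>\<mu>) - (\<Sum>l\<in>L k. w l * f (x l))\<bar> \<le> \<epsilon>)"
      using distr_in_borel_probs[OF R \<phi>meas] by blast
  qed
  then obtain \<Psi> where \<Psi>: "\<And>w. w \<in> W \<Longrightarrow> \<Psi> w \<in> borel_probs X"
    "\<And>w f \<epsilon> k. w \<in> W \<Longrightarrow> continuous_map X euclideanreal f \<Longrightarrow> osc f \<epsilon> k \<Longrightarrow>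
      \<bar>(\<integral>y. f y \<partial>(\<Psi> w)) - (\<Sum>l\<in>L k. w l * f (x l))\<bar> \<le> \<epsilon>"
    unfolding bchoice_iff by blast
  have "continuous_map (top_of_set W) (prob_weak_star X) \<Psi>"
  proof (rule continuous_map_into_weak_star)
    fix f assume f: "continuous_map X euclideanreal f"
    \<comment> \<open>Each finite sum involves finitely many coordinates of w, and its error is at
      most the oscillation of f on the cells, uniformly in w.\<close>
    have "uniform_limit W (\<lambda>k w. \<Sum>l\<in>L k. w l * f (x l)) (\<lambda>w. \<integral>y. f y \<partial>(\<Psi> w)) sequentially"
    proof (rule uniform_limitI)
      fix \<epsilon> :: real assume "0 < \<epsilon>"
      then obtain k0 where k0: "\<forall>k\<ge>k0. osc f (\<epsilon>/2) k" using osc_ex[OF f, of "\<epsilon>/2"] by auto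
      have "dist (\<Sum>l\<in>L k. w l * f (x l)) (\<integral>y. f y \<partial>(\<Psi> w)) < \<epsilon>" if "k0 \<le> k" "w \<in> W" for k w
      proof -
        have "\<bar>(\<integral>y. f y \<partial>(\<Psi> w)) - (\<Sum>l\<in>L k. w l * f (x l))\<bar> \<le> \<epsilon>/2"
          using \<Psi>(2)[OF that(2) f] k0 that(1) by blast
        then show ?thesis using \<open>0 < \<epsilon>\<close> by (simp add: dist_real_def abs_minus_commute)
      qed
      then show "\<forall>\<^sub>F k in sequentially. \<forall>w\<in>W. dist (\<Sum>l\<in>L k. w l * f (x l)) (\<integral>y. f y \<partial>(\<Psi> w)) < \<epsilon>"
        by (auto simp: eventually_sequentially)
    qed
    moreover have "continuous_on W (\<lambda>w. \<Sum>l\<in>L k. w l * f (x l))" for k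
      by (intro continuous_on_sum continuous_on_mult_right continuous_on_subset[OF continuous_on_product_coordinates]) auto
    ultimately have "continuous_on W (\<lambda>w. \<integral>y. f y \<partial>(\<Psi> w))"
      by (intro uniform_limit_theorem[where F = sequentially]) auto
    then show "continuous_map (top_of_set W) euclideanreal (\<lambda>w. \<integral>y. f y \<partial>(\<Psi> w))" by simp
  qed (use \<Psi>(1) in simp)
  then have compI: "compactin (prob_weak_star X) (\<Psi> ` W)"
    by (rule image_compactin[rotated]) (use compW in \<open>simp add: compactin_subtopology\<close>)
  \<comment> \<open>The masses of the cells serve as w: the integrals against \<mu> and against
    \<open>\<Psi> w\<close> are then close to the same finite sums at every scale.\<close>
  have same: "\<exists>w\<in>W. \<forall>f. continuous_map X euclideanreal f \<longrightarrow> (\<integral>y. f y \<partial>\<mu>) = (\<integral>y. f y \<partial>(\<Psi> w))"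
    if \<mu>: "\<mu> \<in> borel_probs X" for \<mu>
  proof -
    interpret P: prob_space \<mu> using \<mu> by (rule borel_probsD)
    have sets\<mu>: "sets \<mu> = sets (borel_of_top X)" and sp\<mu>: "space \<mu> = M" using borel_probsD[OF \<mu>] by auto
    define w where "w l = (if valid_path m l then measure \<mu> (cell l) else 0)" for l
    have w1: "w [] = 1" using P.prob_space sp\<mu> by (simp add: w_def cell)
    have w2: "w l = (\<Sum>i<m (length l). w (i # l))" if "valid_path m l" for l
    proof -
      have "measure \<mu> (\<Union>i<m (length l). cell (i # l)) = (\<Sum>i<m (length l). measure \<mu> (cell (i # l)))"
        using cellborel celldisj1 by (intro P.finite_measure_finite_Union) (auto simp: sets\<mu> disjoint_family_on_def)
      then show ?thesis using that cellUn[of l] by (simp add: w_def)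
    qed
    have "0 \<le> w l" "w l \<le> 1" "cell l = {} \<Longrightarrow> w l = 0" for l by (auto simp: w_def)
    then have wW: "w \<in> W" using w1 w2 unfolding W_def path_weights_def by blast
    have "(\<integral>y. f y \<partial>\<mu>) = (\<integral>y. f y \<partial>(\<Psi> w))" if f: "continuous_map X euclideanreal f" for f
    proof -
      have "\<bar>(\<integral>y. f y \<partial>\<mu>) - (\<integral>y. f y \<partial>(\<Psi> w))\<bar> \<le> \<epsilon>" if "0 < \<epsilon>" for \<epsilon>
      proof -
        obtain k where k: "osc f (\<epsilon>/2) k" using osc_ex[OF f, of "\<epsilon>/2"] \<open>0 < \<epsilon>\<close> by auto
        have "\<bar>(\<integral>y. f y \<partial>\<mu>) - (\<Sum>l\<in>L k. measure \<mu> (cell l) * f (x l))\<bar> \<le> \<epsilon>/2"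
        proof (rule integral_approx_finite_partition[OF P.prob_space_axioms finL _ _ celldisj])
          show "f \<in> borel_measurable \<mu>"
            using continuous_map_measurable_real[OF f] borel_probs_measurable_eq[OF \<mu>] by blast
          show "cell l \<in> sets \<mu>" for l using cellborel sets\<mu> by simp
          show "space \<mu> \<subseteq> (\<Union>l\<in>L k. cell l)" using cellcover sp\<mu> by simp
          fix l t assume "l \<in> L k" "t \<in> cell l"
          then show "\<bar>f t - f (x l)\<bar> \<le> \<epsilon>/2" using k xcell[of l] unfolding osc_def by (auto simp: L_def)
        qed
        moreover have "(\<Sum>l\<in>L k. measure \<mu> (cell l) * f (x l)) = (\<Sum>l\<in>L k. w l * f (x l))"
          by (intro sum.cong) (auto simp: L_def w_def)
        moreover have "\<bar>(\<integral>y. f y \<partial>(\<Psi> w)) - (\<Sum>l\<in>L k. w l * f (x l))\<bar> \<le> \<epsilon>/2"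
          by (rule \<Psi>(2)[OF wW f k])
        ultimately show ?thesis by linarith
      qed
      then have "\<bar>(\<integral>y. f y \<partial>\<mu>) - (\<integral>y. f y \<partial>(\<Psi> w))\<bar> \<le> 0" by (rule field_le_epsilon[of _ 0, simplified])
      then show ?thesis by simp
    qed
    then show ?thesis using wW by blast
  qed
  show ?thesis
    unfolding compact_space_alt
  proof (intro allI impI, elim conjE)
    fix \<U> assume \<U>: "Ball \<U> (openin (prob_weak_star X))" "topspace (prob_weak_star X) \<subseteq> \<Union>\<U>"
    have "\<Psi> ` W \<subseteq> \<Union>\<U>" using \<U>(2) \<Psi>(1) by auto
    then obtain \<F> where F: "finite \<F>" "\<F> \<subseteq> \<U>" "\<Psi> ` W \<subseteq> \<Union>\<F>"
      using compI \<U>(1) unfolding compactin_def by blast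
    \<comment> \<open>An open set around \<open>\<Psi> w\<close> contains every measure with the
      same integrals, so a finite family that covers the image of \<open>W\<close> covers all
      measures.\<close>
    have "topspace (prob_weak_star X) \<subseteq> \<Union>\<F>"
    proof
      fix \<mu> assume "\<mu> \<in> topspace (prob_weak_star X)"
      then have \<mu>: "\<mu> \<in> borel_probs X" by simp
      then obtain w where w: "w \<in> W" "\<And>f. continuous_map X euclideanreal f \<Longrightarrow> (\<integral>y. f y \<partial>\<mu>) = (\<integral>y. f y \<partial>(\<Psi> w))"
        using same by blast
      obtain U where U: "U \<in> \<F>" "\<Psi> w \<in> U" using F(3) w(1) by blast
      then have "openin (prob_weak_star X) U" using F(2) \<U>(1) by blast
      from weak_star_nbhd[OF this U(2)] obtain G \<epsilon> where "\<forall>f\<in>G. continuous_map X euclideanreal f" "0 < \<epsilon>"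
        "{\<nu> \<in> borel_probs X. \<forall>f\<in>G. \<bar>(\<integral>x. f x \<partial>\<nu>) - (\<integral>x. f x \<partial>(\<Psi> w))\<bar> < \<epsilon>} \<subseteq> U" by blast
      then have "\<mu> \<in> U" using \<mu> w(2) by auto
      then show "\<mu> \<in> \<Union>\<F>" using U(1) by blast
    qed
    then show "\<exists>\<F>. finite \<F> \<and> \<F> \<subseteq> \<U> \<and> topspace (prob_weak_star X) \<subseteq> \<Union>\<F>" using F by blast
  qed
qed

section \<open>Zero entropy\<close>

lemma integral_le_imp_exists:
  assumes "prob_space M" "integrable M h" "(\<integral>x. h x \<partial>M) \<le> (c::real)"
  shows "\<exists>x\<in>space M. h x \<le> c"
proof (rule ccontr)
  interpret prob_space M by fact
  assume "\<not> (\<exists>x\<in>space M. h x \<le> c)"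
  then have "\<And>x. x \<in> space M \<Longrightarrow> c < h x" by force
  then have "(\<integral>x. c \<partial>M) < (\<integral>x. h x \<partial>M)"
    by (intro integral_less_AE_space assms(2)) (auto simp: emeasure_space_1)
  then show False using assms(3) by (simp add: prob_space)
qed

text \<open>Greedy form of Maurey's empirical method: the mean of the increment of the squared
  distance is its variance, so some sample point does not exceed it.\<close>

lemma empirical_approximation:
  fixes \<phi> :: "'k \<Rightarrow> 'a \<Rightarrow> real"
  assumes "prob_space M" "finite K"
    and meas: "\<And>\<kappa>. \<kappa> \<in> K \<Longrightarrow> \<phi> \<kappa> \<in> borel_measurable M"
    and range: "\<And>\<kappa> x. \<kappa> \<in> K \<Longrightarrow> x \<in> space M \<Longrightarrow> \<phi> \<kappa> x \<in> {0..1}"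
  shows "\<exists>x. (\<forall>r. x r \<in> space M) \<and>
    (\<Sum>\<kappa>\<in>K. (\<Sum>r<k. \<phi> \<kappa> (x r) - (\<integral>y. \<phi> \<kappa> y \<partial>M))\<^sup>2) \<le> real k * real (card K)"
proof (induction k)
  case 0
  obtain a where "a \<in> space M" using prob_space.not_empty[OF assms(1)] by blast
  then show ?case by (intro exI[of _ "\<lambda>_. a"]) simp
next
  case (Suc k)
  interpret prob_space M by fact
  define v where "v \<kappa> = (\<integral>y. \<phi> \<kappa> y \<partial>M)" for \<kappa>
  obtain x where x: "\<And>r. x r \<in> space M" "(\<Sum>\<kappa>\<in>K. (\<Sum>r<k. \<phi> \<kappa> (x r) - v \<kappa>)\<^sup>2) \<le> real k * real (card K)"
    using Suc unfolding v_def by blast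
  define s where "s \<kappa> = (\<Sum>r<k. \<phi> \<kappa> (x r) - v \<kappa>)" for \<kappa>
  have int: "integrable M (\<phi> \<kappa>)" if "\<kappa> \<in> K" for \<kappa>
    by (rule integrable_const_bound[of _ 1]) (use range[OF that] meas[OF that] in \<open>auto intro!: AE_I2\<close>)
  have v01: "v \<kappa> \<in> {0..1}" if "\<kappa> \<in> K" for \<kappa>
  proof -
    have "(\<integral>y. \<phi> \<kappa> y \<partial>M) \<le> (\<integral>y. 1 \<partial>M)" by (rule integral_mono) (use int range that in auto)
    moreover have "0 \<le> (\<integral>y. \<phi> \<kappa> y \<partial>M)" by (rule integral_nonneg_AE) (use range that in auto)
    ultimately show ?thesis by (simp add: v_def prob_space)
  qed
  have sq: "(\<phi> \<kappa> y - v \<kappa>)\<^sup>2 \<le> 1" if "\<kappa> \<in> K" "y \<in> space M" for \<kappa> y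
    using range[OF that] v01[OF that(1)] by (simp add: abs_square_le_1 abs_le_iff)
  have intsq: "integrable M (\<lambda>y. (\<phi> \<kappa> y - v \<kappa>)\<^sup>2)" if "\<kappa> \<in> K" for \<kappa>
    by (rule integrable_const_bound[of _ 1]) (use sq[OF that] meas[OF that] in \<open>auto intro!: AE_I2\<close>)
  have expand: "(s \<kappa> + (\<phi> \<kappa> y - v \<kappa>))\<^sup>2 = (s \<kappa>)\<^sup>2 + 2 * s \<kappa> * (\<phi> \<kappa> y - v \<kappa>) + (\<phi> \<kappa> y - v \<kappa>)\<^sup>2" for \<kappa> y
    by (simp add: power2_sum)
  have int2: "integrable M (\<lambda>y. (s \<kappa> + (\<phi> \<kappa> y - v \<kappa>))\<^sup>2)" if "\<kappa> \<in> K" for \<kappa>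
    unfolding expand using int[OF that] intsq[OF that] by simp
  have "(\<integral>y. (s \<kappa> + (\<phi> \<kappa> y - v \<kappa>))\<^sup>2 \<partial>M) \<le> (s \<kappa>)\<^sup>2 + 1" if "\<kappa> \<in> K" for \<kappa>
  proof -
    have "(\<integral>y. \<phi> \<kappa> y - v \<kappa> \<partial>M) = 0"
      using int[OF that] by (simp add: v_def prob_space)
    then have "(\<integral>y. (s \<kappa> + (\<phi> \<kappa> y - v \<kappa>))\<^sup>2 \<partial>M) = (s \<kappa>)\<^sup>2 + (\<integral>y. (\<phi> \<kappa> y - v \<kappa>)\<^sup>2 \<partial>M)"
      unfolding expand using int[OF that] intsq[OF that] by (simp add: prob_space)
    moreover have "(\<integral>y. (\<phi> \<kappa> y - v \<kappa>)\<^sup>2 \<partial>M) \<le> (\<integral>y. 1 \<partial>M)"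
      by (rule integral_mono) (use intsq sq that in auto)
    ultimately show ?thesis by (simp add: prob_space)
  qed
  then have "(\<Sum>\<kappa>\<in>K. \<integral>y. (s \<kappa> + (\<phi> \<kappa> y - v \<kappa>))\<^sup>2 \<partial>M) \<le> (\<Sum>\<kappa>\<in>K. (s \<kappa>)\<^sup>2 + 1)"
    by (rule sum_mono)
  also have "\<dots> \<le> real (Suc k) * real (card K)"
    using x(2) by (simp add: s_def sum.distrib algebra_simps)
  finally have "(\<integral>y. (\<Sum>\<kappa>\<in>K. (s \<kappa> + (\<phi> \<kappa> y - v \<kappa>))\<^sup>2) \<partial>M) \<le> real (Suc k) * real (card K)"
    using int2 by (simp add: Bochner_Integration.integral_sum)
  from integral_le_imp_exists[OF assms(1) _ this] int2
  obtain y where y: "y \<in> space M" "(\<Sum>\<kappa>\<in>K. (s \<kappa> + (\<phi> \<kappa> y - v \<kappa>))\<^sup>2) \<le> real (Suc k) * real (card K)"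
    by (auto intro: Bochner_Integration.integrable_sum)
  show ?case
    using y x(1) by (intro exI[of _ "x(k := y)"]) (simp add: s_def flip: v_def)
qed

section \<open>Choice of cuts and the covers defined by them\<close>

text \<open>Union bound. For a centre c and a set E of h coordinates, at most L^(card D - h)
  functions match c on all of E, since every coordinate in E leaves at most one value. There are at
  most 2^(card D) sets E, so \<open>few\<close> leaves a function that is not bad. In the
  application \<open>Mt c x v\<close> says that c comes close to the cut placed in slot v of
  coordinate x.\<close>

lemma avoid_matches:
  fixes L :: nat
  assumes fin: "finite D" "finite Cen" and "0 < L"
    and uniq: "\<And>c x v v'. c \<in> Cen \<Longrightarrow> x \<in> D \<Longrightarrow> Mt c x v \<Longrightarrow> Mt c x v' \<Longrightarrow> v < L \<Longrightarrow> v' < L \<Longrightarrow> v = v'"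
    and few: "card Cen * 2 ^ card D < L ^ h"
  shows "\<exists>g. (\<forall>x\<in>D. g x < L) \<and> (\<forall>c\<in>Cen. card {x\<in>D. Mt c x (g x)} < h)"
proof (cases "h \<le> card D")
  case False
  have "card {x\<in>D. Mt c x 0} < h" for c
    using False card_mono[of D "{x\<in>D. Mt c x 0}"] fin by auto
  then show ?thesis using \<open>0 < L\<close> by (intro exI[of _ "\<lambda>_. 0"]) auto
next
  case True
  define \<E> where "\<E> = {E. E \<subseteq> D \<and> card E = h}"
  define bad where "bad c E = (\<Pi>\<^sub>E x\<in>D. if x \<in> E then {v\<in>{..<L}. Mt c x v} else {..<L})" for c E
  have cbad: "card (bad c E) \<le> L ^ (card D - h)" if "c \<in> Cen" "E \<in> \<E>" for c E
  proof -
    have E: "E \<subseteq> D" "card E = h" "finite E" using that(2) fin(1) by (auto simp: \<E>_def intro: finite_subset)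
    have "card (bad c E) = (\<Prod>x\<in>D. card (if x \<in> E then {v\<in>{..<L}. Mt c x v} else {..<L}))"
      unfolding bad_def using fin(1) by (rule card_PiE)
    also have "\<dots> \<le> (\<Prod>x\<in>D. if x \<in> E then 1 else L)"
    proof (rule prod_mono, intro conjI)
      fix x assume "x \<in> D"
      have "card {v\<in>{..<L}. Mt c x v} \<le> 1"
        by (rule card_le_Suc0_iff_eq[THEN iffD2, unfolded One_nat_def[symmetric]])
          (use uniq[OF that(1) \<open>x \<in> D\<close>] in auto)
      then show "card (if x \<in> E then {v\<in>{..<L}. Mt c x v} else {..<L}) \<le> (if x \<in> E then 1 else L)"
        by simp
    qed simp
    also have "\<dots> = L ^ card (D - E)"
      using fin(1) E(1) by (simp add: prod.If_cases Diff_eq)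
    also have "card (D - E) = card D - h" using E by (simp add: card_Diff_subset)
    finally show ?thesis .
  qed
  have "card (\<Union>c\<in>Cen. \<Union>E\<in>\<E>. bad c E) \<le> (\<Sum>c\<in>Cen. \<Sum>E\<in>\<E>. card (bad c E))"
    using fin by (intro order_trans[OF card_UN_le] sum_mono card_UN_le) (auto simp: \<E>_def)
  also have "\<dots> \<le> (\<Sum>c\<in>Cen. \<Sum>E\<in>\<E>. L ^ (card D - h))"
    by (intro sum_mono cbad)
  also have "\<dots> = card Cen * card \<E> * L ^ (card D - h)" by simp
  also have "card \<E> \<le> card (Pow D)" using fin(1) by (intro card_mono) (auto simp: \<E>_def)
  also have "card (Pow D) = 2 ^ card D" by (rule card_Pow[OF fin(1)])
  also have "card Cen * 2 ^ card D * L ^ (card D - h) < L ^ h * L ^ (card D - h)"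
    using few \<open>0 < L\<close> by simp
  also have "\<dots> = card (\<Pi>\<^sub>E x\<in>D. {..<L})"
    using True fin(1) by (simp add: card_PiE flip: power_add)
  finally have "card (\<Union>c\<in>Cen. \<Union>E\<in>\<E>. bad c E) < card (\<Pi>\<^sub>E x\<in>D. {..<L})" by simp
  then have "\<not> (\<Pi>\<^sub>E x\<in>D. {..<L}) \<subseteq> (\<Union>c\<in>Cen. \<Union>E\<in>\<E>. bad c E)"
  proof -
    have "finite (bad c E)" for c E
      unfolding bad_def using fin(1) by (intro finite_PiE) auto
    then have "finite (\<Union>c\<in>Cen. \<Union>E\<in>\<E>. bad c E)" using fin by (auto simp: \<E>_def)
    then show ?thesis using \<open>card _ < card _\<close> card_mono leD by blast
  qed
  then obtain g where g: "g \<in> (\<Pi>\<^sub>E x\<in>D. {..<L})" "\<And>c E. c \<in> Cen \<Longrightarrow> E \<in> \<E> \<Longrightarrow> g \<notin> bad c E" by blast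
  have "card {x\<in>D. Mt c x (g x)} < h" if c: "c \<in> Cen" for c
  proof (rule ccontr)
    assume "\<not> card {x\<in>D. Mt c x (g x)} < h"
    then obtain E where E: "E \<subseteq> {x\<in>D. Mt c x (g x)}" "card E = h"
      using obtain_subset_with_card_n[of h "{x\<in>D. Mt c x (g x)}"] by auto
    then have "E \<in> \<E>" by (auto simp: \<E>_def)
    moreover have "g \<in> bad c E" using g(1) E(1) by (auto simp: bad_def PiE_iff)
    ultimately show False using g(2)[OF c] by blast
  qed
  then show ?thesis using g(1) by (intro exI[of _ g]) (auto simp: PiE_iff)
qed

text \<open>The sets \<open>{x. s < \<theta> x y}\<close> for \<open>0 \<le> s < 1\<close> form a chain; each of them is the index of a
  member of the cover containing \<open>y\<close>.\<close>

lemma cover_from_cuts: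
  fixes \<theta> :: "'d \<Rightarrow> 'y \<Rightarrow> real"
  assumes fin: "finite D"
    and cont: "\<And>x. x \<in> D \<Longrightarrow> continuous_map Y euclideanreal (\<theta> x)"
    and range: "\<And>x y. x \<in> D \<Longrightarrow> y \<in> topspace Y \<Longrightarrow> \<theta> x y \<in> {0..1}"
    and few: "\<And>y. y \<in> topspace Y \<Longrightarrow> card {x\<in>D. 0 < \<theta> x y \<and> \<theta> x y < 1} \<le> N"
  shows "\<exists>\<B>. finite_open_cover Y \<B> \<and> (\<forall>y\<in>topspace Y. multiplicity_at \<B> y \<le> N + 1) \<and> {} \<notin> \<B> \<and>
    (\<forall>B\<in>\<B>. \<exists>P. \<forall>y\<in>B. (\<forall>x\<in>D \<inter> P. 0 < \<theta> x y) \<and> (\<forall>x\<in>D - P. \<theta> x y < 1))"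
proof -
  \<comment> \<open>Comparing \<theta> inside and outside P forces the index sets of any two members
    containing y to be nested. They all lie between the coordinates with \<theta> equal to 1 and
    those with \<theta> positive, so there is at most one more of them than there are fractional
    coordinates.\<close>
  define B where "B P = {y \<in> topspace Y. (\<forall>x\<in>P. 0 < \<theta> x y) \<and> (\<forall>x\<in>D - P. \<theta> x y < 1) \<and>
    (\<forall>x\<in>P. \<forall>x'\<in>D - P. \<theta> x' y < \<theta> x y)}" for P
  \<comment> \<open>Empty members are dropped, so that each remaining one has a base point; the
    refinement proof later picks members of the given cover around the orbit of such a
    point.\<close>
  define \<B> where "\<B> = B ` Pow D - {{}}"
  have all_open: "openin Y {y \<in> topspace Y. \<forall>x\<in>P. R x y}"
    if "finite P" "\<And>x. x \<in> P \<Longrightarrow> openin Y {y \<in> topspace Y. R x y}" for P :: "'c set" and R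
    using that
  proof (induction P rule: finite_induct)
    case (insert x P)
    have "{y \<in> topspace Y. \<forall>x\<in>insert x P. R x y} = {y \<in> topspace Y. R x y} \<inter> {y \<in> topspace Y. \<forall>x\<in>P. R x y}"
      by auto
    then show ?case using insert by auto
  qed simp
  have openB: "openin Y (B P)" if P: "P \<subseteq> D" for P
  proof -
    have fP: "finite P" "finite (D - P)" using P fin by (auto intro: finite_subset)
    have "B P = {y \<in> topspace Y. \<forall>x\<in>P. 0 < \<theta> x y} \<inter> {y \<in> topspace Y. \<forall>x\<in>D - P. \<theta> x y < 1}
      \<inter> {y \<in> topspace Y. \<forall>x\<in>P. \<forall>x'\<in>D - P. \<theta> x' y < \<theta> x y}"
      by (auto simp: B_def)
    also have "openin Y \<dots>"
      using P by (intro openin_Int all_open fP openin_less cont) auto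
    finally show ?thesis .
  qed
  have "\<Union>\<B> = topspace Y"
  proof
    show "\<Union>\<B> \<subseteq> topspace Y" by (auto simp: \<B>_def B_def)
    show "topspace Y \<subseteq> \<Union>\<B>"
    proof
      fix y assume "y \<in> topspace Y"
      then have "y \<in> B {x\<in>D. 1/2 < \<theta> x y}" by (auto simp: B_def)
      moreover have "B {x\<in>D. 1/2 < \<theta> x y} \<in> B ` Pow D" by (rule imageI) auto
      ultimately show "y \<in> \<Union>\<B>" by (auto simp only: \<B>_def)
    qed
  qed
  moreover have "openin Y C" if "C \<in> \<B>" for C
    using that openB by (auto simp only: \<B>_def Diff_iff image_iff Pow_iff)
  moreover have "finite \<B>" using fin by (simp add: \<B>_def)
  ultimately have "finite_open_cover Y \<B>" by (simp add: finite_open_cover_def)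
  moreover have "multiplicity_at \<B> y \<le> N + 1" if y: "y \<in> topspace Y" for y
  proof -
    define \<P> where "\<P> = {P. P \<subseteq> D \<and> y \<in> B P}"
    define M1 where "M1 = {x\<in>D. \<theta> x y = 1}"
    define H where "H = {x\<in>D. 0 < \<theta> x y \<and> \<theta> x y < 1}"
    have fins: "finite M1" "finite H" "finite \<P>" using fin by (auto simp: M1_def H_def \<P>_def)
    have between: "M1 \<subseteq> P \<and> P \<subseteq> M1 \<union> H" if "P \<in> \<P>" for P
    proof (intro conjI subsetI)
      have P: "P \<subseteq> D" "y \<in> B P" using that by (auto simp: \<P>_def)
      show "x \<in> P" if "x \<in> M1" for x
      proof (rule ccontr)
        assume "x \<notin> P"
        then have "x \<in> D - P" using that by (simp add: M1_def)
        then have "\<theta> x y < 1" using P(2) by (simp add: B_def)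
        then show False using that by (simp add: M1_def)
      qed
      show "x \<in> M1 \<union> H" if "x \<in> P" for x
      proof -
        have "x \<in> D" "0 < \<theta> x y" using that P by (auto simp: B_def)
        then show ?thesis using range[OF _ y, of x] by (auto simp: M1_def H_def)
      qed
    qed
    have chain: "P \<subseteq> P' \<or> P' \<subseteq> P" if "P \<in> \<P>" "P' \<in> \<P>" for P P'
    proof (rule ccontr)
      assume "\<not> (P \<subseteq> P' \<or> P' \<subseteq> P)"
      then obtain a b where "a \<in> P" "a \<notin> P'" "b \<in> P'" "b \<notin> P" by blast
      then have "\<theta> b y < \<theta> a y" "\<theta> a y < \<theta> b y" using that by (auto simp: \<P>_def B_def)
      then show False by simp
    qed
    have "inj_on card \<P>"
    proof (rule inj_onI)
      fix P P' assume PP: "P \<in> \<P>" "P' \<in> \<P>" "card P = card P'"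
      have "finite P" "finite P'" using PP fin by (auto simp: \<P>_def intro: finite_subset)
      then show "P = P'" using chain[OF PP(1,2)] PP(3) by (auto dest: card_subset_eq)
    qed
    moreover have "card ` \<P> \<subseteq> {card M1..card M1 + card H}"
    proof (rule image_subsetI)
      fix P assume P: "P \<in> \<P>"
      have "card M1 \<le> card P" using between[OF P] fins by (intro card_mono) (auto intro: finite_subset)
      moreover have "card P \<le> card (M1 \<union> H)" using between[OF P] fins by (intro card_mono) auto
      ultimately show "card P \<in> {card M1..card M1 + card H}" using card_Un_le[of M1 H] by auto
    qed
    ultimately have "card \<P> \<le> card {card M1..card M1 + card H}" by (rule card_inj_on_le) simp
    then have "card \<P> \<le> card H + 1" by simp
    moreover have "multiplicity_at \<B> y \<le> card \<P>"
      unfolding multiplicity_at_def by (rule surj_card_le[OF fins(3), of _ B]) (auto simp: \<B>_def \<P>_def)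
    ultimately show ?thesis using few[OF y] by (simp add: H_def)
  qed
  moreover have "\<exists>P. \<forall>y\<in>C. (\<forall>x\<in>D \<inter> P. 0 < \<theta> x y) \<and> (\<forall>x\<in>D - P. \<theta> x y < 1)" if "C \<in> \<B>" for C
  proof -
    obtain P where "C = B P" using \<open>C \<in> \<B>\<close> by (auto simp: \<B>_def)
    then show ?thesis by (intro exI[of _ P]) (auto simp: B_def)
  qed
  moreover have "{} \<notin> \<B>" by (simp add: \<B>_def)
  ultimately show ?thesis by blast
qed

section \<open>Covers described by finitely many functions\<close>

text \<open>A Lebesgue number with integrals in place of a metric: every measure has an integral
  neighborhood inside a member, finitely many halved neighborhoods cover by compactness, and the
  triangle inequality gives a tolerance valid everywhere.\<close>

lemma weak_star_lebesgue_number: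
  assumes X: "compact_space X" "metrizable_space X"
    and \<A>: "finite_open_cover (prob_weak_star X) \<A>"
  shows "\<exists>F \<epsilon>. finite F \<and> (\<forall>f\<in>F. continuous_map X euclideanreal f \<and> (\<forall>x\<in>topspace X. f x \<in> {0..1})) \<and> 0 < \<epsilon> \<and>
    (\<forall>\<mu>\<in>borel_probs X. \<exists>A\<in>\<A>. \<forall>\<nu>\<in>borel_probs X. (\<forall>f\<in>F. \<bar>(\<integral>x. f x \<partial>\<nu>) - (\<integral>x. f x \<partial>\<mu>)\<bar> < \<epsilon>) \<longrightarrow> \<nu> \<in> A)"
proof -
  define N where "N F \<epsilon> \<mu> = {\<nu> \<in> borel_probs X. \<forall>f\<in>F. \<bar>(\<integral>x. f x \<partial>\<nu>) - (\<integral>x. f x \<partial>\<mu>)\<bar> < (\<epsilon>::real)}"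
    for F :: "('a \<Rightarrow> real) set" and \<epsilon> \<mu>
  have "\<forall>\<mu>\<in>borel_probs X. \<exists>F \<epsilon> A. finite F \<and> (\<forall>f\<in>F. continuous_map X euclideanreal f) \<and> 0 < \<epsilon> \<and> A \<in> \<A> \<and> N F \<epsilon> \<mu> \<subseteq> A"
  proof
    fix \<mu> assume "\<mu> \<in> borel_probs X"
    then obtain A where A: "A \<in> \<A>" "\<mu> \<in> A" "openin (prob_weak_star X) A"
      using \<A> unfolding finite_open_cover_def by (metis UnionE topspace_prob_weak_star)
    show "\<exists>F \<epsilon> A. finite F \<and> (\<forall>f\<in>F. continuous_map X euclideanreal f) \<and> 0 < \<epsilon> \<and> A \<in> \<A> \<and> N F \<epsilon> \<mu> \<subseteq> A"
      using weak_star_nbhd[OF A(3,2)] A(1) unfolding N_def by meson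
  qed
  then obtain F \<epsilon> A where FA: "\<forall>\<mu>\<in>borel_probs X. finite (F \<mu>) \<and> (\<forall>f\<in>F \<mu>. continuous_map X euclideanreal f)
    \<and> 0 < \<epsilon> \<mu> \<and> A \<mu> \<in> \<A> \<and> N (F \<mu>) (\<epsilon> \<mu>) \<mu> \<subseteq> A \<mu>"
    unfolding bchoice_iff by blast
  define V where "V \<mu> = N (F \<mu>) (\<epsilon> \<mu> / 2) \<mu>" for \<mu>
  have "openin (prob_weak_star X) (V \<mu>)" if \<mu>: "\<mu> \<in> borel_probs X" for \<mu>
  proof -
    define h where "h f \<nu> = \<bar>(\<integral>x. f x \<partial>\<nu>) - (\<integral>x. f x \<partial>\<mu>)\<bar>" for f :: "'a \<Rightarrow> real" and \<nu>
    have "openin (prob_weak_star X) {\<nu> \<in> topspace (prob_weak_star X). h f \<nu> \<in> {..<\<epsilon> \<mu> / 2}}" if "f \<in> F \<mu>" for f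
    proof (rule openin_continuous_map_preimage)
      show "continuous_map (prob_weak_star X) euclideanreal (h f)"
        unfolding h_def using FA \<mu> that
        by (intro continuous_map_real_abs continuous_map_diff continuous_map_weak_star_integral) auto
    qed simp
    then have "openin (prob_weak_star X) (topspace (prob_weak_star X) \<inter>
        (\<Inter>f\<in>F \<mu>. {\<nu> \<in> topspace (prob_weak_star X). h f \<nu> \<in> {..<\<epsilon> \<mu> / 2}}))"
      by (intro openin_Int_Inter[OF _ openin_topspace]) (use FA \<mu> in auto)
    also have "topspace (prob_weak_star X) \<inter>
        (\<Inter>f\<in>F \<mu>. {\<nu> \<in> topspace (prob_weak_star X). h f \<nu> \<in> {..<\<epsilon> \<mu> / 2}}) = V \<mu>"
      by (auto simp: V_def N_def h_def)
    finally show ?thesis .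
  qed
  moreover have "topspace (prob_weak_star X) \<subseteq> \<Union>(V ` borel_probs X)"
  proof
    fix \<mu> assume "\<mu> \<in> topspace (prob_weak_star X)"
    then have "\<mu> \<in> borel_probs X" by simp
    moreover from this have "\<mu> \<in> V \<mu>" using FA by (auto simp: V_def N_def)
    ultimately show "\<mu> \<in> \<Union>(V ` borel_probs X)" by blast
  qed
  ultimately obtain \<F> where F: "finite \<F>" "\<F> \<subseteq> V ` borel_probs X" "topspace (prob_weak_star X) \<subseteq> \<Union>\<F>"
    using compact_space_weak_star[OF X] unfolding compact_space_alt by (metis (no_types, lifting) imageE)
  then obtain P where P: "finite P" "P \<subseteq> borel_probs X" "borel_probs X \<subseteq> \<Union>(V ` P)"
    by (metis finite_subset_image topspace_prob_weak_star)
  define G where "G = (\<Union>\<mu>\<in>P. F \<mu>)"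
  define e where "e = Min (insert 1 ((\<lambda>\<mu>. \<epsilon> \<mu> / 2) ` P))"
  have Gfin: "finite G" and Gcont: "\<And>f. f \<in> G \<Longrightarrow> continuous_map X euclideanreal f"
    using P FA by (auto simp: G_def)
  have e: "0 < e" "\<And>\<mu>. \<mu> \<in> P \<Longrightarrow> e \<le> \<epsilon> \<mu> / 2"
  proof -
    show "0 < e" unfolding e_def using P FA by (subst Min_gr_iff) auto
    show "e \<le> \<epsilon> \<mu> / 2" if "\<mu> \<in> P" for \<mu>
      unfolding e_def by (rule Min_le) (use P(1) that in auto)
  qed
  have main: "\<exists>A\<in>\<A>. \<forall>\<nu>\<in>borel_probs X. (\<forall>f\<in>G. \<bar>(\<integral>x. f x \<partial>\<nu>) - (\<integral>x. f x \<partial>\<mu>)\<bar> < e) \<longrightarrow> \<nu> \<in> A"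
    if \<mu>: "\<mu> \<in> borel_probs X" for \<mu>
  proof -
    obtain \<mu>' where \<mu>': "\<mu>' \<in> P" "\<mu> \<in> V \<mu>'" using P(3) \<mu> by blast
    then have \<mu>'b: "\<mu>' \<in> borel_probs X" using P(2) by blast
    have "\<nu> \<in> A \<mu>'" if \<nu>: "\<nu> \<in> borel_probs X" "\<forall>f\<in>G. \<bar>(\<integral>x. f x \<partial>\<nu>) - (\<integral>x. f x \<partial>\<mu>)\<bar> < e" for \<nu>
    proof -
      have "\<bar>(\<integral>x. f x \<partial>\<nu>) - (\<integral>x. f x \<partial>\<mu>')\<bar> < \<epsilon> \<mu>'" if f: "f \<in> F \<mu>'" for f
      proof -
        have "\<bar>(\<integral>x. f x \<partial>\<nu>) - (\<integral>x. f x \<partial>\<mu>)\<bar> < \<epsilon> \<mu>' / 2"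
          using \<nu>(2) f \<mu>'(1) e(2)[OF \<mu>'(1)] by (fastforce simp: G_def)
        moreover have "\<bar>(\<integral>x. f x \<partial>\<mu>) - (\<integral>x. f x \<partial>\<mu>')\<bar> < \<epsilon> \<mu>' / 2"
          using \<mu>'(2) f by (auto simp: V_def N_def)
        ultimately show ?thesis by linarith
      qed
      then have "\<nu> \<in> N (F \<mu>') (\<epsilon> \<mu>') \<mu>'" using \<nu>(1) by (simp add: N_def)
      then show ?thesis using FA \<mu>'b by blast
    qed
    moreover have "A \<mu>' \<in> \<A>" using FA \<mu>'b by blast
    ultimately show ?thesis by blast
  qed
  have "\<exists>B>0. \<forall>x\<in>topspace X. \<bar>f x\<bar> \<le> B" if "f \<in> G" for f
    using compact_space_continuous_bounded[OF X(1) Gcont[OF that]] .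
  then obtain b where b: "\<And>f. f \<in> G \<Longrightarrow> 0 < b f" "\<And>f x. f \<in> G \<Longrightarrow> x \<in> topspace X \<Longrightarrow> \<bar>f x\<bar> \<le> b f"
    by metis
  define B where "B = Max (insert 1 (b ` G))"
  have B: "1 \<le> B" "\<And>f. f \<in> G \<Longrightarrow> b f \<le> B" using Gfin by (auto simp: B_def)
  \<comment> \<open>Affine change to the range [0, 1], which divides deviations of integrals by 2 B.
    The empirical method and the cuts of the unit interval work in this range.\<close>
  define u where "u f x = (f x + B) / (2 * B)" for f :: "'a \<Rightarrow> real" and x
  have int_u: "(\<integral>x. u f x \<partial>\<mu>) = ((\<integral>x. f x \<partial>\<mu>) + B) / (2 * B)" if "f \<in> G" "\<mu> \<in> borel_probs X" for f \<mu>
  proof -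
    interpret prob_space \<mu> using that(2) by (rule borel_probsD)
    have "integrable \<mu> f" by (rule continuous_map_integrable[OF X(1) Gcont[OF that(1)] that(2)])
    then show ?thesis by (simp add: u_def prob_space)
  qed
  show ?thesis
  proof (intro exI[of _ "u ` G"] exI[of _ "e / (2 * B)"] conjI ballI)
    show "finite (u ` G)" using Gfin by simp
    show "0 < e / (2 * B)" using e(1) B(1) by simp
    fix g assume "g \<in> u ` G"
    then obtain f where f: "f \<in> G" "g = u f" by blast
    show "continuous_map X euclideanreal g"
      unfolding f(2) u_def using B(1)
      by (intro continuous_map_real_divide continuous_map_add Gcont f(1) continuous_map_const[THEN iffD2]) auto
    fix x assume x: "x \<in> topspace X"
    have "\<bar>f x\<bar> \<le> B" using b(2)[OF f(1) x] B(2)[OF f(1)] by linarith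
    then show "g x \<in> {0..1}" using B(1) unfolding f(2) u_def by (auto simp: abs_le_iff)
  next
    fix \<mu> assume \<mu>: "\<mu> \<in> borel_probs X"
    obtain A where A: "A \<in> \<A>"
      "\<And>\<nu>. \<nu> \<in> borel_probs X \<Longrightarrow> (\<forall>f\<in>G. \<bar>(\<integral>x. f x \<partial>\<nu>) - (\<integral>x. f x \<partial>\<mu>)\<bar> < e) \<Longrightarrow> \<nu> \<in> A"
      using main[OF \<mu>] by blast
    have "\<nu> \<in> A" if \<nu>: "\<nu> \<in> borel_probs X"
      "\<forall>g\<in>u ` G. \<bar>(\<integral>x. g x \<partial>\<nu>) - (\<integral>x. g x \<partial>\<mu>)\<bar> < e / (2 * B)" for \<nu>
    proof (rule A(2)[OF \<nu>(1)], rule ballI)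
      fix f assume f: "f \<in> G"
      then have "\<bar>(\<integral>x. u f x \<partial>\<nu>) - (\<integral>x. u f x \<partial>\<mu>)\<bar> < e / (2 * B)" using \<nu>(2) by blast
      also have "(\<integral>x. u f x \<partial>\<nu>) - (\<integral>x. u f x \<partial>\<mu>) = ((\<integral>x. f x \<partial>\<nu>) - (\<integral>x. f x \<partial>\<mu>)) / (2 * B)"
        unfolding int_u[OF f \<nu>(1)] int_u[OF f \<mu>] by (simp add: diff_divide_distrib[symmetric])
      finally show "\<bar>(\<integral>x. f x \<partial>\<nu>) - (\<integral>x. f x \<partial>\<mu>)\<bar> < e"
        using B(1) by (simp add: abs_divide divide_less_cancel)
    qed
    then show "\<exists>A\<in>\<A>. \<forall>\<nu>\<in>borel_probs X. (\<forall>f\<in>u ` G. \<bar>(\<integral>x. f x \<partial>\<nu>) - (\<integral>x. f x \<partial>\<mu>)\<bar> < e / (2 * B)) \<longrightarrow> \<nu> \<in> A"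
      using A(1) by blast
  qed
qed

text \<open>Turns closeness of the functions into a cover of X, so that the entropy of this cover
  counts orbit segments up to \<rho>.\<close>

lemma oscillation_cover:
  assumes "compact_space X" "finite F" "\<And>f. f \<in> F \<Longrightarrow> continuous_map X euclideanreal f" "0 < (\<rho>::real)"
  shows "\<exists>\<U>. finite_open_cover X \<U> \<and> (\<forall>U\<in>\<U>. \<forall>x\<in>U. \<forall>y\<in>U. \<forall>f\<in>F. \<bar>f x - f y\<bar> \<le> \<rho>)"
proof -
  define V where "V x = topspace X \<inter> (\<Inter>f\<in>F. {y \<in> topspace X. \<bar>f y - f x\<bar> \<in> {..<\<rho>/2}})" for x
  have "openin X (V x)" for x
    unfolding V_def
  proof (rule openin_Int_Inter)
    fix W assume "W \<in> (\<lambda>f. {y \<in> topspace X. \<bar>f y - f x\<bar> \<in> {..<\<rho>/2}}) ` F"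
    then obtain f where f: "f \<in> F" "W = {y \<in> topspace X. \<bar>f y - f x\<bar> \<in> {..<\<rho>/2}}" by blast
    show "openin X W" unfolding f(2)
    proof (rule openin_continuous_map_preimage)
      show "continuous_map X euclideanreal (\<lambda>y. \<bar>f y - f x\<bar>)"
        using assms(3)[OF f(1)] by (intro continuous_map_real_abs continuous_map_diff) auto
    qed simp
  qed (use assms(2) in auto)
  moreover have "topspace X \<subseteq> \<Union>(V ` topspace X)"
  proof
    fix x assume x: "x \<in> topspace X"
    then have "x \<in> V x" using assms(4) by (auto simp: V_def)
    then show "x \<in> \<Union>(V ` topspace X)" using x by blast
  qed
  ultimately obtain \<F> where F: "finite \<F>" "\<F> \<subseteq> V ` topspace X" "topspace X \<subseteq> \<Union>\<F>"
    using assms(1) unfolding compact_space_alt by (metis (no_types, lifting) imageE)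
  show ?thesis
  proof (intro exI[of _ \<F>] conjI ballI)
    have "\<Union>\<F> \<subseteq> topspace X" using F(2) by (auto simp: V_def)
    then show "finite_open_cover X \<F>"
      using F \<open>\<And>x. openin X (V x)\<close> by (auto simp: finite_open_cover_def)
    fix U x y f assume *: "U \<in> \<F>" "x \<in> U" "y \<in> U" "f \<in> F"
    then obtain z where "U = V z" using F(2) by blast
    then have "\<bar>f x - f z\<bar> < \<rho>/2" "\<bar>f y - f z\<bar> < \<rho>/2" using * by (auto simp: V_def)
    then show "\<bar>f x - f y\<bar> \<le> \<rho>" by linarith
  qed
qed

section \<open>The dimension estimate for zero entropy\<close>

text \<open>Every axis [0, 1] is divided into Q intervals and each interval into L slots of width 4
  \<rho>. Each interval gets one cut: a ramp of half-width \<rho> about the centre of one slot.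
  Means at distance 2 / Q \<le> \<epsilon> have a whole interval between them and are separated by
  its cut. The constants are fixed in the order Q, L, \<rho>, k, all before n.\<close>

lemma iterated_cover_dim_small:
  assumes X: "compact_space X" "metrizable_space X" and T: "continuous_map X X T"
    and \<A>: "finite_open_cover (prob_weak_star X) \<A>"
    and zero: "\<And>\<U>. finite_open_cover X \<U> \<Longrightarrow> cover_entropy X T \<U> \<le> 0"
    and \<delta>: "0 < \<delta>"
  shows "\<forall>\<^sub>F n in sequentially.
    real_of_int (cover_dim (prob_weak_star X) (iterated_cover (prob_weak_star X) (push_forward X T) \<A> n)) \<le> \<delta> * real n"
proof -
  let ?Y = "prob_weak_star X" and ?S = "push_forward X T"
  obtain F \<epsilon> where F\<epsilon>: "finite F \<and> (\<forall>f\<in>F. continuous_map X euclideanreal f \<and> (\<forall>x\<in>topspace X. f x \<in> {0..1})) \<and> 0 < \<epsilon> \<and>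
    (\<forall>\<mu>\<in>borel_probs X. \<exists>A\<in>\<A>. \<forall>\<nu>\<in>borel_probs X. (\<forall>f\<in>F. \<bar>(\<integral>x. f x \<partial>\<nu>) - (\<integral>x. f x \<partial>\<mu>)\<bar> < \<epsilon>) \<longrightarrow> \<nu> \<in> A)"
    using weak_star_lebesgue_number[OF X \<A>] by (elim exE) (rule that)
  then have F: "finite F" "\<And>f. f \<in> F \<Longrightarrow> continuous_map X euclideanreal f"
    "\<And>f x. f \<in> F \<Longrightarrow> x \<in> topspace X \<Longrightarrow> f x \<in> {0..1}" and \<epsilon>: "0 < \<epsilon>"
    by simp_all
  have leb: "\<exists>A\<in>\<A>. \<forall>\<nu>\<in>borel_probs X. (\<forall>f\<in>F. \<bar>(\<integral>x. f x \<partial>\<nu>) - (\<integral>x. f x \<partial>\<mu>)\<bar> < \<epsilon>) \<longrightarrow> \<nu> \<in> A"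
    if "\<mu> \<in> borel_probs X" for \<mu>
    using F\<epsilon> that by (elim conjE) (rule bspec)
  define m where "m = card F"
  define Q where "Q = nat \<lceil>2/\<epsilon>\<rceil> + 1"
  have Q: "1 \<le> Q" "2 / real Q \<le> \<epsilon>"
  proof -
    have "2/\<epsilon> \<le> real Q" unfolding Q_def by linarith
    then have "2 \<le> \<epsilon> * real Q" using \<epsilon> by (simp only: pos_divide_le_eq mult.commute)
    moreover have "0 < real Q" by (simp add: Q_def)
    ultimately show "2 / real Q \<le> \<epsilon>" by (simp only: pos_divide_le_eq)
  qed (simp add: Q_def)
  \<comment> \<open>L^(\<delta> n / 2) has to exceed 2^(card D) = 2^(m n Q) times the number of
    centres, which will be below exp n.\<close>
  define L where "L = nat \<lceil>exp ((real m * real Q * ln 2 + 1) * 2 / \<delta>)\<rceil> + 1"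
  have L: "1 \<le> L" "real m * real Q * ln 2 + 1 < \<delta>/2 * ln (real L)"
  proof -
    have "exp ((real m * real Q * ln 2 + 1) * 2 / \<delta>) < real L" unfolding L_def by linarith
    then have "(real m * real Q * ln 2 + 1) * 2 / \<delta> < ln (real L)"
      by (metis exp_gt_zero exp_less_cancel_iff exp_ln less_trans)
    then show "real m * real Q * ln 2 + 1 < \<delta>/2 * ln (real L)"
      using \<delta> by (simp add: field_simps)
  qed (simp add: L_def)
  define \<rho> where "\<rho> = 1 / (4 * real L * real Q)"
  have \<rho>: "0 < \<rho>" using L(1) Q(1) by (simp add: \<rho>_def)
  \<comment> \<open>Averages of k suitable samples have total squared error at most m n / k over the
    m n means, so at most 4 m n / (k \<rho>^2) means are missed by \<rho>/2 or more. This k makes Q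
    times that number at most \<delta> n / 2.\<close>
  define k where "k = nat \<lceil>8 * real Q * real m / (\<rho>\<^sup>2 * \<delta>)\<rceil> + 1"
  have k: "1 \<le> k" "8 * real Q * real m / (\<rho>\<^sup>2 * \<delta>) \<le> real k"
    unfolding k_def by linarith+
  obtain \<U> where \<U>: "finite_open_cover X \<U>"
    "\<And>U x y f. U \<in> \<U> \<Longrightarrow> x \<in> U \<Longrightarrow> y \<in> U \<Longrightarrow> f \<in> F \<Longrightarrow> \<bar>f x - f y\<bar> \<le> \<rho>/2"
    using oscillation_cover[OF X(1) F(1,2), of "\<rho>/2"] \<rho> by auto
  define N where "N n = min_subcover_card X (iterated_cover X T \<U> n)" for n
  \<comment> \<open>For large n this gives N n ^ k < exp n: the k-tuples of members of a minimal
    subcover are few enough for the choice of L.\<close>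
  have "cover_entropy X T \<U> < 1 / real k"
    by (rule le_less_trans[OF zero[OF \<U>(1)]]) (use k(1) in simp)
  then have "\<forall>\<^sub>F n in sequentially. ln (real (N n)) / real n < 1 / real k"
    unfolding N_def by (rule order_tendstoD(2)[OF cover_entropy_tendsto[OF \<U>(1) T]])
  then show ?thesis
    using eventually_ge_at_top[of 1]
  proof eventually_elim
    case (elim n)
    then have n: "1 \<le> n" and lnN: "real k * ln (real (N n)) < real n"
      using k(1) by (auto simp: field_simps)
    define K where "K = F \<times> {..<n}"
    define D where "D = K \<times> {..<Q}"
    have fin: "finite K" "finite D" using F(1) by (auto simp: K_def D_def)
    have cardK: "card K = m * n" and cardD: "card D = m * n * Q"
      by (simp_all add: K_def D_def m_def card_cartesian_product)
    define \<phi> where "\<phi> = (\<lambda>(f, j) x. f ((T ^^ j) x) :: real)"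
    have \<phi>cont: "continuous_map X euclideanreal (\<phi> \<kappa>)" if "\<kappa> \<in> K" for \<kappa>
      using that F(2) continuous_map_compose[OF continuous_map_funpow[OF T]]
      by (auto simp: K_def \<phi>_def o_def)
    have \<phi>range: "\<phi> \<kappa> x \<in> {0..1}" if "\<kappa> \<in> K" "x \<in> topspace X" for \<kappa> x
      using that F(3) funpow_in_topspace[OF T] by (auto simp: K_def \<phi>_def)
    define v where "v \<kappa> \<mu> = (\<integral>x. \<phi> \<kappa> x \<partial>\<mu>)" for \<kappa> and \<mu> :: "'a measure"
    have v01: "v \<kappa> \<mu> \<in> {0..1}" if "\<kappa> \<in> K" "\<mu> \<in> borel_probs X" for \<kappa> \<mu>
    proof -
      interpret prob_space \<mu> using that(2) by (rule borel_probsD)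
      have int: "integrable \<mu> (\<phi> \<kappa>)" by (rule continuous_map_integrable[OF X(1) \<phi>cont[OF that(1)] that(2)])
      have r: "\<phi> \<kappa> x \<in> {0..1}" if "x \<in> space \<mu>" for x
        using \<phi>range[OF \<open>\<kappa> \<in> K\<close>] that borel_probsD(3)[OF \<open>\<mu> \<in> borel_probs X\<close>] by simp
      have "(\<integral>y. \<phi> \<kappa> y \<partial>\<mu>) \<le> (\<integral>y. 1 \<partial>\<mu>)" by (rule integral_mono) (use int r in auto)
      moreover have "0 \<le> (\<integral>y. \<phi> \<kappa> y \<partial>\<mu>)" by (rule integral_nonneg_AE) (use r in auto)
      ultimately show ?thesis by (simp add: v_def prob_space)
    qed
    obtain \<BB> where \<BB>: "\<BB> \<subseteq> iterated_cover X T \<U> n" "\<Union>\<BB> = topspace X" "card \<BB> = N n" "finite \<BB>"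
      unfolding N_def by (rule min_subcover_card_obtain[OF finite_open_cover_iterated[OF \<U>(1) T]])
    have oscB: "\<bar>\<phi> \<kappa> x - \<phi> \<kappa> y\<bar> \<le> \<rho>/2" if B: "B \<in> \<BB>" "x \<in> B" "y \<in> B" and \<kappa>: "\<kappa> \<in> K" for B x y \<kappa>
    proof -
      obtain a where a: "\<forall>i<n. a i \<in> \<U>" "B = {y \<in> topspace X. \<forall>i<n. (T ^^ i) y \<in> a i}"
        using \<BB>(1) B(1) in_iterated_cover_iff[of B X T \<U> n] by blast
      obtain f j where "\<kappa> = (f, j)" "f \<in> F" "j < n" using \<kappa> by (auto simp: K_def)
      then show ?thesis using a B \<U>(2)[of "a j" "(T ^^ j) x" "(T ^^ j) y" f] by (simp add: \<phi>_def)
    qed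
    define pt where "pt B = (SOME x. x \<in> B)" for B :: "'a set"
    \<comment> \<open>Samples are replaced by representatives of the members containing them. Then
      at most N n ^ k averages occur, at the cost of an error \<rho>/2.\<close>
    define cen where "cen b = (\<lambda>\<kappa>. (\<Sum>r<k. \<phi> \<kappa> (pt (b r))) / real k)" for b
    define Cen where "Cen = cen ` ({..<k} \<rightarrow>\<^sub>E \<BB>)"
    have finCen: "finite Cen" using \<BB>(4) by (auto simp: Cen_def intro!: finite_PiE)
    have "card Cen \<le> card ({..<k} \<rightarrow>\<^sub>E \<BB>)"
      unfolding Cen_def using \<BB>(4) by (intro card_image_le finite_PiE) auto
    then have cardCen: "card Cen \<le> N n ^ k" by (simp add: card_PiE \<BB>(3))
    \<comment> \<open>The centre of slot i in the interval from l / Q to (l + 1) / Q. Different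
      slots of one interval have centres at least 4 \<rho> apart, so the tolerance 2 \<rho> of
      \<open>Mt\<close> admits at most one slot.\<close>
    define \<xi> where "\<xi> l i = (real l + (2 * real i + 1) / (2 * real L)) / real Q" for l i :: nat
    define Mt where "Mt c x i \<longleftrightarrow> \<bar>c (fst x) - \<xi> (snd x) i\<bar> < 2 * \<rho>"
      for c :: "('a \<Rightarrow> real) \<times> nat \<Rightarrow> real" and x :: "(('a \<Rightarrow> real) \<times> nat) \<times> nat" and i
    \<comment> \<open>Half of the budget \<delta> n goes to cuts matched by a centre, half to means
      missed by the samples. Matches number strictly less than h, which absorbs the rounding
      up.\<close>
    define h where "h = nat \<lceil>\<delta> * real n / 2\<rceil>"
    have h: "\<delta> * real n / 2 \<le> real h" "real h < \<delta> * real n / 2 + 1"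
    proof -
      have "0 \<le> \<delta> * real n / 2" using \<delta> by simp
      then show "\<delta> * real n / 2 \<le> real h" "real h < \<delta> * real n / 2 + 1"
        unfolding h_def by linarith+
    qed
    have "\<exists>g. (\<forall>x\<in>D. g x < L) \<and> (\<forall>c\<in>Cen. card {x\<in>D. Mt c x (g x)} < h)"
    proof (rule avoid_matches[OF fin(2) finCen])
      show "0 < L" using L(1) by simp
      fix c x i i' assume "Mt c x i" "Mt c x i'"
      then have "\<bar>\<xi> (snd x) i - \<xi> (snd x) i'\<bar> < 4 * \<rho>" unfolding Mt_def by linarith
      also have "\<xi> (snd x) i - \<xi> (snd x) i' = 4 * \<rho> * (real i - real i')"
        using L(1) Q(1) by (simp add: \<xi>_def \<rho>_def field_simps)
      finally have "\<bar>real i - real i'\<bar> < 1" using \<rho> by (simp add: abs_mult)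
      then show "i = i'" by linarith
    next
      have "real (card Cen * 2 ^ card D) \<le> real (N n) ^ k * 2 ^ card D"
      proof -
        have "real (card Cen) \<le> real (N n) ^ k"
          using cardCen by (metis of_nat_le_iff of_nat_power)
        then show ?thesis by (simp add: mult_right_mono)
      qed
      also have "\<dots> \<le> exp (ln (real (N n))) ^ k * exp (ln 2) ^ card D"
        by (intro mult_mono power_mono) (cases "N n", auto)
      also have "\<dots> = exp (real k * ln (real (N n)) + real (card D) * ln 2)"
        by (simp add: exp_add exp_of_nat_mult)
      also have "\<dots> < exp (real h * ln (real L))"
      proof (subst exp_less_cancel_iff)
        have "real k * ln (real (N n)) + real (card D) * ln 2 < real n * (real m * real Q * ln 2 + 1)"
          using lnN by (simp add: cardD algebra_simps)
        also have "\<dots> \<le> real n * (\<delta>/2 * ln (real L))"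
          using L(2) by (intro mult_left_mono) auto
        also have "\<dots> = \<delta> * real n / 2 * ln (real L)" by simp
        also have "\<dots> \<le> real h * ln (real L)"
          using h(1) L(1) by (intro mult_right_mono) auto
        finally show "real k * ln (real (N n)) + real (card D) * ln 2 < real h * ln (real L)" .
      qed
      also have "\<dots> = real (L ^ h)" using L(1) by (simp add: exp_of_nat_mult)
      finally show "card Cen * 2 ^ card D < L ^ h" by linarith
    qed
    then obtain g where g: "\<And>x. x \<in> D \<Longrightarrow> g x < L" "\<And>c. c \<in> Cen \<Longrightarrow> card {x\<in>D. Mt c x (g x)} < h"
      by blast
    define \<theta> where "\<theta> x \<mu> = max 0 (min 1 ((v (fst x) \<mu> - \<xi> (snd x) (g x) + \<rho>) / (2 * \<rho>)))" for x \<mu>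
    have near: "\<bar>v (fst x) \<mu> - \<xi> (snd x) (g x)\<bar> < \<rho>" if "0 < \<theta> x \<mu>" "\<theta> x \<mu> < 1" for x \<mu>
      using that \<rho> by (auto simp: \<theta>_def max_def min_def field_simps abs_less_iff split: if_splits)
    have few: "card {x\<in>D. 0 < \<theta> x \<mu> \<and> \<theta> x \<mu> < 1} \<le> nat \<lfloor>\<delta> * real n\<rfloor>" if \<mu>: "\<mu> \<in> topspace ?Y" for \<mu>
    proof -
      have \<mu>b: "\<mu> \<in> borel_probs X" using \<mu> by simp
      have sp: "space \<mu> = topspace X" by (rule borel_probsD(3)[OF \<mu>b])
      have "\<exists>x. (\<forall>r. x r \<in> space \<mu>) \<and>
        (\<Sum>\<kappa>\<in>K. (\<Sum>r<k. \<phi> \<kappa> (x r) - (\<integral>y. \<phi> \<kappa> y \<partial>\<mu>))\<^sup>2) \<le> real k * real (card K)"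
      proof (rule empirical_approximation[OF borel_probsD(1)[OF \<mu>b] fin(1)])
        show "\<phi> \<kappa> \<in> borel_measurable \<mu>" if "\<kappa> \<in> K" for \<kappa>
          using continuous_map_measurable_real[OF \<phi>cont[OF that]] borel_probs_measurable_eq[OF \<mu>b] by blast
      qed (use \<phi>range sp in auto)
      then obtain x where x: "\<And>r. x r \<in> topspace X"
        "(\<Sum>\<kappa>\<in>K. (\<Sum>r<k. \<phi> \<kappa> (x r) - v \<kappa> \<mu>)\<^sup>2) \<le> real k * real (card K)"
        using sp by (auto simp: v_def)
      have "\<forall>r. \<exists>B. B \<in> \<BB> \<and> x r \<in> B" using x(1) \<BB>(2) by blast
      then obtain b where b: "\<And>r. b r \<in> \<BB>" "\<And>r. x r \<in> b r" by metis
      define c where "c = cen (restrict b {..<k})"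
      have cC: "c \<in> Cen" unfolding c_def Cen_def using b(1) by (intro imageI) auto
      define a where "a \<kappa> = (\<Sum>r<k. \<phi> \<kappa> (x r)) / real k" for \<kappa>
      have ca: "\<bar>c \<kappa> - a \<kappa>\<bar> \<le> \<rho>/2" if \<kappa>: "\<kappa> \<in> K" for \<kappa>
      proof -
        have "c \<kappa> - a \<kappa> = (\<Sum>r<k. \<phi> \<kappa> (pt (b r)) - \<phi> \<kappa> (x r)) / real k"
          by (simp add: c_def cen_def a_def sum_subtractf diff_divide_distrib)
        moreover have "\<bar>\<Sum>r<k. \<phi> \<kappa> (pt (b r)) - \<phi> \<kappa> (x r)\<bar> \<le> (\<Sum>r<k. \<rho>/2)"
        proof (rule order_trans[OF sum_abs sum_mono])
          fix r
          have "pt (b r) \<in> b r" unfolding pt_def using b(2)[of r] by (rule someI)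
          then show "\<bar>\<phi> \<kappa> (pt (b r)) - \<phi> \<kappa> (x r)\<bar> \<le> \<rho>/2" by (rule oscB[OF b(1) _ b(2) \<kappa>])
        qed
        ultimately have "\<bar>c \<kappa> - a \<kappa>\<bar> \<le> (real k * (\<rho>/2)) / real k"
          by (simp only: abs_divide abs_of_nat) (rule divide_right_mono, simp_all)
        then show ?thesis using k(1) by simp
      qed
      define Kb where "Kb = {\<kappa>\<in>K. \<rho>/2 \<le> \<bar>a \<kappa> - v \<kappa> \<mu>\<bar>}"
      have finKb: "finite Kb" using fin(1) by (simp add: Kb_def)
      have a_eq: "a \<kappa> - v \<kappa> \<mu> = (\<Sum>r<k. \<phi> \<kappa> (x r) - v \<kappa> \<mu>) / real k" for \<kappa>
        using k(1) by (simp add: a_def sum_subtractf diff_divide_distrib)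
      have "real (card Kb) * (\<rho>/2)\<^sup>2 = (\<Sum>\<kappa>\<in>Kb. (\<rho>/2)\<^sup>2)" by simp
      also have "\<dots> \<le> (\<Sum>\<kappa>\<in>Kb. (a \<kappa> - v \<kappa> \<mu>)\<^sup>2)"
        using \<rho> by (intro sum_mono) (auto simp: Kb_def intro!: abs_le_square_iff[THEN iffD1])
      also have "\<dots> \<le> (\<Sum>\<kappa>\<in>K. (a \<kappa> - v \<kappa> \<mu>)\<^sup>2)"
        using fin(1) by (intro sum_mono2) (auto simp: Kb_def)
      also have "\<dots> = (\<Sum>\<kappa>\<in>K. (\<Sum>r<k. \<phi> \<kappa> (x r) - v \<kappa> \<mu>)\<^sup>2) / (real k)\<^sup>2"
        unfolding a_eq power_divide by (rule sum_divide_distrib[symmetric])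
      also have "\<dots> \<le> real k * real (card K) / (real k)\<^sup>2"
        by (intro divide_right_mono x(2)) simp
      also have "\<dots> = real m * real n / real k" using k(1) by (simp add: cardK power2_eq_square)
      finally have Kb1: "real (card Kb) * \<rho>\<^sup>2 \<le> 4 * (real m * real n / real k)"
        by (simp add: power_divide algebra_simps)
      have Kb: "real Q * real (card Kb) \<le> \<delta> * real n / 2"
      proof -
        have "8 * real Q * real m \<le> real k * (\<rho>\<^sup>2 * \<delta>)"
          using k(2) \<rho> \<delta> by (simp add: pos_divide_le_eq)
        then have "real Q * (4 * (real m * real n / real k)) \<le> \<rho>\<^sup>2 * (\<delta> * real n / 2)"
          using k(1) mult_right_mono[of "8 * real Q * real m" "real k * (\<rho>\<^sup>2 * \<delta>)" "real n"]
          by (simp add: field_simps)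
        moreover have "real Q * (real (card Kb) * \<rho>\<^sup>2) \<le> real Q * (4 * (real m * real n / real k))"
          by (intro mult_left_mono Kb1) simp
        moreover have "\<rho>\<^sup>2 * (real Q * real (card Kb)) = real Q * (real (card Kb) * \<rho>\<^sup>2)" by simp
        ultimately have "\<rho>\<^sup>2 * (real Q * real (card Kb)) \<le> \<rho>\<^sup>2 * (\<delta> * real n / 2)" by linarith
        then show ?thesis using \<rho> by simp
      qed
      \<comment> \<open>A fractional cut is within \<rho> of the mean. Unless the samples miss this
        mean, sampling and representatives add at most \<rho>/2 each, so the centre is within 2
        \<rho> of the cut.\<close>
      have "{x\<in>D. 0 < \<theta> x \<mu> \<and> \<theta> x \<mu> < 1} \<subseteq> {x\<in>D. Mt c x (g x)} \<union> Kb \<times> {..<Q}"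
      proof
        fix z assume z: "z \<in> {x\<in>D. 0 < \<theta> x \<mu> \<and> \<theta> x \<mu> < 1}"
        then have zK: "fst z \<in> K" "snd z < Q" by (auto simp: D_def)
        show "z \<in> {x\<in>D. Mt c x (g x)} \<union> Kb \<times> {..<Q}"
        proof (cases "fst z \<in> Kb")
          case True
          then show ?thesis using zK by (auto simp: mem_Times_iff)
        next
          case False
          then have "\<bar>a (fst z) - v (fst z) \<mu>\<bar> < \<rho>/2" using zK by (auto simp: Kb_def)
          moreover have "\<bar>v (fst z) \<mu> - \<xi> (snd z) (g z)\<bar> < \<rho>" using near[of z \<mu>] z by simp
          ultimately have "Mt c z (g z)" using ca[OF zK(1)] unfolding Mt_def by linarith
          then show ?thesis using z by simp
        qed
      qed
      then have "card {x\<in>D. 0 < \<theta> x \<mu> \<and> \<theta> x \<mu> < 1} \<le> card ({x\<in>D. Mt c x (g x)} \<union> Kb \<times> {..<Q})"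
        by (rule card_mono[rotated]) (use fin finKb in auto)
      also have "\<dots> \<le> card {x\<in>D. Mt c x (g x)} + card Kb * Q"
        using card_Un_le[of "{x\<in>D. Mt c x (g x)}" "Kb \<times> {..<Q}"] by (simp add: card_cartesian_product)
      finally have "real (card {x\<in>D. 0 < \<theta> x \<mu> \<and> \<theta> x \<mu> < 1})
          \<le> real (card {x\<in>D. Mt c x (g x)}) + real Q * real (card Kb)"
        by (simp add: mult.commute flip: of_nat_mult of_nat_add)
      also have "\<dots> \<le> \<delta> * real n"
        using g(2)[OF cC] h(2) Kb by linarith
      finally show ?thesis by linarith
    qed
    have \<theta>cont: "continuous_map ?Y euclideanreal (\<theta> x)" if "x \<in> D" for x
    proof -
      have "continuous_map ?Y euclideanreal (v (fst x))"
        unfolding v_def using that by (intro continuous_map_weak_star_integral \<phi>cont) (auto simp: D_def)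
      then have "continuous_map ?Y euclideanreal (\<lambda>\<mu>. v (fst x) \<mu> - \<xi> (snd x) (g x) + \<rho>)"
        by (intro continuous_map_add continuous_map_diff) simp_all
      then have "continuous_map ?Y euclideanreal (\<lambda>\<mu>. (v (fst x) \<mu> - \<xi> (snd x) (g x) + \<rho>) / (2 * \<rho>))"
        by (rule continuous_map_real_divide) (use \<rho> in simp_all)
      then show ?thesis
        unfolding \<theta>_def by (intro continuous_map_real_max continuous_map_real_min) simp_all
    qed
    have "\<exists>\<B>. finite_open_cover ?Y \<B> \<and> (\<forall>y\<in>topspace ?Y. multiplicity_at \<B> y \<le> nat \<lfloor>\<delta> * real n\<rfloor> + 1) \<and> {} \<notin> \<B> \<and>
      (\<forall>B\<in>\<B>. \<exists>P. \<forall>y\<in>B. (\<forall>x\<in>D \<inter> P. 0 < \<theta> x y) \<and> (\<forall>x\<in>D - P. \<theta> x y < 1))"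
    proof (rule cover_from_cuts[OF fin(2) \<theta>cont _ few])
      show "\<theta> x y \<in> {0..1}" for x y by (simp add: \<theta>_def)
    qed
    then obtain \<B> where \<B>': "finite_open_cover ?Y \<B> \<and>
      (\<forall>y\<in>topspace ?Y. multiplicity_at \<B> y \<le> nat \<lfloor>\<delta> * real n\<rfloor> + 1) \<and> {} \<notin> \<B> \<and>
      (\<forall>B\<in>\<B>. \<exists>P. \<forall>y\<in>B. (\<forall>x\<in>D \<inter> P. 0 < \<theta> x y) \<and> (\<forall>x\<in>D - P. \<theta> x y < 1))"
      by (elim exE) (rule that)
    then have \<B>: "finite_open_cover ?Y \<B>"
      "\<And>y. y \<in> topspace ?Y \<Longrightarrow> multiplicity_at \<B> y \<le> nat \<lfloor>\<delta> * real n\<rfloor> + 1" "{} \<notin> \<B>"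
      by (simp_all only: simp_thms)
    have cuts: "\<exists>P. \<forall>y\<in>B. (\<forall>x\<in>D \<inter> P. 0 < \<theta> x y) \<and> (\<forall>x\<in>D - P. \<theta> x y < 1)" if "B \<in> \<B>" for B
      using \<B>' that by (elim conjE) (rule bspec)
    have small: "v \<kappa> \<mu> < v \<kappa> \<mu>0 + \<epsilon>"
      if B: "B \<in> \<B>" "\<mu> \<in> B" "\<mu>0 \<in> B" and \<kappa>: "\<kappa> \<in> K" for B \<mu> \<mu>0 \<kappa>
    proof (rule ccontr)
      assume "\<not> v \<kappa> \<mu> < v \<kappa> \<mu>0 + \<epsilon>"
      then have gap: "v \<kappa> \<mu>0 + 2 / real Q \<le> v \<kappa> \<mu>" using Q(2) by linarith
      have "\<mu> \<in> borel_probs X" "\<mu>0 \<in> borel_probs X"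
        using B \<B>(1) unfolding finite_open_cover_def topspace_prob_weak_star[symmetric] by blast+
      then have v0: "0 \<le> v \<kappa> \<mu>0" "v \<kappa> \<mu> \<le> 1" using v01[OF \<kappa>] by auto
      \<comment> \<open>The first interval that starts at or above the smaller mean. Since the gap
        is 2 / Q, it ends at or below the larger one; its cut then has \<theta> equal to 0 at one
        measure and 1 at the other, which no member admits.\<close>
      define l where "l = nat \<lceil>real Q * v \<kappa> \<mu>0\<rceil>"
      have "0 \<le> real Q * v \<kappa> \<mu>0" using v0 by simp
      then have l: "real Q * v \<kappa> \<mu>0 \<le> real l" "real l < real Q * v \<kappa> \<mu>0 + 1"
        unfolding l_def by linarith+
      have "real Q * v \<kappa> \<mu>0 + 2 \<le> real Q * v \<kappa> \<mu>"
        using mult_left_mono[OF gap, of "real Q"] Q(1) by (simp add: algebra_simps)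
      then have l2: "real l + 1 \<le> real Q * v \<kappa> \<mu>" using l by linarith
      moreover have "real Q * v \<kappa> \<mu> \<le> real Q" using v0(2) Q(1) by (simp add: mult_left_le)
      ultimately have "l < Q" by linarith
      then have xD: "(\<kappa>, l) \<in> D" using \<kappa> by (simp add: D_def)
      define i where "i = g (\<kappa>, l)"
      have i: "i < L" using g(1)[OF xD] by (simp add: i_def)
      have \<xi>_eq: "\<xi> l i = real l / real Q + 2 * \<rho> * (2 * real i + 1)"
        using L(1) Q(1) by (simp add: \<xi>_def \<rho>_def field_simps)
      have "real l / real Q + 2 * \<rho> \<le> \<xi> l i" unfolding \<xi>_eq using \<rho> by (simp add: algebra_simps)
      moreover have "v \<kappa> \<mu>0 \<le> real l / real Q" using l(1) Q(1) by (simp add: field_simps)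
      ultimately have lo: "v \<kappa> \<mu>0 - \<xi> l i + \<rho> \<le> 0" using \<rho> by linarith
      have "2 * \<rho> * (2 * real i + 1) \<le> 2 * \<rho> * (2 * real L - 1)"
        using i \<rho> by (intro mult_left_mono) auto
      also have "\<dots> = 1 / real Q - 2 * \<rho>" using L(1) Q(1) by (simp add: \<rho>_def field_simps)
      finally have "\<xi> l i \<le> (real l + 1) / real Q - 2 * \<rho>" unfolding \<xi>_eq by (simp add: add_divide_distrib)
      moreover have "(real l + 1) / real Q \<le> v \<kappa> \<mu>" using l2 Q(1) by (simp add: field_simps)
      ultimately have hi: "2 * \<rho> \<le> v \<kappa> \<mu> - \<xi> l i + \<rho>" using \<rho> by linarith
      have "(v \<kappa> \<mu>0 - \<xi> l i + \<rho>) / (2 * \<rho>) \<le> 0" using lo \<rho> by (simp add: divide_le_0_iff)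
      then have t0: "\<theta> (\<kappa>, l) \<mu>0 = 0" by (simp add: \<theta>_def i_def)
      have "1 \<le> (v \<kappa> \<mu> - \<xi> l i + \<rho>) / (2 * \<rho>)" using hi \<rho> by (subst pos_le_divide_eq) auto
      then have t1: "\<theta> (\<kappa>, l) \<mu> = 1" by (simp add: \<theta>_def i_def)
      obtain P where P: "\<forall>y\<in>B. (\<forall>x\<in>D \<inter> P. 0 < \<theta> x y) \<and> (\<forall>x\<in>D - P. \<theta> x y < 1)"
        using cuts[OF B(1)] by (elim exE) (rule that)
      show False
      proof (cases "(\<kappa>, l) \<in> P")
        case True
        then have "0 < \<theta> (\<kappa>, l) \<mu>0" using P[THEN bspec, OF B(3)] xD by simp
        then show ?thesis using t0 by simp
      next
        case False
        then have "\<theta> (\<kappa>, l) \<mu> < 1" using P[THEN bspec, OF B(2)] xD by simp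
        then show ?thesis using t1 by simp
      qed
    qed
    have "finer_cover \<B> (iterated_cover ?Y ?S \<A> n)"
      unfolding finer_cover_def
    proof
      fix B assume B: "B \<in> \<B>"
      have Bsub: "B \<subseteq> borel_probs X"
        using B \<B>(1) unfolding finite_open_cover_def topspace_prob_weak_star[symmetric] by blast
      obtain \<mu>0 where \<mu>0: "\<mu>0 \<in> B" using B \<B>(3) by (metis ex_in_conv)
      have iter: "(?S ^^ j) \<mu> \<in> borel_probs X" if "\<mu> \<in> B" for j \<mu>
        using funpow_in_topspace[OF continuous_map_push_forward[OF T], of \<mu> j] Bsub that by auto
      have "\<forall>j. \<exists>A\<in>\<A>. \<forall>\<nu>\<in>borel_probs X.
        (\<forall>f\<in>F. \<bar>(\<integral>x. f x \<partial>\<nu>) - (\<integral>x. f x \<partial>((?S ^^ j) \<mu>0))\<bar> < \<epsilon>) \<longrightarrow> \<nu> \<in> A"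
        using leb[OF iter[OF \<mu>0]] by blast
      then obtain A where A: "\<And>j. A j \<in> \<A>" "\<And>j \<nu>. \<nu> \<in> borel_probs X \<Longrightarrow>
        (\<forall>f\<in>F. \<bar>(\<integral>x. f x \<partial>\<nu>) - (\<integral>x. f x \<partial>((?S ^^ j) \<mu>0))\<bar> < \<epsilon>) \<Longrightarrow> \<nu> \<in> A j"
        by metis
      have "(?S ^^ j) \<mu> \<in> A j" if \<mu>: "\<mu> \<in> B" and j: "j < n" for \<mu> j
      proof (rule A(2)[OF iter[OF \<mu>]], rule ballI)
        fix f assume f: "f \<in> F"
        then have \<kappa>: "(f, j) \<in> K" using j by (simp add: K_def)
        have int: "(\<integral>x. f x \<partial>((?S ^^ j) \<nu>)) = v (f, j) \<nu>" if "\<nu> \<in> B" for \<nu>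
          using integral_funpow_push_forward[OF T _ F(2)[OF f], of \<nu> j] Bsub that by (auto simp: v_def \<phi>_def)
        show "\<bar>(\<integral>x. f x \<partial>((?S ^^ j) \<mu>)) - (\<integral>x. f x \<partial>((?S ^^ j) \<mu>0))\<bar> < \<epsilon>"
          using small[OF B \<mu> \<mu>0 \<kappa>] small[OF B \<mu>0 \<mu> \<kappa>] unfolding int[OF \<mu>] int[OF \<mu>0] by linarith
      qed
      then have "B \<subseteq> {\<mu> \<in> topspace ?Y. \<forall>j<n. (?S ^^ j) \<mu> \<in> A j}"
        using Bsub unfolding topspace_prob_weak_star by (intro subsetI CollectI conjI allI impI) (rule subsetD)
      moreover have "{\<mu> \<in> topspace ?Y. \<forall>j<n. (?S ^^ j) \<mu> \<in> A j} \<in> iterated_cover ?Y ?S \<A> n"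
        unfolding in_iterated_cover_iff by (rule exI[of _ A]) (simp add: A(1))
      ultimately show "\<exists>A\<in>iterated_cover ?Y ?S \<A> n. B \<subseteq> A" by (rule bexI)
    qed
    then have "cover_dim ?Y (iterated_cover ?Y ?S \<A> n) \<le> int (nat \<lfloor>\<delta> * real n\<rfloor>)"
    proof (rule cover_dim_le[OF \<B>(1)])
      show "int (multiplicity_at \<B> y) \<le> int (nat \<lfloor>\<delta> * real n\<rfloor>) + 1" if "y \<in> topspace ?Y" for y
        using \<B>(2)[OF that] by linarith
    qed linarith
    moreover have "0 \<le> \<delta> * real n" using \<delta> by simp
    ultimately show ?case by linarith
  qed
qed

theorem mean_dim_nonpos_if_zero_entropy:
  assumes X: "compact_space X" "metrizable_space X" and T: "continuous_map X X T"
    and zero: "\<not> top_entropy X T > 0"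
  shows "mean_dim (prob_weak_star X) (push_forward X T) \<le> 0"
  unfolding mean_dim_def
proof (rule SUP_least)
  let ?Y = "prob_weak_star X" and ?S = "push_forward X T"
  fix \<A> assume "\<A> \<in> {\<A>. finite_open_cover ?Y \<A>}"
  then have \<A>: "finite_open_cover ?Y \<A>" by simp
  have zero': "cover_entropy X T \<U> \<le> 0" if "finite_open_cover X \<U>" for \<U>
  proof -
    have "ereal (cover_entropy X T \<U>) \<le> top_entropy X T"
      unfolding top_entropy_def by (rule SUP_upper) (use that in simp)
    also have "\<dots> \<le> 0" using zero by simp
    finally show ?thesis by simp
  qed
  let ?D = "\<lambda>n. real_of_int (cover_dim ?Y (iterated_cover ?Y ?S \<A> n))"
  \<comment> \<open>The bound -1 covers the empty space as well, and divided by n it still tends to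
    0.\<close>
  have ge: "-1 \<le> ?D n" for n
    using cover_dim_ge[OF finite_open_cover_iterated[OF \<A> continuous_map_push_forward[OF T]], of n] by linarith
  have "(\<lambda>n. ?D n / real n) \<longlonglongrightarrow> 0"
  proof (rule order_tendstoI)
    fix y :: real assume "y < 0"
    have "(\<lambda>n. -1 / real n) \<longlonglongrightarrow> 0" by (rule lim_const_over_n)
    from order_tendstoD(1)[OF this \<open>y < 0\<close>]
    show "\<forall>\<^sub>F n in sequentially. y < ?D n / real n"
    proof (rule eventually_mono)
      fix n assume "y < -1 / real n"
      also have "\<dots> \<le> ?D n / real n" by (rule divide_right_mono[OF ge]) simp
      finally show "y < ?D n / real n" .
    qed
  next
    fix y :: real assume y: "0 < y"
    then have "\<forall>\<^sub>F n in sequentially. ?D n \<le> y/2 * real n"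
      by (intro iterated_cover_dim_small[OF X T \<A> zero']) auto
    then show "\<forall>\<^sub>F n in sequentially. ?D n / real n < y"
      using eventually_ge_at_top[of 1]
    proof eventually_elim
      case (elim n)
      then have "?D n / real n \<le> y/2" by (simp add: pos_divide_le_eq)
      then show ?case using y by linarith
    qed
  qed
  then show "ereal (lim (\<lambda>n. ?D n / real n)) \<le> 0" by (simp add: limI)
qed

section \<open>Positive entropy\<close>

text \<open>An independence set, in the sense of combinatorial independence, for the pair of sets
  where f is 0 and where f is 1.\<close>

definition independent_times :: "'a topology \<Rightarrow> ('a \<Rightarrow> 'a) \<Rightarrow> ('a \<Rightarrow> real) \<Rightarrow> nat set \<Rightarrow> bool" where
  "independent_times X T f J \<longleftrightarrow>
     (\<forall>\<omega>. \<exists>x\<in>topspace X. \<forall>j\<in>J. f ((T ^^ j) x) = (if \<omega> j then 1 else 0))"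

text \<open>For a cover \<U> of positive entropy, each member U gets a function \<open>f U\<close>
  that vanishes outside U, such that at every point some \<open>f U\<close> equals 1. If no U had
  independent times of density c, each would admit few disambiguations; choosing one for every U
  determines a member of the iterated cover, so minimal subcovers would grow too slowly. As \<U> is
  finite, a single U serves infinitely many n.\<close>

lemma positive_entropy_independence:
  assumes X: "compact_space X" "metrizable_space X" and T: "continuous_map X X T"
    and pos: "top_entropy X T > 0"
  shows "\<exists>f c. continuous_map X euclideanreal f \<and> 0 < c \<and>
    (\<exists>\<^sub>F n in sequentially. \<exists>J\<subseteq>{..<n}. c * real n \<le> real (card J) \<and> independent_times X T f J)"
proof -
  obtain \<U> where \<U>: "finite_open_cover X \<U>" "0 < cover_entropy X T \<U>"
  proof -
    obtain \<U> where "finite_open_cover X \<U>" "0 < ereal (cover_entropy X T \<U>)"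
      using pos unfolding top_entropy_def less_SUP_iff by (elim bexE) simp
    then show ?thesis by (intro that[of \<U>]) simp_all
  qed
  have finU: "finite \<U>" using \<U>(1) by (simp add: finite_open_cover_def)
  obtain w where w: "\<forall>U\<in>\<U>. continuous_map X euclideanreal (w U)"
    "\<forall>U\<in>\<U>. \<forall>y\<in>topspace X. 0 \<le> w U y \<and> (y \<notin> U \<longrightarrow> w U y = 0)"
    "\<forall>y\<in>topspace X. (\<Sum>U\<in>\<U>. w U y) = (1::real)"
    using partition_of_unity_finite_cover[OF X(1) metrizable_imp_completely_regular_space[OF X(2)] \<U>(1)]
    by (elim exE conjE) (rule that)
  \<comment> \<open>One more than the number of members: if all \<open>w U\<close> were below 1 / r,
    their sum would be below 1. So some \<open>f U\<close> equals 1 at each point.\<close>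
  define r where "r = real (card \<U>) + 1"
  have r: "1 \<le> r" by (simp add: r_def)
  define f where "f U x = min 1 (r * w U x)" for U x
  define A where "A U a j = {x \<in> topspace X. f U ((T ^^ j) x) = (if a then 1 else 0)}" for U a and j :: nat
  \<comment> \<open>The families for all U together cost at most exp(r \<eta> n), and r \<eta> is
    half the entropy of \<U>.\<close>
  define \<eta> where "\<eta> = cover_entropy X T \<U> / (2 * r)"
  have \<eta>: "0 < \<eta>" using \<U>(2) r by (simp add: \<eta>_def)
  obtain c where c: "0 < c" and sd: "\<forall>(I::nat set) A (Y::'a set). finite I \<longrightarrow> (\<forall>j\<in>I. A True j \<inter> A False j = {}) \<longrightarrow>
    (\<exists>J\<subseteq>I. c * real (card I) \<le> real (card J) \<and> shattered A Y J) \<or>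
    (\<exists>F. finite F \<and> real (card F) \<le> exp (\<eta> * real (card I))
      \<and> (\<forall>x\<in>Y. \<exists>f\<in>F. \<forall>j\<in>I. x \<notin> A (f j) j))"
    using shattered_or_disambiguation[OF \<eta>] by (elim exE conjE) (rule that)
  define P where "P U n \<longleftrightarrow> (\<exists>J\<subseteq>{..<n}. c * real n \<le> real (card J) \<and> shattered (A U) (topspace X) J)" for U n
  define N where "N n = min_subcover_card X (iterated_cover X T \<U> n)" for n
  have bound: "real (N n) \<le> exp (r * \<eta> * real n)" if noP: "\<forall>U\<in>\<U>. \<not> P U n" for n
  proof -
    have "\<exists>F. finite F \<and> real (card F) \<le> exp (\<eta> * real n) \<and>
      (\<forall>x\<in>topspace X. \<exists>\<phi>\<in>F. \<forall>j<n. x \<notin> A U (\<phi> j) j)" if U: "U \<in> \<U>" for U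
    proof -
      have "(\<exists>J\<subseteq>{..<n}. c * real (card {..<n}) \<le> real (card J) \<and> shattered (A U) (topspace X) J) \<or>
        (\<exists>F. finite F \<and> real (card F) \<le> exp (\<eta> * real (card {..<n}))
          \<and> (\<forall>x\<in>topspace X. \<exists>\<phi>\<in>F. \<forall>j\<in>{..<n}. x \<notin> A U (\<phi> j) j))"
        by (rule sd[rule_format]) (auto simp: A_def)
      moreover have "\<not> (\<exists>J\<subseteq>{..<n}. c * real (card {..<n}) \<le> real (card J) \<and> shattered (A U) (topspace X) J)"
        using noP U by (simp add: P_def)
      ultimately have "\<exists>F. finite F \<and> real (card F) \<le> exp (\<eta> * real (card {..<n}))
          \<and> (\<forall>x\<in>topspace X. \<exists>\<phi>\<in>F. \<forall>j\<in>{..<n}. x \<notin> A U (\<phi> j) j)"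
        by (elim disjE) (erule (1) notE)
      then show ?thesis by (simp only: card_lessThan Ball_def lessThan_iff)
    qed
    then have "\<forall>U\<in>\<U>. \<exists>F. finite F \<and> real (card F) \<le> exp (\<eta> * real n) \<and>
      (\<forall>x\<in>topspace X. \<exists>\<phi>\<in>F. \<forall>j<n. x \<notin> A U (\<phi> j) j)" by blast
    then obtain F where F: "\<forall>U\<in>\<U>. finite (F U) \<and> real (card (F U)) \<le> exp (\<eta> * real n) \<and>
      (\<forall>x\<in>topspace X. \<exists>\<phi>\<in>F U. \<forall>j<n. x \<notin> A U (\<phi> j) j)"
      unfolding bchoice_iff by (elim exE) (rule that)
    \<comment> \<open>For a point x disambiguated by \<Phi>, a value False at U and j means that
      \<open>f U\<close> is not 0 at time j, so the orbit is in U. If all values at j were True, no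
      \<open>f U\<close> would be 1 at that time.\<close>
    define sel where "sel \<Phi> j = (SOME U. U \<in> \<U> \<and> \<not> \<Phi> U j)" for \<Phi> :: "'a set \<Rightarrow> nat \<Rightarrow> bool" and j
    define B where "B \<Phi> = {y \<in> topspace X. \<forall>j<n. (T ^^ j) y \<in> sel \<Phi> j}" for \<Phi>
    define \<BB> where "\<BB> = B ` {\<Phi> \<in> PiE \<U> F. \<forall>j<n. \<exists>U\<in>\<U>. \<not> \<Phi> U j}"
    have sel: "sel \<Phi> j \<in> \<U> \<and> \<not> \<Phi> (sel \<Phi> j) j" if "\<exists>U\<in>\<U>. \<not> \<Phi> U j" for \<Phi> j
      unfolding sel_def by (rule someI_ex) (use that in blast)
    have "\<BB> \<subseteq> iterated_cover X T \<U> n"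
    proof
      fix V assume "V \<in> \<BB>"
      then obtain \<Phi> where \<Phi>: "V = B \<Phi>" "\<forall>j<n. \<exists>U\<in>\<U>. \<not> \<Phi> U j" by (auto simp: \<BB>_def)
      show "V \<in> iterated_cover X T \<U> n"
        unfolding in_iterated_cover_iff \<Phi>(1) B_def
        by (rule exI[of _ "sel \<Phi>"]) (use \<Phi>(2) sel in simp)
    qed
    moreover have "\<Union>\<BB> = topspace X"
    proof
      show "\<Union>\<BB> \<subseteq> topspace X" by (auto simp: \<BB>_def B_def)
      show "topspace X \<subseteq> \<Union>\<BB>"
      proof
        fix x assume x: "x \<in> topspace X"
        then have "\<forall>U\<in>\<U>. \<exists>\<phi>. \<phi> \<in> F U \<and> (\<forall>j<n. x \<notin> A U (\<phi> j) j)" using F by blast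
        then obtain \<Phi>0 where \<Phi>0: "\<forall>U\<in>\<U>. \<Phi>0 U \<in> F U \<and> (\<forall>j<n. x \<notin> A U (\<Phi>0 U j) j)"
          unfolding bchoice_iff by (elim exE) (rule that)
        define \<Phi> where "\<Phi> = restrict \<Phi>0 \<U>"
        have \<Phi>: "\<Phi> \<in> PiE \<U> F" "\<And>U j. U \<in> \<U> \<Longrightarrow> j < n \<Longrightarrow> x \<notin> A U (\<Phi> U j) j"
          using \<Phi>0 by (auto simp: \<Phi>_def)
        have ex: "\<exists>U\<in>\<U>. \<not> \<Phi> U j" if j: "j < n" for j
        proof (rule ccontr)
          assume "\<not> (\<exists>U\<in>\<U>. \<not> \<Phi> U j)"
          then have all: "\<And>U. U \<in> \<U> \<Longrightarrow> x \<notin> A U True j" using \<Phi>(2)[OF _ j] by metis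
          have y: "(T ^^ j) x \<in> topspace X" by (rule funpow_in_topspace[OF T x])
          have "w U ((T ^^ j) x) < 1 / r" if "U \<in> \<U>" for U
          proof -
            have "f U ((T ^^ j) x) \<noteq> 1" using all[OF that] x by (simp add: A_def)
            then have "r * w U ((T ^^ j) x) < 1" by (auto simp: f_def min_def split: if_splits)
            then show ?thesis using r by (simp add: field_simps)
          qed
          then have "(\<Sum>U\<in>\<U>. w U ((T ^^ j) x)) \<le> (\<Sum>U\<in>\<U>. 1 / r)"
            by (intro sum_mono) (simp add: less_imp_le)
          also have "\<dots> < 1" using r by (simp add: r_def field_simps)
          finally show False using w(3) y by simp
        qed
        have "(T ^^ j) x \<in> sel \<Phi> j" if j: "j < n" for j
        proof (rule ccontr)
          assume "(T ^^ j) x \<notin> sel \<Phi> j"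
          moreover have s: "sel \<Phi> j \<in> \<U>" "\<not> \<Phi> (sel \<Phi> j) j" using sel[of \<Phi> j] ex[OF j] by blast+
          ultimately have "w (sel \<Phi> j) ((T ^^ j) x) = 0" using w(2) funpow_in_topspace[OF T x] by blast
          then have "x \<in> A (sel \<Phi> j) False j" using x by (simp add: A_def f_def)
          then show False using \<Phi>(2)[OF s(1) j] s(2) by simp
        qed
        then have "x \<in> B \<Phi>" using x by (simp add: B_def)
        moreover have "B \<Phi> \<in> \<BB>" unfolding \<BB>_def by (rule imageI) (use \<Phi>(1) ex in simp)
        ultimately show "x \<in> \<Union>\<BB>" by (rule UnionI[rotated])
      qed
    qed
    ultimately have "N n \<le> card \<BB>" unfolding N_def by (rule min_subcover_card_le)
    also have "\<dots> \<le> card (PiE \<U> F)"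
    proof -
      have "finite (PiE \<U> F)" using finU F by (intro finite_PiE) auto
      then have "card \<BB> \<le> card {\<Phi> \<in> PiE \<U> F. \<forall>j<n. \<exists>U\<in>\<U>. \<not> \<Phi> U j}"
        unfolding \<BB>_def by (intro card_image_le) simp
      also have "\<dots> \<le> card (PiE \<U> F)" by (rule card_mono) (use \<open>finite (PiE \<U> F)\<close> in auto)
      finally show ?thesis .
    qed
    also have "\<dots> = (\<Prod>U\<in>\<U>. card (F U))" by (rule card_PiE[OF finU])
    finally have "real (N n) \<le> (\<Prod>U\<in>\<U>. real (card (F U)))" by (simp flip: of_nat_prod)
    also have "\<dots> \<le> (\<Prod>U\<in>\<U>. exp (\<eta> * real n))" using F by (intro prod_mono) auto
    also have "\<dots> = exp (real (card \<U>) * (\<eta> * real n))" by (simp add: exp_of_nat_mult)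
    also have "\<dots> \<le> exp (r * \<eta> * real n)" using \<eta> by (simp add: r_def algebra_simps)
    finally show ?thesis .
  qed
  have "\<forall>\<^sub>F n in sequentially. r * \<eta> < ln (real (N n)) / real n"
  proof (rule order_tendstoD(1))
    show "(\<lambda>n. ln (real (N n)) / real n) \<longlonglongrightarrow> cover_entropy X T \<U>"
      unfolding N_def by (rule cover_entropy_tendsto[OF \<U>(1) T])
    show "r * \<eta> < cover_entropy X T \<U>" using \<U>(2) r by (simp add: \<eta>_def)
  qed
  then have ev: "\<forall>\<^sub>F n in sequentially. \<exists>U\<in>\<U>. P U n"
    using eventually_ge_at_top[of 1]
  proof eventually_elim
    case (elim n)
    show ?case
    proof (rule ccontr)
      assume "\<not> (\<exists>U\<in>\<U>. P U n)"
      then have b: "real (N n) \<le> exp (r * \<eta> * real n)" using bound by blast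
      have "ln (real (N n)) \<le> r * \<eta> * real n"
      proof (cases "N n = 0")
        case False
        then have "ln (real (N n)) \<le> ln (exp (r * \<eta> * real n))" using b by (intro ln_mono) auto
        then show ?thesis by simp
      qed (use r \<eta> in simp)
      then have "ln (real (N n)) / real n \<le> r * \<eta>" using elim(2) by (simp add: pos_divide_le_eq)
      then show False using elim(1) by simp
    qed
  qed
  \<comment> \<open>Pigeonhole over the finitely many members: U may depend on n in
    \<open>ev\<close>, but one U occurs infinitely often.\<close>
  have "\<exists>U\<in>\<U>. \<exists>\<^sub>F n in sequentially. P U n"
  proof (rule ccontr)
    assume "\<not> (\<exists>U\<in>\<U>. \<exists>\<^sub>F n in sequentially. P U n)"
    then have "\<forall>U\<in>\<U>. \<forall>\<^sub>F n in sequentially. \<not> P U n" by (simp add: not_frequently)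
    then have "\<forall>\<^sub>F n in sequentially. \<forall>U\<in>\<U>. \<not> P U n" by (rule eventually_ball_finite[OF finU])
    with ev have "\<forall>\<^sub>F n::nat in sequentially. False" by eventually_elim blast
    then show False by simp
  qed
  then obtain U where U: "U \<in> \<U>" "\<exists>\<^sub>F n in sequentially. P U n" by (elim bexE) (rule that)
  show ?thesis
  proof (intro exI[of _ "f U"] exI[of _ c] conjI)
    show "continuous_map X euclideanreal (f U)"
      unfolding f_def using w(1) U(1)
      by (intro continuous_map_real_min continuous_map_real_mult) simp_all
    show "0 < c" by (rule c)
    show "\<exists>\<^sub>F n in sequentially. \<exists>J\<subseteq>{..<n}. c * real n \<le> real (card J) \<and> independent_times X T (f U) J"
    proof (rule frequently_elim1[OF U(2)])
      fix n assume "P U n"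
      then obtain J where J: "J \<subseteq> {..<n}" "c * real n \<le> real (card J)" "shattered (A U) (topspace X) J"
        by (auto simp: P_def)
      have "independent_times X T (f U) J"
        unfolding independent_times_def
      proof
        fix \<omega> :: "nat \<Rightarrow> bool"
        obtain x where "x \<in> topspace X" "\<forall>j\<in>J. x \<in> A U (\<omega> j) j"
          using J(3) unfolding shattered_def by meson
        then show "\<exists>x\<in>topspace X. \<forall>j\<in>J. f U ((T ^^ j) x) = (if \<omega> j then 1 else 0)"
          by (intro bexI[of _ x]) (simp_all add: A_def)
      qed
      then show "\<exists>J\<subseteq>{..<n}. c * real n \<le> real (card J) \<and> independent_times X T (f U) J"
        using J by blast
    qed
  qed
qed

section \<open>Patterns in windows and the cubes they span\<close>

text \<open>Where f takes only the values 0 and 1 at the times in K, this is the indicator that a is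
  exactly the set of times with value 1. K belongs to the index because windows differ in the
  positions of their free times.\<close>

definition pattern_fun :: "('a \<Rightarrow> 'a) \<Rightarrow> ('a \<Rightarrow> real) \<Rightarrow> nat set \<times> nat set \<Rightarrow> 'a \<Rightarrow> real" where
  "pattern_fun T f = (\<lambda>(K, a) x. (\<Prod>s\<in>a. f ((T ^^ s) x)) * (\<Prod>s\<in>K - a. 1 - f ((T ^^ s) x)))"

text \<open>A finite stock of patterns common to all windows and all n, so that a single cover can
  serve them all.\<close>

definition patterns :: "nat \<Rightarrow> (nat set \<times> nat set) set" where
  "patterns R = {(K, a). K \<subseteq> {..<R} \<and> a \<subseteq> K}"

lemma finite_patterns: "finite (patterns R)"
  by (rule finite_subset[of _ "Pow {..<R} \<times> Pow {..<R}"]) (auto simp: patterns_def)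

text \<open>The join, over all patterns, of the covers by the two sets "integral positive" and
  "integral below \<beta>"; P collects the patterns for which the first is taken. No member contains
  measures with integral 0 and with integral \<beta> for the same pattern, and these values will
  mark opposite faces of a cube.\<close>

definition pattern_cover :: "'a topology \<Rightarrow> ('a \<Rightarrow> 'a) \<Rightarrow> ('a \<Rightarrow> real) \<Rightarrow> nat \<Rightarrow> real \<Rightarrow> 'a measure set set" where
  "pattern_cover X T f R \<beta> = (\<lambda>P. {\<mu> \<in> borel_probs X.
     (\<forall>p\<in>P. 0 < (\<integral>x. pattern_fun T f p x \<partial>\<mu>)) \<and>
     (\<forall>p\<in>patterns R - P. (\<integral>x. pattern_fun T f p x \<partial>\<mu>) < \<beta>)}) ` Pow (patterns R)"

lemma continuous_pattern_fun:
  assumes "continuous_map X X T" "continuous_map X euclideanreal f" "p \<in> patterns R"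
  shows "continuous_map X euclideanreal (pattern_fun T f p)"
proof -
  obtain K a where p: "p = (K, a)" "K \<subseteq> {..<R}" "a \<subseteq> K" using assms(3) by (auto simp: patterns_def)
  have fin: "finite a" "finite (K - a)" using p by (auto intro: finite_subset)
  have fT: "continuous_map X euclideanreal (\<lambda>x. f ((T ^^ s) x))" for s
    using continuous_map_compose[OF continuous_map_funpow[OF assms(1)] assms(2)] by (simp add: o_def)
  have "continuous_map X euclideanreal (\<lambda>x. \<Prod>s\<in>a. f ((T ^^ s) x))"
    by (intro continuous_map_prod fin fT)
  moreover have "continuous_map X euclideanreal (\<lambda>x. \<Prod>s\<in>K - a. 1 - f ((T ^^ s) x))"
    by (intro continuous_map_prod fin continuous_map_diff fT) simp_all
  ultimately show ?thesis unfolding p(1) pattern_fun_def prod.case by (rule continuous_map_real_mult)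
qed

lemma finite_open_cover_pattern_cover:
  assumes "continuous_map X X T" "continuous_map X euclideanreal f" "0 < \<beta>"
  shows "finite_open_cover (prob_weak_star X) (pattern_cover X T f R \<beta>)"
proof -
  let ?Y = "prob_weak_star X"
  define G where "G p \<mu> = (\<integral>x. pattern_fun T f p x \<partial>\<mu>)" for p and \<mu> :: "'a measure"
  define V where "V P = {\<mu> \<in> borel_probs X. (\<forall>p\<in>P. 0 < G p \<mu>) \<and> (\<forall>p\<in>patterns R - P. G p \<mu> < \<beta>)}" for P
  have Gcont: "continuous_map ?Y euclideanreal (G p)" if "p \<in> patterns R" for p
    unfolding G_def
    by (intro continuous_map_weak_star_integral continuous_pattern_fun[OF assms(1,2) that])
  have "openin ?Y (V P)" if P: "P \<subseteq> patterns R" for P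
  proof -
    have o1: "openin ?Y {\<mu> \<in> topspace ?Y. G p \<mu> \<in> {0<..}}" if "p \<in> P" for p
      by (rule openin_continuous_map_preimage[OF Gcont]) (use P that in auto)
    have o2: "openin ?Y {\<mu> \<in> topspace ?Y. G p \<mu> \<in> {..<\<beta>}}" if "p \<in> patterns R - P" for p
      by (rule openin_continuous_map_preimage[OF Gcont]) (use that in auto)
    have "V P = (topspace ?Y \<inter> (\<Inter>p\<in>P. {\<mu> \<in> topspace ?Y. G p \<mu> \<in> {0<..}})) \<inter>
      (topspace ?Y \<inter> (\<Inter>p\<in>patterns R - P. {\<mu> \<in> topspace ?Y. G p \<mu> \<in> {..<\<beta>}}))"
      by (auto simp: V_def)
    also have "openin ?Y \<dots>"
      using o1 o2 finite_subset[OF P finite_patterns] finite_patterns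
      by (intro openin_Int openin_Int_Inter[OF _ openin_topspace]) auto
    finally show ?thesis .
  qed
  moreover have "\<Union>(V ` Pow (patterns R)) = topspace ?Y"
  proof
    show "\<Union>(V ` Pow (patterns R)) \<subseteq> topspace ?Y" by (auto simp: V_def)
    show "topspace ?Y \<subseteq> \<Union>(V ` Pow (patterns R))"
    proof
      fix \<mu> assume \<mu>: "\<mu> \<in> topspace ?Y"
      have "\<mu> \<in> V {p\<in>patterns R. 0 < G p \<mu>}" using \<mu> assms(3) by (auto simp: V_def)
      moreover have "{p\<in>patterns R. 0 < G p \<mu>} \<in> Pow (patterns R)" by auto
      ultimately show "\<mu> \<in> \<Union>(V ` Pow (patterns R))" by blast
    qed
  qed
  moreover have "pattern_cover X T f R \<beta> = V ` Pow (patterns R)"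
    unfolding pattern_cover_def by (intro image_cong refl) (simp only: V_def G_def)
  ultimately show ?thesis by (simp add: finite_open_cover_def finite_patterns)
qed

text \<open>The probability measures \<open>p b\<close> on the patterns of the windows are independent of each
  other, so the product measure on orbits realises every point of a cube whose dimension is the number
  of pairs of a window and a nonempty pattern.\<close>

lemma pattern_cover_dim_lower:
  assumes T: "continuous_map X X T" and f: "continuous_map X euclideanreal f"
    and ind: "independent_times X T f J" and J: "J \<subseteq> {..<n}"
    and W: "finite W" "\<And>b. b \<in> W \<Longrightarrow> Kb b \<subseteq> {..<R}" "\<And>b. b \<in> W \<Longrightarrow> card (Kb b) = k"
      "\<And>b s. b \<in> W \<Longrightarrow> s \<in> Kb b \<Longrightarrow> b * R + s \<in> J"
    and k: "1 \<le> k"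
  shows "int (card W * (2 ^ k - 1)) \<le> cover_dim (prob_weak_star X)
    (iterated_cover (prob_weak_star X) (push_forward X T) (pattern_cover X T f R (1 / 2 ^ k)) n)"
proof -
  let ?Y = "prob_weak_star X" and ?S = "push_forward X T"
  \<comment> \<open>The 2^k - 1 nonempty patterns of a window can then have any weights between 0
    and \<beta>: their sum stays below 1 and the empty pattern takes the rest.\<close>
  define \<beta> :: real where "\<beta> = 1 / 2 ^ k"
  have \<beta>: "0 < \<beta>" by (simp add: \<beta>_def)
  let ?\<A> = "pattern_cover X T f R \<beta>"
  have foc: "finite_open_cover ?Y ?\<A>" by (rule finite_open_cover_pattern_cover[OF T f \<beta>])
  have finK: "finite (Kb b)" if "b \<in> W" for b using W(2)[OF that] by (rule finite_subset) simp
  define ne where "ne b = Pow (Kb b) - {{}}" for b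
  have fin_ne: "finite (ne b)" and card_ne: "card (ne b) = 2 ^ k - 1" if "b \<in> W" for b
    using finK[OF that] W(3)[OF that] by (simp_all add: ne_def card_Pow)
  define idx where "idx = Sigma W ne"
  define d where "d = card W * (2 ^ k - 1)"
  have "finite idx" using W(1) fin_ne by (simp add: idx_def)
  moreover have "card idx = d" using W(1) fin_ne card_ne by (simp add: idx_def d_def)
  ultimately obtain e where e: "bij_betw e {..<d} idx"
    using ex_bij_betw_nat_finite[of idx] by (auto simp: atLeast0LessThan)
  define \<iota> where "\<iota> = the_inv_into {..<d} e"
  have \<iota>: "\<iota> (e i) = i" if "i < d" for i
    unfolding \<iota>_def using e that by (intro the_inv_into_f_f) (auto simp: bij_betw_def)
  define C where "C = {t :: nat \<Rightarrow> real. \<forall>i. 0 \<le> t i \<and> t i \<le> 1}"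
  define p where "p t b a = (if a = {} then 1 - (\<Sum>a'\<in>ne b. t (\<iota> (b, a')) * \<beta>) else t (\<iota> (b, a)) * \<beta>)"
    for t :: "nat \<Rightarrow> real" and b and a :: "nat set"
  have p_nonneg: "0 \<le> p t b a" if t: "t \<in> C" and b: "b \<in> W" for t b a
  proof (cases "a = {}")
    case True
    have "(\<Sum>a'\<in>ne b. t (\<iota> (b, a')) * \<beta>) \<le> (\<Sum>a'\<in>ne b. 1 * \<beta>)"
      using t \<beta> by (intro sum_mono mult_right_mono) (simp_all add: C_def)
    also have "\<dots> = real (2 ^ k - 1) * \<beta>" by (simp add: card_ne[OF b])
    also have "\<dots> \<le> real (2 ^ k) * \<beta>" using \<beta> by (intro mult_right_mono of_nat_mono) simp_all
    also have "\<dots> = 1" by (simp add: \<beta>_def)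
    finally show ?thesis using True by (simp add: p_def)
  next
    case False
    then show ?thesis using t \<beta> by (simp add: p_def C_def)
  qed
  have p_sum: "(\<Sum>a\<in>Pow (Kb b). p t b a) = 1" if b: "b \<in> W" for t b
  proof -
    have "(\<Sum>a\<in>Pow (Kb b). p t b a) = p t b {} + (\<Sum>a\<in>ne b. p t b a)"
      unfolding ne_def using finK[OF b] by (intro sum.remove) auto
    also have "(\<Sum>a\<in>ne b. p t b a) = (\<Sum>a\<in>ne b. t (\<iota> (b, a)) * \<beta>)"
      by (intro sum.cong) (auto simp: p_def ne_def)
    finally show ?thesis by (simp add: p_def)
  qed
  define \<Omega> where "\<Omega> = (\<Pi>\<^sub>E b\<in>W. Pow (Kb b))"
  have fin\<Omega>: "finite \<Omega>" unfolding \<Omega>_def using W(1) finK by (intro finite_PiE) auto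
  define q where "q t \<omega> = (\<Prod>b\<in>W. p t b (\<omega> b))" for t \<omega>
  have q_nonneg: "0 \<le> q t \<omega>" if "t \<in> C" for t \<omega>
    unfolding q_def using p_nonneg[OF that] by (intro prod_nonneg) auto
  have q_sum: "(\<Sum>\<omega>\<in>\<Omega>. q t \<omega>) = 1" for t
  proof -
    have "(\<Sum>\<omega>\<in>\<Omega>. q t \<omega>) = (\<Prod>b\<in>W. \<Sum>a\<in>Pow (Kb b). p t b a)"
      unfolding \<Omega>_def q_def using W(1) finK by (intro prod_sum_PiE[symmetric]) auto
    then show ?thesis using p_sum by simp
  qed
  have q_marginal: "(\<Sum>\<omega>\<in>\<Omega>. q t \<omega> * (if \<omega> b = a then 1 else 0)) = p t b a"
    if b: "b \<in> W" and a: "a \<subseteq> Kb b" for t b a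
  proof -
    \<comment> \<open>Putting the condition on window b into its own factor keeps the product form,
      so the sum factorises over the windows and all other factors sum to 1.\<close>
    define u where "u b' a' = (if b' = b then (if a' = a then p t b a else 0) else p t b' a')" for b' a'
    have "q t \<omega> * (if \<omega> b = a then 1 else 0) = (\<Prod>b'\<in>W. u b' (\<omega> b'))" for \<omega>
    proof (cases "\<omega> b = a")
      case True
      then show ?thesis unfolding q_def by (auto simp: u_def intro!: prod.cong)
    next
      case False
      then have "(\<Prod>b'\<in>W. u b' (\<omega> b')) = 0"
        using W(1) b by (intro prod_zero) (auto simp: u_def)
      then show ?thesis using False by simp
    qed
    then have "(\<Sum>\<omega>\<in>\<Omega>. q t \<omega> * (if \<omega> b = a then 1 else 0)) = (\<Sum>\<omega>\<in>\<Omega>. \<Prod>b'\<in>W. u b' (\<omega> b'))" by simp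
    also have "\<dots> = (\<Prod>b'\<in>W. \<Sum>a'\<in>Pow (Kb b'). u b' a')"
      unfolding \<Omega>_def using W(1) finK by (intro prod_sum_PiE[symmetric]) auto
    also have "\<dots> = (\<Prod>b'\<in>W. if b' = b then p t b a else 1)"
    proof (rule prod.cong[OF refl])
      fix b' assume b': "b' \<in> W"
      show "(\<Sum>a'\<in>Pow (Kb b'). u b' a') = (if b' = b then p t b a else 1)"
      proof (cases "b' = b")
        case True
        then show ?thesis using a finK[OF b] by (simp add: u_def)
      next
        case False
        then show ?thesis using p_sum[OF b'] by (simp add: u_def)
      qed
    qed
    also have "\<dots> = p t b a" using W(1) b by simp
    finally show ?thesis .
  qed
  have "\<exists>x\<in>topspace X. \<forall>b\<in>W. \<forall>s\<in>Kb b. f ((T ^^ (b * R + s)) x) = (if s \<in> \<omega> b then 1 else 0)" for \<omega>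
  proof -
    \<comment> \<open>Time j is position j mod R of window j div R, so a choice of patterns for all
      windows is a single prescription on J.\<close>
    obtain x where x: "x \<in> topspace X" "\<forall>j\<in>J. f ((T ^^ j) x) = (if j mod R \<in> \<omega> (j div R) then 1 else 0)"
      using ind[unfolded independent_times_def, THEN spec[of _ "\<lambda>j. j mod R \<in> \<omega> (j div R)"]]
      by (elim bexE) (rule that)
    have "f ((T ^^ (b * R + s)) x) = (if s \<in> \<omega> b then 1 else 0)" if b: "b \<in> W" "s \<in> Kb b" for b s
    proof -
      have "s < R" using W(2)[OF b(1)] b(2) by auto
      then have "(b * R + s) mod R = s" "(b * R + s) div R = b" by simp_all
      then show ?thesis using x(2)[THEN bspec, OF W(4)[OF b]] by simp
    qed
    then show ?thesis using x(1) by blast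
  qed
  then have "\<forall>\<omega>. \<exists>x. x \<in> topspace X \<and> (\<forall>b\<in>W. \<forall>s\<in>Kb b. f ((T ^^ (b * R + s)) x) = (if s \<in> \<omega> b then 1 else 0))"
    by (simp only: Bex_def simp_thms)
  then obtain x where x': "\<forall>\<omega>. x \<omega> \<in> topspace X \<and>
    (\<forall>b\<in>W. \<forall>s\<in>Kb b. f ((T ^^ (b * R + s)) (x \<omega>)) = (if s \<in> \<omega> b then 1 else 0))"
    unfolding choice_iff by (elim exE) (rule that)
  then have x: "x \<omega> \<in> topspace X"
    "b \<in> W \<Longrightarrow> s \<in> Kb b \<Longrightarrow> f ((T ^^ (b * R + s)) (x \<omega>)) = (if s \<in> \<omega> b then 1 else 0)" for \<omega> b s
    by simp_all
  define \<Phi> where "\<Phi> t = distr (point_measure \<Omega> (\<lambda>\<omega>. ennreal (q t \<omega>))) (borel_of_top X) x" for t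
  have \<Phi>_prob: "\<Phi> t \<in> borel_probs X" if t: "t \<in> C" for t
    unfolding \<Phi>_def
  proof (rule distr_in_borel_probs)
    show "prob_space (point_measure \<Omega> (\<lambda>\<omega>. ennreal (q t \<omega>)))"
      by (rule prob_space_point_measure[OF fin\<Omega>])
        (use q_nonneg[OF t] q_sum in \<open>simp_all add: sum_ennreal\<close>)
    show "x \<in> measurable (point_measure \<Omega> (\<lambda>\<omega>. ennreal (q t \<omega>))) (borel_of_top X)" using x(1) by simp
  qed
  have \<Phi>_int: "(\<integral>y. h y \<partial>(\<Phi> t)) = (\<Sum>\<omega>\<in>\<Omega>. q t \<omega> * h (x \<omega>))"
    if t: "t \<in> C" and h: "continuous_map X euclideanreal h" for t h
  proof -
    have "(\<integral>y. h y \<partial>(\<Phi> t)) = (\<integral>\<omega>. h (x \<omega>) \<partial>(point_measure \<Omega> (\<lambda>\<omega>. ennreal (q t \<omega>))))"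
      unfolding \<Phi>_def
      by (rule integral_distr[OF _ continuous_map_measurable_real[OF h]]) (use x(1) in simp)
    also have "\<dots> = (\<Sum>\<omega>\<in>\<Omega>. q t \<omega> *\<^sub>R h (x \<omega>))"
      by (rule lebesgue_integral_point_measure_finite[OF fin\<Omega> q_nonneg[OF t]])
    finally show ?thesis by simp
  qed
  have contq: "continuous_on C (\<lambda>t. q t \<omega>)" for \<omega>
  proof -
    have c: "continuous_on C (\<lambda>t :: nat \<Rightarrow> real. t i)" for i
      by (rule continuous_on_subset[OF continuous_on_product_coordinates]) simp
    have "continuous_on C (\<lambda>t. p t b a)" for b a
    proof (cases "a = {}")
      case True
      then show ?thesis unfolding p_def by (simp, intro continuous_intros c)
    next
      case False
      then show ?thesis unfolding p_def by (simp, intro continuous_intros c)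
    qed
    then show ?thesis unfolding q_def by (intro continuous_on_prod)
  qed
  have \<Phi>_cont: "continuous_map (top_of_set C) ?Y \<Phi>"
  proof (rule continuous_map_into_weak_star)
    fix h assume h: "continuous_map X euclideanreal h"
    have "continuous_on C (\<lambda>t. \<Sum>\<omega>\<in>\<Omega>. q t \<omega> * h (x \<omega>))" by (intro continuous_intros contq)
    then have "continuous_map (top_of_set C) euclideanreal (\<lambda>t. \<Sum>\<omega>\<in>\<Omega>. q t \<omega> * h (x \<omega>))" by simp
    then show "continuous_map (top_of_set C) euclideanreal (\<lambda>t. \<integral>y. h y \<partial>(\<Phi> t))"
      by (rule continuous_map_eq) (simp add: \<Phi>_int[OF _ h])
  qed (use \<Phi>_prob in simp)
  have val: "(\<integral>y. pattern_fun T f (Kb b, a) y \<partial>((?S ^^ (b * R)) (\<Phi> t))) = p t b a"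
    if t: "t \<in> C" and b: "b \<in> W" and a: "a \<subseteq> Kb b" for t b a
  proof -
    have pat: "(Kb b, a) \<in> patterns R" using W(2)[OF b] a by (simp add: patterns_def)
    note contp = continuous_pattern_fun[OF T f pat]
    have "(\<integral>y. pattern_fun T f (Kb b, a) y \<partial>((?S ^^ (b * R)) (\<Phi> t)))
      = (\<integral>y. pattern_fun T f (Kb b, a) ((T ^^ (b * R)) y) \<partial>(\<Phi> t))"
      by (rule integral_funpow_push_forward[OF T \<Phi>_prob[OF t] contp])
    also have "\<dots> = (\<Sum>\<omega>\<in>\<Omega>. q t \<omega> * pattern_fun T f (Kb b, a) ((T ^^ (b * R)) (x \<omega>)))"
      using \<Phi>_int[OF t continuous_map_compose[OF continuous_map_funpow[OF T] contp]] by (simp add: o_def)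
    also have "\<dots> = (\<Sum>\<omega>\<in>\<Omega>. q t \<omega> * (if \<omega> b = a then 1 else 0))"
    proof (rule sum.cong[OF refl])
      fix \<omega> assume "\<omega> \<in> \<Omega>"
      then have \<omega>: "\<omega> b \<subseteq> Kb b" using b by (auto simp: \<Omega>_def PiE_iff)
      have fv: "f ((T ^^ s) ((T ^^ (b * R)) (x \<omega>))) = (if s \<in> \<omega> b then 1 else 0)" if "s \<in> Kb b" for s
        using x(2)[OF b that, of \<omega>] by (simp add: funpow_add add.commute)
      have fina: "finite a" "finite (Kb b - a)" using finK[OF b] a by (auto intro: finite_subset)
      have "pattern_fun T f (Kb b, a) ((T ^^ (b * R)) (x \<omega>)) =
        (\<Prod>s\<in>a. if s \<in> \<omega> b then 1 else 0) * (\<Prod>s\<in>Kb b - a. 1 - (if s \<in> \<omega> b then 1 else 0))"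
        unfolding pattern_fun_def prod.case
        by (intro arg_cong2[where f = "(*)"] prod.cong refl) (use fv a in auto)
      also have "\<dots> = (if \<omega> b = a then 1 else 0)"
      proof (cases "\<omega> b = a")
        case True
        then show ?thesis by (auto intro!: prod.neutral)
      next
        case False
        then obtain s where "s \<in> a \<and> s \<notin> \<omega> b \<or> s \<in> Kb b - a \<and> s \<in> \<omega> b" using \<omega> by blast
        then have "(\<Prod>s\<in>a. if s \<in> \<omega> b then 1 else (0::real)) = 0 \<or>
          (\<Prod>s\<in>Kb b - a. 1 - (if s \<in> \<omega> b then 1 else (0::real))) = 0"
          using fina by (elim disjE) (auto simp: prod_zero_iff)
        then show ?thesis using False by auto
      qed
      finally show "q t \<omega> * pattern_fun T f (Kb b, a) ((T ^^ (b * R)) (x \<omega>)) = q t \<omega> * (if \<omega> b = a then 1 else 0)"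
        by simp
    qed
    also have "\<dots> = p t b a" by (rule q_marginal[OF b a])
    finally show ?thesis .
  qed
  have "int d \<le> cover_dim ?Y (iterated_cover ?Y ?S ?\<A> n)"
  proof (rule cover_dim_lower_bound[OF finite_open_cover_iterated[OF foc continuous_map_push_forward[OF T]]])
    fix \<B> assume \<B>: "finite_open_cover ?Y \<B>" "finer_cover \<B> (iterated_cover ?Y ?S ?\<A> n)"
    define G where "G B = {t \<in> topspace (top_of_set C). \<Phi> t \<in> B}" for B
    have GC: "t \<in> C \<and> \<Phi> t \<in> B" if "t \<in> G B" for t B using that by (simp add: G_def)
    have "\<exists>t\<in>{t :: nat \<Rightarrow> real. \<forall>i. 0 \<le> t i \<and> t i \<le> 1}. d + 1 \<le> card {B\<in>\<B>. t \<in> G B}"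
    proof (rule cube_cover_multiplicity)
      show "finite \<B>" using \<B>(1) by (simp add: finite_open_cover_def)
      show "openin (top_of_set {t :: nat \<Rightarrow> real. \<forall>i. 0 \<le> t i \<and> t i \<le> 1}) (G B)" if "B \<in> \<B>" for B
        unfolding C_def[symmetric] G_def
        by (rule openin_continuous_map_preimage[OF \<Phi>_cont]) (use \<B>(1) that in \<open>simp add: finite_open_cover_def\<close>)
      show "{t :: nat \<Rightarrow> real. \<forall>i. 0 \<le> t i \<and> t i \<le> 1} \<subseteq> (\<Union>B\<in>\<B>. G B)"
        unfolding C_def[symmetric]
      proof
        fix t assume t: "t \<in> C"
        then have "\<Phi> t \<in> \<Union>\<B>" using \<Phi>_prob \<B>(1) by (simp add: finite_open_cover_def)
        then show "t \<in> (\<Union>B\<in>\<B>. G B)" using t by (auto simp: G_def)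
      qed
      fix B i t t' assume B: "B \<in> \<B>" and i: "i < d" and t: "t \<in> G B" "t' \<in> G B" "t i = 0"
      show "t' i \<noteq> 1"
      proof
        assume t'i: "t' i = 1"
        have "e i \<in> idx" using e i by (auto dest: bij_betwE)
        moreover obtain b a where "e i = (b, a)" by (cases "e i")
        ultimately have ba: "e i = (b, a)" "b \<in> W" "a \<subseteq> Kb b" "a \<noteq> {}"
          by (simp_all add: idx_def ne_def)
        have \<iota>i: "\<iota> (b, a) = i" using \<iota>[OF i] ba(1) by simp
        \<comment> \<open>A window with a nonempty pattern contains a time of J, so its start is
          below n and among the times seen by the iterated cover.\<close>
        obtain s where "s \<in> Kb b" using ba by blast
        then have "b * R + s < n" using W(4)[OF ba(2)] J by blast
        then have bn: "b * R < n" by simp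
        have "\<exists>U\<in>iterated_cover ?Y ?S ?\<A> n. B \<subseteq> U"
          using \<B>(2) B unfolding finer_cover_def by (rule bspec)
        then obtain U where U: "U \<in> iterated_cover ?Y ?S ?\<A> n" "B \<subseteq> U" by (elim bexE) (rule that)
        from U(1) obtain A where A: "\<forall>j<n. A j \<in> ?\<A>" "U = {\<mu> \<in> topspace ?Y. \<forall>j<n. (?S ^^ j) \<mu> \<in> A j}"
          unfolding in_iterated_cover_iff by (elim exE conjE) (rule that)
        have "A (b * R) \<in> ?\<A>" using A(1) bn by simp
        then obtain P where P: "A (b * R) = {\<mu> \<in> borel_probs X.
           (\<forall>p\<in>P. 0 < (\<integral>x. pattern_fun T f p x \<partial>\<mu>)) \<and>
           (\<forall>p\<in>patterns R - P. (\<integral>x. pattern_fun T f p x \<partial>\<mu>) < \<beta>)}"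
          unfolding pattern_cover_def by (elim imageE) (rule that)
        have pat: "(Kb b, a) \<in> patterns R" using W(2)[OF ba(2)] ba(3) by (simp add: patterns_def)
        have mem: "(?S ^^ (b * R)) (\<Phi> u) \<in> A (b * R)" if "u \<in> G B" for u
        proof -
          have "\<Phi> u \<in> U" using GC[OF that] U(2) by (elim conjE) (rule subsetD)
          then show ?thesis using A(2) bn by simp
        qed
        have v0: "(\<integral>y. pattern_fun T f (Kb b, a) y \<partial>((?S ^^ (b * R)) (\<Phi> t))) = 0"
          using val[OF _ ba(2,3), of t] GC[OF t(1)] t(3) ba(4) \<iota>i by (simp add: p_def)
        have v1: "(\<integral>y. pattern_fun T f (Kb b, a) y \<partial>((?S ^^ (b * R)) (\<Phi> t'))) = \<beta>"
          using val[OF _ ba(2,3), of t'] GC[OF t(2)] t'i ba(4) \<iota>i by (simp add: p_def)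
        show False
        proof (cases "(Kb b, a) \<in> P")
          case True
          then have "0 < (\<integral>y. pattern_fun T f (Kb b, a) y \<partial>((?S ^^ (b * R)) (\<Phi> t)))"
            using mem[OF t(1)] unfolding P by (elim CollectE conjE) (erule bspec, assumption)
          then show ?thesis using v0 by simp
        next
          case False
          then have "(Kb b, a) \<in> patterns R - P" using pat by simp
          then have "(\<integral>y. pattern_fun T f (Kb b, a) y \<partial>((?S ^^ (b * R)) (\<Phi> t'))) < \<beta>"
            using mem[OF t(2)] unfolding P by (elim CollectE conjE) (erule bspec, assumption)
          then show ?thesis using v1 by simp
        qed
      qed
    qed
    then have "\<exists>t\<in>C. d + 1 \<le> card {B\<in>\<B>. t \<in> G B}" by (simp only: C_def)
    then obtain t where t: "t \<in> C" "d + 1 \<le> card {B\<in>\<B>. t \<in> G B}" by (elim bexE) (rule that)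
    have "{B\<in>\<B>. t \<in> G B} = {B\<in>\<B>. \<Phi> t \<in> B}" using t(1) by (simp add: G_def)
    then show "\<exists>y\<in>topspace ?Y. d + 1 \<le> multiplicity_at \<B> y"
      using t \<Phi>_prob by (intro bexI[of _ "\<Phi> t"]) (simp_all add: multiplicity_at_def)
  qed
  then show ?thesis by (simp only: d_def \<beta>_def)
qed

section \<open>Choice of the windows and growth of the dimension\<close>

text \<open>Windows with fewer than k times of J contribute less than k each. There are at most n /
  R + 1 windows, the extra one for an incomplete end, so by the lower bounds on R and n these
  contribute at most 3 c n / 4. The remaining c n / 4 times lie in windows of at most R times
  each.\<close>

lemma dense_windows:
  fixes c :: real
  assumes J: "J \<subseteq> {..<n}" "c * real n \<le> real (card J)" and c: "0 < c"
    and R: "1 \<le> R" "2 * real k / c \<le> real R" and n: "4 * real k / c \<le> real n"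
  shows "\<exists>W Kb. finite W \<and> c * real n \<le> 4 * real R * real (card W) \<and>
    (\<forall>b\<in>W. Kb b \<subseteq> {..<R} \<and> card (Kb b) = k \<and> (\<forall>s\<in>Kb b. b * R + s \<in> J))"
proof -
  define S where "S b = {s. s < R \<and> b * R + s \<in> J}" for b
  define q where "q = n div R + 1"
  define W where "W = {b. b < q \<and> k \<le> card (S b)}"
  have finS: "finite (S b)" for b by (rule finite_subset[of _ "{..<R}"]) (auto simp: S_def)
  have cardS: "card (S b) \<le> R" for b
    using card_mono[of "{..<R}" "S b"] by (force simp: S_def)
  have "J \<subseteq> (\<lambda>(b, s). b * R + s) ` Sigma {..<q} S"
  proof
    fix j assume j: "j \<in> J"
    then have "j < n" using J(1) by auto
    then have "j div R < q" unfolding q_def using div_le_mono[of j n R] by simp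
    moreover have "j mod R \<in> S (j div R)" using j R(1) by (simp add: S_def)
    ultimately show "j \<in> (\<lambda>(b, s). b * R + s) ` Sigma {..<q} S"
      by (intro image_eqI[of _ _ "(j div R, j mod R)"]) simp_all
  qed
  then have "card J \<le> card (Sigma {..<q} S)"
    by (rule surj_card_le[rotated]) (use finS in auto)
  also have "\<dots> = (\<Sum>b<q. card (S b))" using finS by simp
  also have "\<dots> \<le> (\<Sum>b<q. if b \<in> W then R else k)"
    by (intro sum_mono) (use cardS in \<open>auto simp: W_def\<close>)
  also have "\<dots> \<le> (\<Sum>b<q. (if b \<in> W then R else 0) + k)" by (intro sum_mono) simp
  also have "\<dots> = card W * R + q * k"
  proof -
    have "(\<Sum>b<q. if b \<in> W then R else 0) = (\<Sum>b\<in>{..<q} \<inter> W. R)"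
      by (simp add: sum.If_cases)
    also have "{..<q} \<inter> W = W" by (auto simp: W_def)
    finally show ?thesis by (simp add: sum.distrib)
  qed
  finally have "real (card J) \<le> real (card W) * real R + real q * real k"
    by (simp flip: of_nat_mult of_nat_add)
  moreover have "real q * real k \<le> c * real n / 2 + c * real n / 4"
  proof -
    have "real (n div R) \<le> real n / real R" by (rule of_nat_div_le_of_nat)
    then have "real (n div R) * real k \<le> real n / real R * real k" by (rule mult_right_mono) simp
    also have "\<dots> \<le> c * real n / 2"
    proof -
      have "2 * real k \<le> c * real R" using R(2) c by (simp add: pos_divide_le_eq mult.commute)
      then have "real n * (2 * real k) \<le> real n * (c * real R)" by (rule mult_left_mono) simp
      then show ?thesis using R(1) by (simp add: field_simps)
    qed
    finally have "real (n div R) * real k \<le> c * real n / 2" .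
    moreover have "real k \<le> c * real n / 4" using n c by (simp add: pos_divide_le_eq mult.commute)
    ultimately show ?thesis by (simp add: q_def distrib_right)
  qed
  ultimately have main: "c * real n \<le> 4 * real R * real (card W)" using J(2) by (simp add: algebra_simps)
  have "\<exists>K. K \<subseteq> S b \<and> card K = k" if "b \<in> W" for b
    using that obtain_subset_with_card_n[of k "S b"] by (auto simp: W_def)
  then have "\<forall>b\<in>W. \<exists>K. K \<subseteq> S b \<and> card K = k" by simp
  then obtain Kb where "\<forall>b\<in>W. Kb b \<subseteq> S b \<and> card (Kb b) = k"
    unfolding bchoice_iff by (elim exE) (rule that)
  then have "\<forall>b\<in>W. Kb b \<subseteq> {..<R} \<and> card (Kb b) = k \<and> (\<forall>s\<in>Kb b. b * R + s \<in> J)"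
    by (fastforce simp: S_def)
  moreover have "finite W" by (simp add: W_def)
  ultimately show ?thesis using main by (intro exI conjI)
qed

text \<open>For k = 2 j this follows from (j + 1)^2 \<le> 2^(2 j), as soon as j \<ge> 2 a + b and j
  \<ge> 1.\<close>

lemma linear_below_exponential:
  fixes a b :: real
  assumes "0 \<le> a" "0 \<le> b"
  shows "\<exists>k\<ge>1. a * real k + b \<le> 2 ^ k - 1"
proof -
  define j where "j = nat \<lceil>2 * a + b\<rceil> + 1"
  have j: "2 * a + b \<le> real j" "1 \<le> j" unfolding j_def by linarith+
  have "j < 2 ^ j" by (rule less_exp)
  then have "j + 1 \<le> 2 ^ j" by linarith
  then have "real (j + 1) \<le> 2 ^ j" by (metis of_nat_le_iff of_nat_numeral of_nat_power)
  then have "real (j + 1) * real (j + 1) \<le> 2 ^ j * 2 ^ j" by (intro mult_mono) simp_all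
  moreover have "(2::real) ^ (2 * j) = 2 ^ j * 2 ^ j" by (simp add: mult_2 power_add)
  moreover have "real (j + 1) * real (j + 1) = real j * real j + 2 * real j + 1"
    by (simp add: algebra_simps)
  ultimately have *: "real j * real j + 2 * real j + 1 \<le> 2 ^ (2 * j)" by linarith
  have "a * real (2 * j) + b \<le> (2 * a + b) * real j"
    using assms j(2) mult_left_mono[of 1 "real j" b] by (simp add: algebra_simps)
  also have "\<dots> \<le> real j * real j" by (rule mult_right_mono[OF j(1)]) simp
  finally have "a * real (2 * j) + b \<le> 2 ^ (2 * j) - 1" using * by simp
  then show ?thesis using j(2) by (intro exI[of _ "2 * j"]) simp
qed

text \<open>The c n / (4 R) windows give the quotient the lower bound c (2^k - 1) / (4 R) with R
  about 2 k / c, which exceeds any given M for suitable k. The cover depends on M through k and R,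
  but not on n.\<close>

theorem mean_dim_infinite_if_positive_entropy:
  assumes X: "compact_space X" "metrizable_space X" and T: "continuous_map X X T"
    and pos: "top_entropy X T > 0"
  shows "mean_dim (prob_weak_star X) (push_forward X T) = \<infinity>"
  unfolding mean_dim_def
proof (rule SUP_PInfty)
  let ?Y = "prob_weak_star X" and ?S = "push_forward X T"
  fix M :: nat
  obtain f c where fc: "continuous_map X euclideanreal f \<and> 0 < c \<and>
    (\<exists>\<^sub>F n in sequentially. \<exists>J\<subseteq>{..<n}. c * real n \<le> real (card J) \<and> independent_times X T f J)"
    using positive_entropy_independence[OF X T pos] by (elim exE) (rule that)
  then have f: "continuous_map X euclideanreal f" and c: "0 < c" by simp_all
  have freq: "\<exists>\<^sub>F n in sequentially. \<exists>J\<subseteq>{..<n}. c * real n \<le> real (card J) \<and> independent_times X T f J"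
    using fc by (elim conjE)
  \<comment> \<open>This is 4 R M \<le> c (2^k - 1) with R replaced by its upper bound 2 k / c + 1
    and both sides divided by c.\<close>
  obtain k where k: "1 \<le> k" "8 * real M / c\<^sup>2 * real k + 4 * real M / c \<le> 2 ^ k - 1"
    using linear_below_exponential[of "8 * real M / c\<^sup>2" "4 * real M / c"] c by auto
  define R where "R = nat \<lceil>2 * real k / c\<rceil>"
  have R: "1 \<le> R" "2 * real k / c \<le> real R" "real R \<le> 2 * real k / c + 1"
  proof -
    have "0 < 2 * real k / c" using k(1) c by simp
    then show "1 \<le> R" "2 * real k / c \<le> real R" "real R \<le> 2 * real k / c + 1"
      unfolding R_def by linarith+
  qed
  define \<A> where "\<A> = pattern_cover X T f R (1 / 2 ^ k)"
  have foc: "finite_open_cover ?Y \<A>"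
    unfolding \<A>_def by (rule finite_open_cover_pattern_cover[OF T f]) simp
  define D where "D n = real_of_int (cover_dim ?Y (iterated_cover ?Y ?S \<A> n))" for n
  have MR: "4 * real R * real M \<le> c * (2 ^ k - 1)"
  proof -
    have "4 * real R * real M \<le> 4 * (2 * real k / c + 1) * real M"
      by (intro mult_right_mono mult_left_mono R(3)) simp_all
    also have "\<dots> = c * (8 * real M / c\<^sup>2 * real k + 4 * real M / c)"
      using c by (simp add: field_simps power2_eq_square)
    also have "\<dots> \<le> c * (2 ^ k - 1)" using k(2) c by (intro mult_left_mono) simp_all
    finally show ?thesis .
  qed
  have freq2: "\<exists>\<^sub>F n in sequentially. real M \<le> D n / real n"
  proof -
    obtain n0 :: nat where n0: "4 * real k / c \<le> real n0" using real_arch_simple by blast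
    have "\<exists>\<^sub>F n in sequentially. (\<exists>J\<subseteq>{..<n}. c * real n \<le> real (card J) \<and> independent_times X T f J)
      \<and> max 1 n0 \<le> n"
      using freq eventually_ge_at_top by (rule frequently_eventually_frequently)
    then show ?thesis
    proof (rule frequently_elim1, elim conjE exE)
      fix n J assume n: "max 1 n0 \<le> n" and J: "J \<subseteq> {..<n}" "c * real n \<le> real (card J)" "independent_times X T f J"
      have "4 * real k / c \<le> real n" using n0 n by simp
      from dense_windows[OF J(1,2) c R(1,2) this] obtain W Kb where WK:
        "finite W \<and> c * real n \<le> 4 * real R * real (card W) \<and>
        (\<forall>b\<in>W. Kb b \<subseteq> {..<R} \<and> card (Kb b) = k \<and> (\<forall>s\<in>Kb b. b * R + s \<in> J))"
        by (elim exE) (rule that)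
      have W: "finite W" "c * real n \<le> 4 * real R * real (card W)"
        and Kb: "\<forall>b\<in>W. Kb b \<subseteq> {..<R} \<and> card (Kb b) = k \<and> (\<forall>s\<in>Kb b. b * R + s \<in> J)"
        using WK[THEN conjunct1] WK[THEN conjunct2, THEN conjunct1] WK[THEN conjunct2, THEN conjunct2] .
      have "int (card W * (2 ^ k - 1)) \<le> cover_dim ?Y (iterated_cover ?Y ?S \<A> n)"
        unfolding \<A>_def
        by (rule pattern_cover_dim_lower[OF T f J(3,1) _ _ _ _ k(1), where W = W and Kb = Kb]) (use W(1) Kb in blast)+
      then have "real_of_int (int (card W * (2 ^ k - 1))) \<le> D n"
        unfolding D_def by (rule of_int_le_iff[THEN iffD2])
      moreover have "real (2 ^ k - 1) = 2 ^ k - 1" by simp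
      ultimately have Dn: "real (card W) * (2 ^ k - 1) \<le> D n"
        by (simp only: of_int_mult of_int_of_nat_eq of_nat_mult)
      have "c * real n * (4 * real R * real M) \<le> 4 * real R * real (card W) * (c * (2 ^ k - 1))"
        by (rule mult_mono[OF _ MR]) (use W(2) c in simp_all)
      also have "\<dots> \<le> 4 * real R * c * D n"
        using mult_left_mono[OF Dn, of "4 * real R * c"] c by (simp add: ac_simps)
      finally have "(4 * real R * c) * (real M * real n) \<le> (4 * real R * c) * D n" by (simp add: ac_simps)
      then have "real M * real n \<le> D n" using c R(1) by simp
      then show "real M \<le> D n / real n" using n by (simp add: pos_le_divide_eq)
    qed
  qed
  \<comment> \<open>Independence provides a point of X even for an empty set of times, and its Dirac
    measure lies in the space.\<close>
  have ne: "topspace ?Y \<noteq> {}"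
  proof
    assume e: "topspace ?Y = {}"
    have "topspace X = {}"
    proof (rule equals0I)
      fix x assume "x \<in> topspace X"
      from dirac_in_borel_probs[OF this] e show False by simp
    qed
    have no: "\<not> (\<exists>J\<subseteq>{..<n}. c * real n \<le> real (card J) \<and> independent_times X T f J)" for n
      using \<open>topspace X = {}\<close> by (simp add: independent_times_def)
    have "\<exists>\<^sub>F n::nat in sequentially. False"
      by (rule frequently_elim1[OF freq]) (erule notE[OF no])
    then show False by simp
  qed
  \<comment> \<open>The bound is available for infinitely many n only; convergence carries it over
    to the limit.\<close>
  have "convergent (\<lambda>n. D n / real n)"
    unfolding D_def
    by (rule cover_dim_iterated_convergent[OF compact_space_weak_star[OF X] completely_regular_weak_star ne foc
          continuous_map_push_forward[OF T]])
  then have lim: "(\<lambda>n. D n / real n) \<longlonglongrightarrow> lim (\<lambda>n. D n / real n)" by (rule convergent_LIMSEQ_iff[THEN iffD1])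
  have "real M \<le> lim (\<lambda>n. D n / real n)"
  proof (rule ccontr)
    assume "\<not> real M \<le> lim (\<lambda>n. D n / real n)"
    then have "\<forall>\<^sub>F n in sequentially. D n / real n < real M" by (intro order_tendstoD(2)[OF lim]) simp
    then have "\<forall>\<^sub>F n in sequentially. \<not> real M \<le> D n / real n" by eventually_elim simp
    then show False using freq2 by (simp add: frequently_def)
  qed
  then show "\<exists>\<A>\<in>{\<A>. finite_open_cover ?Y \<A>}. ereal (real M) \<le>
      ereal (lim (\<lambda>n. real_of_int (cover_dim ?Y (iterated_cover ?Y ?S \<A> n)) / real n))"
    using foc by (intro bexI[of _ \<A>]) (simp_all add: D_def)
qed

theorem mainTheorem1:
  fixes X :: "'a topology" and T :: "'a \<Rightarrow> 'a"
  assumes "compact_space X" and "metrizable_space X" and "continuous_map X X T"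
  shows "(top_entropy X T > 0 \<longrightarrow> mean_dim (prob_weak_star X) (push_forward X T) = \<infinity>)
    \<and> (top_entropy X T > 0 \<longleftrightarrow> mean_dim (prob_weak_star X) (push_forward X T) > 0)
    \<and> (mean_dim (prob_weak_star X) (push_forward X T) > 0
         \<longleftrightarrow> mean_dim (prob_weak_star X) (push_forward X T) = \<infinity>)"
proof (cases "top_entropy X T > 0")
  case True
  then show ?thesis using mean_dim_infinite_if_positive_entropy[OF assms] by simp
next
  case False
  then have "mean_dim (prob_weak_star X) (push_forward X T) \<le> 0"
    by (rule mean_dim_nonpos_if_zero_entropy[OF assms])
  then have "\<not> mean_dim (prob_weak_star X) (push_forward X T) > 0"
    "mean_dim (prob_weak_star X) (push_forward X T) \<noteq> \<infinity>" by auto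
  then show ?thesis using False by blast
qed

end
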